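(* Let $(M^n,g)$ be an $n$-dimensional closed Riemannian manifold with non-negative Ricci curvature, let $c>0$, and let $f:M\times[0,\infty)\to\mathbb{R}$ be a solution of $f_t=\Delta f+cf(1-f)$, $C^2$ in $x$ and $C^1$ in $t$, with $0<f<1$. Consider real constants $\alpha,\beta$ satisfying $$0<\alpha<1,\qquad \beta\le\frac{-cn(1+\alpha)}{4\alpha^2-4\alpha+2n}<0.\qquad( * )$$ If $0<\alpha<1$ and $\alpha\le n/4$, then there always exists $\beta$ satisfying $( * )$ and $\beta+c\ge0$. For any such $\alpha$ and $\beta$ (i.e. satisfying $( * )$, $\alpha\le n/4$ and $\beta+c\ge0$), put $$T_2:=\frac{n}{2(1-\alpha)(-\beta c)}\left(\frac{4\beta(1-\alpha)}{n}+c\right).$$ Then for all $x_1,x_2\in M$: (i) if $8\beta(1-\alpha)+cn<0$ and $t_2>t_1>0$, then $$\frac{f(x_2,t_2)}{f(x_1,t_1)}\ge\left(\frac{1-e^{-ct_2}}{1-e^{-ct_1}}\right)^{\frac{8\beta^2(1-\alpha)}{c^2n+8\beta c(1-\alpha)}}\exp\left(-\frac{d(x_1,x_2)^2}{4(1-\alpha)(t_2-t_1)}\right);$$ (ii) if $8\beta(1-\alpha)+cn>0$ and $t_2>t_1>T_2$, then $$\frac{f(x_2,t_2)}{f(x_1,t_1)}\ge\left[\frac{\left(1+\frac{8\beta(1-\alpha)}{cn}\right)e^{-c(t_2-T_2)}+1}{\left(1+\frac{8\beta(1-\alpha)}{cn}\right)e^{-c(t_1-T_2)}+1}\right]^{\frac{8\beta^2(1-\alpha)}{c(cn+8\beta(1-\alpha))}}\exp\left(-\frac{d(x_1,x_2)^2}{4(1-\alpha)(t_2-t_1)}\right);$$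 (iii) if $8\beta(1-\alpha)+cn=0$ and $t_2>t_1>T_2$, then $$\frac{f(x_2,t_2)}{f(x_1,t_1)}\ge\exp\left[-\frac{\beta}{c}\left(e^{-c(t_2-T_2)}-e^{-c(t_1-T_2)}\right)\right]\exp\left(-\frac{d(x_1,x_2)^2}{4(1-\alpha)(t_2-t_1)}\right).$$
   Context: Closed means compact without boundary (connected). $d(\cdot,\cdot)$ is the geodesic distance on $M$ and $\Delta$ the Laplace–Beltrami operator ($\Delta=\operatorname{div}\nabla$) in the space variable. *)

theory Defs
  imports "HOL-Analysis.Analysis"
begin

section \<open>Differentiation in Euclidean coordinates\<close>

definition partial_deriv :: "'n::finite \<Rightarrow> (real^'n \<Rightarrow> 'b::real_normed_vector) \<Rightarrow> real^'n \<Rightarrow> 'b" where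
  "partial_deriv i u y = frechet_derivative u (at y) (axis i 1)"

text \<open>To be used for open sets only: the derivatives are two-sided ones, while
  \<open>differentiable_on\<close> relativises to the set.\<close>

primrec Ck_on :: "nat \<Rightarrow> (real^'n::finite \<Rightarrow> 'b::real_normed_vector) \<Rightarrow> (real^'n) set \<Rightarrow> bool" where
  "Ck_on 0 u V \<longleftrightarrow> continuous_on V u"
| "Ck_on (Suc k) u V \<longleftrightarrow> u differentiable_on V \<and> (\<forall>i. Ck_on k (partial_deriv i u) V)"

definition smooth_on :: "(real^'n::finite \<Rightarrow> 'b::real_normed_vector) \<Rightarrow> (real^'n) set \<Rightarrow> bool" where
  "smooth_on u V \<longleftrightarrow> (\<forall>k. Ck_on k u V)"


section \<open>Closed Riemannian manifolds\<close>

text \<open>A chart is a pair of its domain and its coordinate map; the values of the coordinate map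
  outside the domain are irrelevant.  A metric assigns to every chart \<open>\<kappa>\<close> of the atlas the matrix
  function \<open>g \<kappa>\<close> of the coefficients \<open>g\<^sub>i\<^sub>j\<close>, defined on the image of the chart.\<close>

type_synonym ('a, 'n) chart = "'a set \<times> ('a \<Rightarrow> real^'n)"
type_synonym ('a, 'n) metric = "('a, 'n) chart \<Rightarrow> real^'n \<Rightarrow> real^'n^'n"

definition chart_dom :: "('a, 'n) chart \<Rightarrow> 'a set" where
  "chart_dom \<kappa> = fst \<kappa>"

definition chart_map :: "('a, 'n) chart \<Rightarrow> 'a \<Rightarrow> real^'n" where
  "chart_map \<kappa> = snd \<kappa>"

definition chart_img :: "('a, 'n) chart \<Rightarrow> (real^'n) set" where
  "chart_img \<kappa> = chart_map \<kappa> ` chart_dom \<kappa>"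

definition chart_inv :: "('a, 'n) chart \<Rightarrow> real^'n \<Rightarrow> 'a" where
  "chart_inv \<kappa> = inv_into (chart_dom \<kappa>) (chart_map \<kappa>)"

definition transition :: "('a, 'n) chart \<Rightarrow> ('a, 'n) chart \<Rightarrow> real^'n \<Rightarrow> real^'n" where
  "transition \<kappa> \<kappa>' = chart_map \<kappa>' \<circ> chart_inv \<kappa>"

text \<open>Here \<open>closed\<close> means compact, connected and without boundary; the last property holds since
  all charts are onto open subsets of the full Euclidean space.  The dimension is \<open>CARD('n)\<close>.
  The atlas need not be maximal.\<close>

locale closed_riemannian_manifold =
  fixes M :: "'a topology"
    and A :: "('a, 'n::finite) chart set"
    and g :: "('a, 'n) metric"
  assumes Hausdorff: "Hausdorff_space M"
    and second_countable: "second_countable M"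
    and compact: "compact_space M"
    and connected: "connected_space M"
    and charts_cover: "(\<Union>\<kappa>\<in>A. chart_dom \<kappa>) = topspace M"
    and chart_dom_open: "\<kappa> \<in> A \<Longrightarrow> openin M (chart_dom \<kappa>)"
    and chart_img_open: "\<kappa> \<in> A \<Longrightarrow> open (chart_img \<kappa>)"
    and chart_homeo: "\<kappa> \<in> A \<Longrightarrow>
      homeomorphic_map (subtopology M (chart_dom \<kappa>)) (top_of_set (chart_img \<kappa>)) (chart_map \<kappa>)"
    and transition_smooth: "\<kappa> \<in> A \<Longrightarrow> \<kappa>' \<in> A \<Longrightarrow>
      smooth_on (transition \<kappa> \<kappa>') (chart_map \<kappa> ` (chart_dom \<kappa> \<inter> chart_dom \<kappa>'))"
    and metric_smooth: "\<kappa> \<in> A \<Longrightarrow> smooth_on (g \<kappa>) (chart_img \<kappa>)"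
    and metric_sym: "\<kappa> \<in> A \<Longrightarrow> y \<in> chart_img \<kappa> \<Longrightarrow> transpose (g \<kappa> y) = g \<kappa> y"
    and metric_pos: "\<kappa> \<in> A \<Longrightarrow> y \<in> chart_img \<kappa> \<Longrightarrow> v \<noteq> 0 \<Longrightarrow> v \<bullet> (g \<kappa> y *v v) > 0"
    and metric_tensor: "\<kappa> \<in> A \<Longrightarrow> \<kappa>' \<in> A \<Longrightarrow> p \<in> chart_dom \<kappa> \<inter> chart_dom \<kappa>' \<Longrightarrow>
      J = matrix (frechet_derivative (transition \<kappa> \<kappa>') (at (chart_map \<kappa> p))) \<Longrightarrow>
      g \<kappa> (chart_map \<kappa> p) = transpose J ** g \<kappa>' (chart_map \<kappa>' p) ** J"


section \<open>Ricci curvature\<close>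

text \<open>The functions in this section and the next take the coefficient matrix of the metric in a
  single chart.\<close>

definition christoffel :: "(real^'n::finite \<Rightarrow> real^'n^'n) \<Rightarrow> 'n \<Rightarrow> 'n \<Rightarrow> 'n \<Rightarrow> real^'n \<Rightarrow> real" where
  "christoffel h k i j y = (1/2) * (\<Sum>l\<in>UNIV. matrix_inv (h y) $ k $ l *
     (partial_deriv i (\<lambda>z. h z $ j $ l) y + partial_deriv j (\<lambda>z. h z $ i $ l) y
      - partial_deriv l (\<lambda>z. h z $ i $ j) y))"

text \<open>\<open>riemann h l k i j\<close> is the component along \<open>\<partial>\<^sub>l\<close> of \<open>R(\<partial>\<^sub>i, \<partial>\<^sub>j) \<partial>\<^sub>k\<close>, where
  \<open>R(X,Y)Z = \<nabla>\<^sub>X \<nabla>\<^sub>Y Z - \<nabla>\<^sub>Y \<nabla>\<^sub>X Z - \<nabla>\<^bsub>[X,Y]\<^esub> Z\<close>, and \<open>Ric(Y,Z)\<close> is the trace of \<open>X \<mapsto> R(X,Y)Z\<close>;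
  with these signs round spheres have positive Ricci curvature.\<close>

definition riemann :: "(real^'n::finite \<Rightarrow> real^'n^'n) \<Rightarrow> 'n \<Rightarrow> 'n \<Rightarrow> 'n \<Rightarrow> 'n \<Rightarrow> real^'n \<Rightarrow> real" where
  "riemann h l k i j y =
     partial_deriv i (christoffel h l j k) y - partial_deriv j (christoffel h l i k) y
     + (\<Sum>m\<in>UNIV. christoffel h l i m y * christoffel h m j k y
                  - christoffel h l j m y * christoffel h m i k y)"

definition ricci :: "(real^'n::finite \<Rightarrow> real^'n^'n) \<Rightarrow> real^'n \<Rightarrow> real^'n^'n" where
  "ricci h y = (\<chi> j k. \<Sum>i\<in>UNIV. riemann h i k i j y)"

definition nonneg_ricci :: "('a, 'n::finite) chart set \<Rightarrow> ('a, 'n) metric \<Rightarrow> bool" where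
  "nonneg_ricci A g \<longleftrightarrow>
     (\<forall>\<kappa>\<in>A. \<forall>y\<in>chart_img \<kappa>. \<forall>v. v \<bullet> (ricci (g \<kappa>) y *v v) \<ge> 0)"


section \<open>Laplace--Beltrami operator\<close>

definition riem_grad :: "(real^'n::finite \<Rightarrow> real^'n^'n) \<Rightarrow> (real^'n \<Rightarrow> real) \<Rightarrow> real^'n \<Rightarrow> real^'n" where
  "riem_grad h u y = matrix_inv (h y) *v (\<chi> j. partial_deriv j u y)"

definition riem_div :: "(real^'n::finite \<Rightarrow> real^'n^'n) \<Rightarrow> (real^'n \<Rightarrow> real^'n) \<Rightarrow> real^'n \<Rightarrow> real" where
  "riem_div h X y =
     (\<Sum>i\<in>UNIV. partial_deriv i (\<lambda>z. sqrt (det (h z)) * X z $ i) y) / sqrt (det (h y))"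

definition laplace_beltrami :: "(real^'n::finite \<Rightarrow> real^'n^'n) \<Rightarrow> (real^'n \<Rightarrow> real) \<Rightarrow> real^'n \<Rightarrow> real" where
  "laplace_beltrami h u = riem_div h (riem_grad h u)"


section \<open>Geodesic distance\<close>

text \<open>By compatibility of the metric on overlaps, the speed does not depend on the chosen chart.\<close>

definition chart_at :: "('a, 'n) chart set \<Rightarrow> 'a \<Rightarrow> ('a, 'n) chart" where
  "chart_at A p = (SOME \<kappa>. \<kappa> \<in> A \<and> p \<in> chart_dom \<kappa>)"

definition speed :: "('a, 'n::finite) chart set \<Rightarrow> ('a, 'n) metric \<Rightarrow> (real \<Rightarrow> 'a) \<Rightarrow> real \<Rightarrow> real" where
  "speed A g \<gamma> s =
     (let \<kappa> = chart_at A (\<gamma> s); v = vector_derivative (chart_map \<kappa> \<circ> \<gamma>) (at s)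
      in sqrt (v \<bullet> (g \<kappa> (chart_map \<kappa> (\<gamma> s)) *v v)))"

definition C1_curve_on :: "('a, 'n::finite) chart set \<Rightarrow> real set \<Rightarrow> (real \<Rightarrow> 'a) \<Rightarrow> bool" where
  "C1_curve_on A I \<gamma> \<longleftrightarrow>
     (\<forall>\<kappa>\<in>A. let J = {s\<in>I. \<gamma> s \<in> chart_dom \<kappa>} in
        (\<forall>s\<in>J. (chart_map \<kappa> \<circ> \<gamma>) differentiable (at s within I)) \<and>
        continuous_on J (\<lambda>s. vector_derivative (chart_map \<kappa> \<circ> \<gamma>) (at s within I)))"

text \<open>Being \<open>C\<^sup>1\<close> on each closed piece (with one-sided derivatives at the end points), rather than
  only away from the break points as in \<open>piecewise_C1_differentiable_on\<close>, makes the speed bounded,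
  so that the integral below is never the default value for a non-integrable function.\<close>

definition piecewise_C1_curve :: "'a topology \<Rightarrow> ('a, 'n::finite) chart set \<Rightarrow> (real \<Rightarrow> 'a) \<Rightarrow> bool" where
  "piecewise_C1_curve M A \<gamma> \<longleftrightarrow>
     continuous_map (top_of_set {0..1}) M \<gamma> \<and>
     (\<exists>m::nat. \<exists>\<tau>::nat \<Rightarrow> real. \<tau> 0 = 0 \<and> \<tau> m = 1 \<and>
        (\<forall>i<m. \<tau> i < \<tau> (Suc i) \<and> C1_curve_on A {\<tau> i..\<tau> (Suc i)} \<gamma>))"

definition curve_length :: "('a, 'n::finite) chart set \<Rightarrow> ('a, 'n) metric \<Rightarrow> (real \<Rightarrow> 'a) \<Rightarrow> real" where
  "curve_length A g \<gamma> = integral {0..1} (speed A g \<gamma>)"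

definition geodesic_dist ::
  "'a topology \<Rightarrow> ('a, 'n::finite) chart set \<Rightarrow> ('a, 'n) metric \<Rightarrow> 'a \<Rightarrow> 'a \<Rightarrow> real" where
  "geodesic_dist M A g p q =
     Inf {curve_length A g \<gamma> |\<gamma>. piecewise_C1_curve M A \<gamma> \<and> \<gamma> 0 = p \<and> \<gamma> 1 = q}"


section \<open>Solutions of the Fisher equation\<close>

definition in_chart :: "('a, 'n::finite) chart \<Rightarrow> ('a \<Rightarrow> real \<Rightarrow> real) \<Rightarrow> real \<Rightarrow> real^'n \<Rightarrow> real" where
  "in_chart \<kappa> f t y = f (chart_inv \<kappa> y) t"

text \<open>The class \<open>C\<^sup>2\<^sup>,\<^sup>1\<close> of functions on \<open>M \<times> [0,\<infinity>)\<close>: the derivatives up to second order in space and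
  of first order in time (one-sided at time \<open>0\<close>) exist and are jointly continuous.\<close>

definition C2_1 :: "('a, 'n::finite) chart set \<Rightarrow> ('a \<Rightarrow> real \<Rightarrow> real) \<Rightarrow> bool" where
  "C2_1 A f \<longleftrightarrow>
     (\<forall>\<kappa>\<in>A. let V = chart_img \<kappa>; u = in_chart \<kappa> f in
        (\<forall>t\<ge>0. Ck_on 2 (u t) V) \<and>
        (\<forall>y\<in>V. \<forall>t\<ge>0. (\<lambda>s. u s y) differentiable (at t within {0..})) \<and>
        continuous_on (V \<times> {0..}) (\<lambda>(y, t). u t y) \<and>
        (\<forall>i. continuous_on (V \<times> {0..}) (\<lambda>(y, t). partial_deriv i (u t) y)) \<and>
        (\<forall>i j. continuous_on (V \<times> {0..}) (\<lambda>(y, t). partial_deriv i (partial_deriv j (u t)) y)) \<and>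
        continuous_on (V \<times> {0..}) (\<lambda>(y, t). vector_derivative (\<lambda>s. u s y) (at t within {0..})))"

definition fisher_solution ::
  "('a, 'n::finite) chart set \<Rightarrow> ('a, 'n) metric \<Rightarrow> real \<Rightarrow> ('a \<Rightarrow> real \<Rightarrow> real) \<Rightarrow> bool" where
  "fisher_solution A g c f \<longleftrightarrow>
     C2_1 A f \<and>
     (\<forall>\<kappa>\<in>A. \<forall>p\<in>chart_dom \<kappa>. \<forall>t\<ge>0.
        (f p has_real_derivative
           laplace_beltrami (g \<kappa>) (in_chart \<kappa> f t) (chart_map \<kappa> p) + c * f p t * (1 - f p t))
          (at t within {0..}))"


section \<open>Constants\<close>

definition admissible :: "real \<Rightarrow> real \<Rightarrow> real \<Rightarrow> real \<Rightarrow> bool" where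
  "admissible n c \<alpha> \<beta> \<longleftrightarrow>
     0 < \<alpha> \<and> \<alpha> < 1 \<and>
     \<beta> \<le> - c * n * (1 + \<alpha>) / (4 * \<alpha>^2 - 4 * \<alpha> + 2 * n) \<and>
     - c * n * (1 + \<alpha>) / (4 * \<alpha>^2 - 4 * \<alpha> + 2 * n) < 0"

definition T2 :: "real \<Rightarrow> real \<Rightarrow> real \<Rightarrow> real \<Rightarrow> real" where
  "T2 n c \<alpha> \<beta> = n / (2 * (1 - \<alpha>) * (- \<beta> * c)) * (4 * \<beta> * (1 - \<alpha>) / n + c)"

end

(* Put l = ln f and H = l_t - (1 - alpha) |grad l|^2 - c + (beta + c) f + phi(t).  The differential
   Harnack inequality H >= 0 integrates along curves to the claim.  It is obtained from the maximum
   principle, with phi solving a Riccati equation for which the remaining quadratic in f is a square.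

   Since f is only C^2 in space, H cannot be differentiated.  At a minimum point, |grad l|^2 is
   therefore linearised: - (1 - alpha) |grad l|^2 <= - <W, grad l> + |W|^2 / (4 (1 - alpha)) for every
   vector field W, with equality at the minimum point for a suitable value of W there.  Now only the
   directional derivative l_t - <W, grad l> is left; it is replaced by a difference quotient, which is
   C^2, and the step size is sent to 0 after the second order minimum conditions have been applied.
   Choosing the covariant derivative of W at the point to be kappa times the identity reproduces the
   Bochner inequality, and kappa = 2 (1 - alpha) (Laplacian of l) / n is optimal. *)

theory Submission
  imports Defs "HOL-Real_Asymp.Real_Asymp"
begin

section \<open>Positive semidefinite matrices and strict derivatives\<close>

text \<open>By the equation, l_t is the Laplacian of l plus |grad l|^2 + c (1 - f), so H is the
  Laplacian of l plus \<alpha> |grad l|^2 + \<beta> f + \<phi>. The upper bound on \<beta> in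
  \<open>admissible\<close> says that the coefficient of f |grad l|^2, as it appears at a negative
  minimum of H, is nonnegative. The condition \<beta> + c \<ge> 0 enters when H \<ge> 0 is read as a
  lower bound for l_t: as f < 1, the part - c + (\<beta> + c) f is at most \<beta>, and the rate
  \<beta> + \<phi> that is left is integrated explicitly. With a = 2 (1 - \<alpha>) / n, the three
  cases are the signs of c + 4 a \<beta>, which is also the sign of the quadratic coefficient in the
  Riccati equation for \<phi> + \<beta>. If it is negative, some solution comes down from infinity
  at time 0 and so dominates all initial values. Otherwise no solution comes down from infinity.
  Then the barrier 1 / (a t) is used first; it works precisely up to time \<open>T2\<close>, where
  it meets the Riccati solution that continues it.\<close>

lemma matrix_inner_alt:
  fixes A B :: "real^'n^'m"
  shows "A \<bullet> B = (\<Sum>i\<in>UNIV. \<Sum>j\<in>UNIV. A $ i $ j * B $ i $ j)"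
  by (simp add: inner_vec_def)

lemma matrix_inner_transpose: "transpose A \<bullet> transpose B = A \<bullet> (B :: real^'n^'m)"
  unfolding matrix_inner_alt transpose_def by (simp, rule sum.swap)

lemma inner_matrix_vector:
  fixes B :: "real^'n^'m"
  shows "v \<bullet> (B *v w) = (\<Sum>i\<in>UNIV. \<Sum>j\<in>UNIV. v $ i * B $ i $ j * w $ j)"
  by (simp add: inner_vec_def matrix_vector_mult_def sum_distrib_left mult.assoc)

text \<open>On the vector e_i + s e_j the form is B_jj s^2 + 2 s B_ij; this is nonnegative for all s
  only if the linear term vanishes.\<close>

lemma psd_zero_diagonal:
  fixes B :: "real^'n^'n"
  assumes psd: "\<And>v. v \<bullet> (B *v v) \<ge> 0" and sym: "transpose B = B" and z: "B $ i $ i = 0"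
  shows "B $ i $ j = 0"
proof -
  have sj: "B $ j $ i = B $ i $ j"
    by (metis sym transpose_def vec_lambda_beta)
  have *: "B $ j $ j * s^2 + 2 * s * B $ i $ j \<ge> 0" for s
  proof -
    define v where "v = axis i 1 + s *\<^sub>R (axis j 1 :: real^'n)"
    have "v \<bullet> (B *v v) = B $ j $ j * s^2 + 2 * s * B $ i $ j"
      unfolding v_def
      by (simp add: matrix_vector_right_distrib matrix_vector_mult_scaleR inner_add_left inner_add_right
          matrix_vector_mult_basis column_def inner_axis' z sj power2_eq_square algebra_simps)
    then show ?thesis using psd[of v] by simp
  qed
  show ?thesis
  proof (cases "B $ j $ j = 0")
    case True
    then show ?thesis using *[of "1"] *[of "-1"] by simp
  next
    case False
    then have p: "B $ j $ j > 0" using psd[of "axis j 1"]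
      by (simp add: matrix_vector_mult_basis column_def inner_axis')
    \<comment> \<open>The minimiser of the quadratic in s, where its value is - B_ij^2 /
      B_jj.\<close>
    then show ?thesis using *[of "- B $ i $ j / B $ j $ j"]
      by (simp add: field_simps power2_eq_square) (metis mult_eq_0_iff not_real_square_gt_zero not_less)
  qed
qed

text \<open>Induction by Schur complements, which avoids diagonalisation. Let b be the i-th row of
  \<open>B\<close> and d its diagonal entry. Subtracting the rank-one matrix b b^T / d leaves a
  positive semidefinite matrix with more zeros on the diagonal, and the rank-one part pairs with
  \<open>a\<close> to a value of the quadratic form of \<open>a\<close>.\<close>

lemma psd_inner_psd_sym:
  fixes a B :: "real^'n^'n"
  assumes a: "\<And>v. v \<bullet> (a *v v) \<ge> 0"
  shows "transpose B = B \<Longrightarrow> (\<And>v. v \<bullet> (B *v v) \<ge> 0) \<Longrightarrow> a \<bullet> B \<ge> 0"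
proof (induction "card {i. B $ i $ i \<noteq> 0}" arbitrary: B rule: less_induct)
  case less
  note sym = less.prems(1) and psd = less.prems(2)
  have sB: "B $ j $ i = B $ i $ j" for i j
    by (metis sym transpose_def vec_lambda_beta)
  show ?case
  proof (cases "\<exists>i. B $ i $ i \<noteq> 0")
    case False
    then have "B = 0"
      using psd_zero_diagonal[OF psd sym] by (simp add: vec_eq_iff)
    then show ?thesis by simp
  next
    case True
    then obtain i where i: "B $ i $ i \<noteq> 0" by blast
    define d where "d = B $ i $ i"
    have d: "d > 0" using i psd[of "axis i 1"] unfolding d_def
      by (simp add: matrix_vector_mult_basis column_def inner_axis')
    define C where "C = (\<chi> p q. B $ p $ q - B $ p $ i * B $ i $ q / d)"
    have Csym: "transpose C = C"
      unfolding C_def transpose_def by (simp add: vec_eq_iff sB mult.commute)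
    have Cv: "v \<bullet> (C *v v) = v \<bullet> (B *v v) - (B $ i \<bullet> v)^2 / d" for v
    proof -
      have "v \<bullet> (C *v v) = v \<bullet> (B *v v) - (\<Sum>p\<in>UNIV. \<Sum>q\<in>UNIV. (B $ i $ p * v $ p) * (B $ i $ q * v $ q)) / d"
        unfolding inner_matrix_vector C_def
        by (simp add: algebra_simps sum_subtractf sum_divide_distrib sB)
      also have "(\<Sum>p\<in>UNIV. \<Sum>q\<in>UNIV. (B $ i $ p * v $ p) * (B $ i $ q * v $ q)) = (B $ i \<bullet> v)^2"
        by (simp add: inner_vec_def power2_eq_square sum_product)
      finally show ?thesis .
    qed
    have Cpsd: "v \<bullet> (C *v v) \<ge> 0" for v
    proof -
      \<comment> \<open>This \<open>s\<close> minimises the form of \<open>B\<close> along v - s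
        e_i, and the minimum is the form of the Schur complement at v.\<close>
      define s where "s = (B $ i \<bullet> v) / d"
      define u where "u = v - s *\<^sub>R axis i 1"
      have Bi: "(B *v v) $ i = B $ i \<bullet> v" for v
        by (simp add: matrix_vector_mult_def inner_vec_def)
      have vB: "v \<bullet> (B *v axis i 1) = B $ i \<bullet> v"
        by (simp add: matrix_vector_mult_basis column_def inner_vec_def sB mult.commute)
      have eB: "axis i 1 \<bullet> (B *v x) = B $ i \<bullet> x" for x
        by (simp add: inner_axis' Bi)
      have Be: "B $ i \<bullet> axis i 1 = d" by (simp add: inner_axis d_def)
      have "u \<bullet> (B *v u) = v \<bullet> (B *v v) - 2 * s * (B $ i \<bullet> v) + s^2 * d"
        unfolding u_def matrix_vector_mult_diff_distrib matrix_vector_mult_scaleR inner_diff_left inner_diff_right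
          inner_scaleR_left inner_scaleR_right vB eB Be
        by (simp add: power2_eq_square algebra_simps)
      also have "\<dots> = v \<bullet> (C *v v)"
        unfolding Cv s_def using d by (simp add: field_simps power2_eq_square)
      finally show ?thesis using psd[of u] by simp
    qed
    have "{j. C $ j $ j \<noteq> 0} \<subset> {j. B $ j $ j \<noteq> 0}"
    proof
      show "{j. C $ j $ j \<noteq> 0} \<subseteq> {j. B $ j $ j \<noteq> 0}"
      proof clarify
        fix j assume "C $ j $ j \<noteq> 0" "B $ j $ j = 0"
        then show False using psd_zero_diagonal[OF psd sym, of j i] by (simp add: C_def)
      qed
      have "C $ i $ i = 0" using d by (simp add: C_def d_def)
      then show "{j. C $ j $ j \<noteq> 0} \<noteq> {j. B $ j $ j \<noteq> 0}" using i by blast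
    qed
    then have "card {j. C $ j $ j \<noteq> 0} < card {j. B $ j $ j \<noteq> 0}"
      by (intro psubset_card_mono) auto
    from less.hyps[OF this Csym Cpsd] have "a \<bullet> C \<ge> 0" .
    moreover have "a \<bullet> B = a \<bullet> C + (B $ i) \<bullet> (a *v (B $ i)) / d"
      unfolding inner_matrix_vector C_def matrix_inner_alt
      by (simp add: algebra_simps sum_subtractf sum_divide_distrib sB)
    ultimately show ?thesis using a[of "B $ i"] d by simp
  qed
qed

text \<open>Pairing with a symmetric \<open>a\<close> sees only the symmetric part of
  \<open>B\<close>. In this form Jacobian matrices of gradients can be inserted for
  \<open>B\<close>, whatever their symmetry.\<close>

lemma psd_inner_psd:
  fixes a B :: "real^'n^'n"
  assumes a: "\<And>v. v \<bullet> (a *v v) \<ge> 0" and sa: "transpose a = a"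
    and B: "\<And>v. v \<bullet> (B *v v) \<ge> 0"
  shows "a \<bullet> B \<ge> 0"
proof -
  have "v \<bullet> (transpose B *v v) = v \<bullet> (B *v v)" for v
    by (metis dot_lmul_matrix inner_commute transpose_matrix_vector)
  then have "v \<bullet> ((B + transpose B) *v v) \<ge> 0" for v
    using B[of v] by (simp add: matrix_vector_mult_add_rdistrib inner_add_right)
  moreover have "transpose (B + transpose B) = B + transpose B"
    by (simp add: transpose_def vec_eq_iff)
  ultimately have "a \<bullet> (B + transpose B) \<ge> 0"
    by (intro psd_inner_psd_sym[OF a])
  moreover have "a \<bullet> transpose B = a \<bullet> B"
    by (metis matrix_inner_transpose sa)
  ultimately show ?thesis by (simp add: inner_add_right)
qed

section \<open>Strict differentiability of continuously differentiable functions\<close>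

definition C1_gradient :: "('a::real_inner) set \<Rightarrow> ('a \<Rightarrow> real) \<Rightarrow> ('a \<Rightarrow> 'a) \<Rightarrow> bool" where
  "C1_gradient S F D \<longleftrightarrow> (\<forall>z\<in>S. (F has_derivative (\<lambda>h. D z \<bullet> h)) (at z)) \<and> continuous_on S D"

text \<open>Base point and direction of the difference quotient may both move. This is needed
  because the quotients will be taken at minimum points that depend on the step size.\<close>

definition strict_derivative ::
  "('a::real_normed_vector \<Rightarrow> 'b::real_normed_vector) \<Rightarrow> ('a \<Rightarrow> 'b) \<Rightarrow> 'a \<Rightarrow> bool" where
  "strict_derivative F F' z \<longleftrightarrow> (\<forall>p v v0 \<tau>. p \<longlonglongrightarrow> z \<longrightarrow> v \<longlonglongrightarrow> v0 \<longrightarrow> \<tau> \<longlonglongrightarrow> 0 \<longrightarrow> (\<forall>k::nat. \<tau> k \<noteq> (0::real)) \<longrightarrow>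
     (\<lambda>k. (F (p k + \<tau> k *\<^sub>R v k) - F (p k)) /\<^sub>R \<tau> k) \<longlonglongrightarrow> F' v0)"

lemma strict_derivativeD:
  assumes "strict_derivative F F' z" "p \<longlonglongrightarrow> z" "v \<longlonglongrightarrow> v0" "\<tau> \<longlonglongrightarrow> 0" "\<And>k::nat. \<tau> k \<noteq> (0::real)"
  shows "(\<lambda>k. (F (p k + \<tau> k *\<^sub>R v k) - F (p k)) /\<^sub>R \<tau> k) \<longlonglongrightarrow> F' v0"
  using assms unfolding strict_derivative_def by blast

text \<open>By the mean value theorem on the segment from p to p + \<tau> v, the quotient is the
  gradient at an intermediate point \<xi>, applied to v. The points \<xi> converge to z, and the
  gradient is continuous there.\<close>

lemma C1_gradient_strict:
  assumes C1: "C1_gradient S F D" and S: "open S" "z \<in> S"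
  shows "strict_derivative F (\<lambda>h. D z \<bullet> h) z"
  unfolding strict_derivative_def
proof (intro allI impI)
  fix p v :: "nat \<Rightarrow> 'a" and v0 and \<tau> :: "nat \<Rightarrow> real"
  assume p: "p \<longlonglongrightarrow> z" and v: "v \<longlonglongrightarrow> v0" and \<tau>: "\<tau> \<longlonglongrightarrow> 0" and nz: "\<forall>k. \<tau> k \<noteq> 0"
  obtain r where r: "r > 0" "ball z r \<subseteq> S" using S openE by blast
  define q where "q k = p k + \<tau> k *\<^sub>R v k" for k
  have q: "q \<longlonglongrightarrow> z + 0 *\<^sub>R v0" unfolding q_def by (intro tendsto_intros p v \<tau>)
  have ex: "\<exists>s\<in>{0..1}. F (q k) - F (p k) = D (p k + s *\<^sub>R (q k - p k)) \<bullet> (q k - p k)"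
    if "p k \<in> ball z r" "q k \<in> ball z r" for k
  proof -
    have seg: "p k + s *\<^sub>R (q k - p k) \<in> S" if "0 \<le> s" "s \<le> 1" for s
    proof -
      have "p k + s *\<^sub>R (q k - p k) = (1 - s) *\<^sub>R p k + s *\<^sub>R q k" by (simp add: algebra_simps)
      also have "\<dots> \<in> ball z r"
        using convexD[OF convex_ball, of "p k" z r "q k" "1 - s" s] \<open>p k \<in> ball z r\<close> \<open>q k \<in> ball z r\<close> that by auto
      finally show ?thesis using r by blast
    qed
    have "\<exists>s. s > 0 \<and> s < 1 \<and> F (p k + 1 *\<^sub>R (q k - p k)) - F (p k + 0 *\<^sub>R (q k - p k)) = (1 - 0) * (D (p k + s *\<^sub>R (q k - p k)) \<bullet> (q k - p k))"
    proof (rule MVT2)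
      fix s :: real assume s: "0 \<le> s" "s \<le> 1"
      have "(F has_derivative (\<lambda>h. D (p k + s *\<^sub>R (q k - p k)) \<bullet> h)) (at (p k + s *\<^sub>R (q k - p k)))"
        using C1 seg[OF s] unfolding C1_gradient_def by blast
      then have "((\<lambda>s. F (p k + s *\<^sub>R (q k - p k))) has_derivative (\<lambda>h. D (p k + s *\<^sub>R (q k - p k)) \<bullet> (h *\<^sub>R (q k - p k)))) (at s)"
        by (rule has_derivative_compose[rotated]) (auto intro!: derivative_eq_intros)
      then show "((\<lambda>s. F (p k + s *\<^sub>R (q k - p k))) has_real_derivative D (p k + s *\<^sub>R (q k - p k)) \<bullet> (q k - p k)) (at s)"
        unfolding has_field_derivative_def by (simp add: mult.commute[of _ "_ \<bullet> _"])
    qed auto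
    then show ?thesis by force
  qed
  have "\<exists>s. \<forall>k. p k \<in> ball z r \<longrightarrow> q k \<in> ball z r \<longrightarrow>
     s k \<in> {0..1} \<and> F (q k) - F (p k) = D (p k + s k *\<^sub>R (q k - p k)) \<bullet> (q k - p k)"
    by (rule choice) (use ex in blast)
  then obtain s where s: "\<And>k. p k \<in> ball z r \<Longrightarrow> q k \<in> ball z r \<Longrightarrow>
     s k \<in> {0..1} \<and> F (q k) - F (p k) = D (p k + s k *\<^sub>R (q k - p k)) \<bullet> (q k - p k)" by blast
  \<comment> \<open>Where no mean value point is available, \<xi> is p. This concerns finitely many
    indices only, since p and q converge to the centre of the ball.\<close>
  define \<xi> where "\<xi> k = p k + (if p k \<in> ball z r \<and> q k \<in> ball z r then s k else 0) *\<^sub>R (q k - p k)" for k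
  have d0: "(\<lambda>k. norm (q k - p k)) \<longlonglongrightarrow> 0"
    using tendsto_norm[OF tendsto_diff[OF q p]] by simp
  have "(\<lambda>k. \<xi> k - p k) \<longlonglongrightarrow> 0"
  proof (rule Lim_null_comparison[OF _ d0], rule always_eventually, rule allI)
    fix k show "norm (\<xi> k - p k) \<le> norm (q k - p k)"
      unfolding \<xi>_def using s[of k] by (auto intro: mult_left_le_one_le)
  qed
  from tendsto_add[OF p this] have \<xi>: "\<xi> \<longlonglongrightarrow> z" by simp
  have "isCont D z" using C1 S unfolding C1_gradient_def by (simp add: continuous_on_eq_continuous_at)
  then have D: "(\<lambda>k. D (\<xi> k)) \<longlonglongrightarrow> D z" using \<xi> by (rule isCont_tendsto_compose)
  have "(\<lambda>k. D (\<xi> k) \<bullet> v k) \<longlonglongrightarrow> D z \<bullet> v0" by (intro tendsto_intros D v)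
  moreover have "\<forall>\<^sub>F k in sequentially. D (\<xi> k) \<bullet> v k = (F (p k + \<tau> k *\<^sub>R v k) - F (p k)) /\<^sub>R \<tau> k"
  proof -
    have "\<forall>\<^sub>F k in sequentially. p k \<in> ball z r" "\<forall>\<^sub>F k in sequentially. q k \<in> ball z r"
      using topological_tendstoD[OF p, of "ball z r"] topological_tendstoD[OF q, of "ball z r"] r by auto
    then show ?thesis
    proof eventually_elim
      case (elim k)
      then show ?case using s[of k] nz[rule_format, of k] unfolding \<xi>_def q_def by simp
    qed
  qed
  ultimately show "(\<lambda>k. (F (p k + \<tau> k *\<^sub>R v k) - F (p k)) /\<^sub>R \<tau> k) \<longlonglongrightarrow> D z \<bullet> v0"
    by (rule Lim_transform_eventually)
qed

lemma strict_derivative_vec: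
  fixes F :: "'a::real_normed_vector \<Rightarrow> ('b::real_normed_vector)^'n::finite"
  assumes "\<And>i. strict_derivative (\<lambda>z. F z $ i) (F' i) z"
  shows "strict_derivative F (\<lambda>h. \<chi> i. F' i h) z"
  using assms unfolding strict_derivative_def by (auto intro!: vec_tendstoI)

text \<open>A space derivative at each fixed time, together with a time derivative that is jointly
  continuous, gives a joint derivative. Convexity of the time set serves the mean value argument in
  time.\<close>

lemma joint_C1_gradient:
  fixes l :: "'a::euclidean_space \<Rightarrow> real \<Rightarrow> real"
  assumes V: "open V" and T: "open T" "convex T"
    and Dl: "\<And>y t. y \<in> V \<Longrightarrow> t \<in> T \<Longrightarrow> ((\<lambda>y. l y t) has_derivative (\<lambda>v. Dl y t \<bullet> v)) (at y)"
    and lt: "\<And>y t. y \<in> V \<Longrightarrow> t \<in> T \<Longrightarrow> (l y has_real_derivative lt y t) (at t)"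
    and cD: "continuous_on (V \<times> T) (\<lambda>(y, t). Dl y t)"
    and ct: "continuous_on (V \<times> T) (\<lambda>(y, t). lt y t)"
  shows "C1_gradient (V \<times> T) (\<lambda>(y, t). l y t) (\<lambda>(y, t). (Dl y t, lt y t))"
  unfolding C1_gradient_def
proof
  show "continuous_on (V \<times> T) (\<lambda>(y, t). (Dl y t, lt y t))"
    using continuous_on_Pair[OF cD ct] by (simp add: case_prod_beta')
  show "\<forall>z\<in>V \<times> T. ((\<lambda>(y, t). l y t) has_derivative (\<lambda>h. (case z of (y, t) \<Rightarrow> (Dl y t, lt y t)) \<bullet> h)) (at z)"
  proof clarify
    fix y t assume y: "y \<in> V" "t \<in> T"
    have "((\<lambda>(y, t). l y t) has_derivative (\<lambda>(tx, ty). Dl y t \<bullet> tx + blinfun_scaleR_left (lt y t) ty)) (at (y, t) within V \<times> T)"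
    proof (rule has_derivative_partialsI)
      show "((\<lambda>x. l x t) has_derivative (\<bullet>) (Dl y t)) (at y within V)"
        using Dl[OF y] by (rule has_derivative_at_withinI)
      show "(l x has_derivative blinfun_apply (blinfun_scaleR_left (lt x s))) (at s within T)" if "x \<in> V" "s \<in> T" for x s
        using has_derivative_at_withinI[OF lt[OF that, unfolded has_field_derivative_def]]
        by (simp add: mult.commute[of _ "lt x s"])
      have "isCont (\<lambda>(y, t). lt y t) (y, t)"
        using ct y V T by (simp add: continuous_on_eq_continuous_at open_Times)
      then have "isCont (\<lambda>z. blinfun_scaleR_left (case z of (y, t) \<Rightarrow> lt y t)) (y, t)"
        by (intro bounded_linear.isCont[OF bounded_linear_blinfun_scaleR_left]) 
      then show "continuous (at (y, t) within V \<times> T) (\<lambda>(x, y). blinfun_scaleR_left (lt x y))"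
        by (simp add: case_prod_beta' continuous_at_imp_continuous_at_within)
    qed (use y T in auto)
    moreover have "at (y, t) within V \<times> T = at (y, t)"
      using y V T by (intro at_within_open) (auto simp: open_Times)
    moreover have "(\<lambda>(tx, ty). Dl y t \<bullet> tx + blinfun_scaleR_left (lt y t) ty) = (\<lambda>h. (Dl y t, lt y t) \<bullet> h)"
      by (auto simp: fun_eq_iff inner_prod_def mult.commute)
    ultimately show "((\<lambda>(y, t). l y t) has_derivative (\<lambda>h. (Dl y t, lt y t) \<bullet> h)) (at (y, t))"
      by simp
  qed
qed

text \<open>If \<open>g2\<close> were negative, \<open>g1\<close> would be negative just to the
  right of 0, and the mean value theorem would give a value of \<open>g\<close> below
  \<open>g 0\<close>.\<close>

lemma second_derivative_test:
  fixes g :: "real \<Rightarrow> real"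
  assumes d: "d > 0" and g: "\<And>s. \<bar>s\<bar> < d \<Longrightarrow> (g has_real_derivative g1 s) (at s)"
    and g1: "(g1 has_real_derivative g2) (at 0)"
    and min: "\<And>s. \<bar>s\<bar> < d \<Longrightarrow> g 0 \<le> g s"
  shows "g1 0 = 0" "g2 \<ge> 0"
proof -
  show z: "g1 0 = 0"
    using DERIV_local_min[OF g[of 0] d] d min by auto
  show "g2 \<ge> 0"
  proof (rule ccontr)
    assume "\<not> g2 \<ge> 0"
    then have "g2 < 0" by simp
    from DERIV_neg_dec_right[OF g1 this] obtain e where e: "e > 0" "\<And>h. 0 < h \<Longrightarrow> h < e \<Longrightarrow> g1 h < g1 0"
      by auto
    define m where "m = min d e / 2"
    have m: "0 < m" "m < d" "m < e" using d e by (auto simp: m_def min_def field_simps)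
    have "\<exists>s. s > 0 \<and> s < m \<and> g m - g 0 = (m - 0) * g1 s"
      by (rule MVT2) (use m g in auto)
    then obtain s where s: "s > 0" "s < m" "g m - g 0 = m * g1 s" by auto
    have "g1 s < 0" using e(2)[of s] s m z by auto
    then have "m * g1 s < 0" using m by (simp add: mult_pos_neg)
    then show False using s min[of m] m by auto
  qed
qed

section \<open>Second order conditions at a minimum\<close>

lemma bounded_bilinear_matrix_matrix: "bounded_bilinear ((**) :: real^'n^'m \<Rightarrow> real^'k^'n \<Rightarrow> real^'k^'m)"
  unfolding bilinear_conv_bounded_bilinear[symmetric] bilinear_def
  by (auto intro!: linearI simp: matrix_matrix_mult_def vec_eq_iff algebra_simps sum.distrib sum_distrib_left)

lemma bounded_bilinear_matrix_vector: "bounded_bilinear ((*v) :: real^'n^'m \<Rightarrow> real^'n \<Rightarrow> real^'m)"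
  unfolding bilinear_conv_bounded_bilinear[symmetric] bilinear_def
  by (auto intro!: linearI simp: matrix_vector_mult_def vec_eq_iff algebra_simps sum.distrib sum_distrib_left)

lemmas tendsto_matrix_matrix = bounded_bilinear.tendsto[OF bounded_bilinear_matrix_matrix]
lemmas tendsto_matrix_vector = bounded_bilinear.tendsto[OF bounded_bilinear_matrix_vector]
lemmas continuous_on_matrix_vector = bounded_bilinear.continuous_on[OF bounded_bilinear_matrix_vector]

lemma inner_transpose_vector: "(v::real^'m) \<bullet> (transpose A *v w) = (A *v v) \<bullet> w"
  by (metis dot_lmul_matrix transpose_matrix_vector inner_commute)

lemma line_has_derivative:
  fixes F :: "'a::real_normed_vector \<Rightarrow> 'b::real_normed_vector"
  assumes "(F has_derivative F') (at (x + s *\<^sub>R v))"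
  shows "((\<lambda>s. F (x + s *\<^sub>R v)) has_vector_derivative F' v) (at s)"
proof -
  have "((\<lambda>s. F (x + s *\<^sub>R v)) has_derivative (\<lambda>h. F' (h *\<^sub>R v))) (at s)"
  proof (rule has_derivative_compose[of "\<lambda>s. x + s *\<^sub>R v" "\<lambda>h. h *\<^sub>R v" s UNIV F F', OF _ assms])
    show "((\<lambda>s. x + s *\<^sub>R v) has_derivative (\<lambda>h. h *\<^sub>R v)) (at s)"
      by (auto intro!: derivative_eq_intros)
  qed
  moreover have "F' (h *\<^sub>R v) = h *\<^sub>R F' v" for h
    using assms has_derivative_bounded_linear linear_simps(5) by blast
  ultimately show ?thesis by (simp add: has_vector_derivative_def)
qed

lemma C1_gradient_continuous_on: "C1_gradient S F D \<Longrightarrow> continuous_on S F"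
  unfolding C1_gradient_def
  by (auto intro!: continuous_at_imp_continuous_on dest!: bspec has_derivative_continuous)

lemma C1_gradient_exp:
  assumes "C1_gradient S F D"
  shows "C1_gradient S (\<lambda>z. exp (F z)) (\<lambda>z. exp (F z) *\<^sub>R D z)"
  using assms C1_gradient_continuous_on[OF assms] unfolding C1_gradient_def
  by (auto intro!: continuous_intros derivative_eq_intros simp: algebra_simps)

lemma continuous_on_tendsto_at:
  fixes V :: "'a::t2_space set" and F :: "'a \<times> real \<Rightarrow> 'b::topological_space"
  assumes "continuous_on (V \<times> {0<..}) F" "open V" "y0 \<in> V" "0 < (t0::real)"
    "y \<longlonglongrightarrow> y0" "t \<longlonglongrightarrow> t0"
  shows "(\<lambda>k. F (y k, t k)) \<longlonglongrightarrow> F (y0, t0)"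
proof -
  have "isCont F (y0, t0)"
    using assms(1-4) by (simp add: continuous_on_eq_continuous_at open_Times)
  then show ?thesis
    by (rule isCont_tendsto_compose) (intro tendsto_intros assms)
qed

text \<open>In the proof, \<open>lt - W \<bullet> Dl\<close> is replaced by the difference quotient
  \<open>(l y (t + \<tau>) - l (y + \<tau> W y) t) / \<tau>\<close>, to which the second order minimum conditions apply
  although \<open>l\<close> has only two space derivatives.  The penalty \<open>\<epsilon> (|y - y0|\<^sup>2 + (t - t0)\<^sup>2)\<close>
  forces the minimum points of the quotients to converge to \<open>(y0, t0)\<close>.\<close>

lemma minimum_inequality:
  fixes l lt E Et :: "real^'n \<Rightarrow> real \<Rightarrow> real" and Dl DE :: "real^'n \<Rightarrow> real \<Rightarrow> real^'n"
    and DDl DDE :: "real^'n \<Rightarrow> real \<Rightarrow> real^'n^'n"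
    and a :: "real^'n \<Rightarrow> real^'n^'n" and b :: "real^'n \<Rightarrow> real^'n" and N :: "real^'n^'n"
  assumes V: "open V"
    and Dl: "\<And>y t. y \<in> V \<Longrightarrow> t > 0 \<Longrightarrow> ((\<lambda>y. l y t) has_derivative (\<lambda>v. Dl y t \<bullet> v)) (at y)"
    and DDl: "\<And>y t. y \<in> V \<Longrightarrow> t > 0 \<Longrightarrow> ((\<lambda>y. Dl y t) has_derivative (\<lambda>v. DDl y t *v v)) (at y)"
    and lt: "\<And>y t. y \<in> V \<Longrightarrow> t > 0 \<Longrightarrow> (l y has_real_derivative lt y t) (at t)"
    and cDl: "continuous_on (V \<times> {0<..}) (\<lambda>(y, t). Dl y t)"
    and cDDl: "continuous_on (V \<times> {0<..}) (\<lambda>(y, t). DDl y t)"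
    and clt: "continuous_on (V \<times> {0<..}) (\<lambda>(y, t). lt y t)"
    and DE: "\<And>y t. y \<in> V \<Longrightarrow> t > 0 \<Longrightarrow> ((\<lambda>y. E y t) has_derivative (\<lambda>v. DE y t \<bullet> v)) (at y)"
    and DDE: "\<And>y t. y \<in> V \<Longrightarrow> t > 0 \<Longrightarrow> ((\<lambda>y. DE y t) has_derivative (\<lambda>v. DDE y t *v v)) (at y)"
    and Et: "\<And>y t. y \<in> V \<Longrightarrow> t > 0 \<Longrightarrow> (E y has_real_derivative Et y t) (at t)"
    and cDE: "continuous_on (V \<times> {0<..}) (\<lambda>(y, t). DE y t)"
    and cDDE: "continuous_on (V \<times> {0<..}) (\<lambda>(y, t). DDE y t)"
    and cEt: "continuous_on (V \<times> {0<..}) (\<lambda>(y, t). Et y t)"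
    and ca: "continuous_on V a" and cb: "continuous_on V b"
    and a_sym: "\<And>y. y \<in> V \<Longrightarrow> transpose (a y) = a y"
    and a_psd: "\<And>y v. y \<in> V \<Longrightarrow> v \<bullet> (a y *v v) \<ge> 0"
    and a': "strict_derivative a a' y0" and b': "strict_derivative b b' y0"
    and eq: "\<And>y t. y \<in> V \<Longrightarrow> t > 0 \<Longrightarrow>
      lt y t = a y \<bullet> DDl y t + b y \<bullet> Dl y t + Dl y t \<bullet> (a y *v Dl y t) + c * (1 - exp (l y t))"
    and r: "r > 0" "cball y0 (2 * r) \<subseteq> V" and \<eta>: "0 < \<eta>" "\<eta> < t0"
    and min: "\<And>y t. y \<in> cball y0 r \<Longrightarrow> t \<in> {t0 - \<eta>..t0} \<Longrightarrow>
      lt y0 t0 - w \<bullet> Dl y0 t0 + E y0 t0 \<le> lt y t - (w + N *v (y - y0)) \<bullet> Dl y t + E y t"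
    and X: "X = transpose N *v Dl y0 t0 - DE y0 t0"
  shows "a y0 \<bullet> (transpose N ** DDl y0 t0 + DDl y0 t0 ** N) - a' w \<bullet> DDl y0 t0
    + (b y0 \<bullet> X - b' w \<bullet> Dl y0 t0)
    + (2 * (X \<bullet> (a y0 *v Dl y0 t0)) - Dl y0 t0 \<bullet> (a' w *v Dl y0 t0))
    - c * exp (l y0 t0) * (lt y0 t0 - w \<bullet> Dl y0 t0)
    + Et y0 t0 - a y0 \<bullet> DDE y0 t0 \<le> 0" (is "?Q \<le> 0")
proof -
  have y0: "y0 \<in> V" using r by (intro subsetD[OF r(2)]) auto
  have t0: "t0 > 0" using \<eta> by simp
  have rV: "cball y0 r \<subseteq> V" using r subset_cball[of r "2 * r" y0] by auto
  define W where "W y = w + N *v (y - y0)" for y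
  have C1l: "C1_gradient (V \<times> {0<..}) (\<lambda>(y, t). l y t) (\<lambda>(y, t). (Dl y t, lt y t))"
    by (rule joint_C1_gradient) (use V Dl lt cDl clt in auto)
  have C1E: "C1_gradient (V \<times> {0<..}) (\<lambda>(y, t). E y t) (\<lambda>(y, t). (DE y t, Et y t))"
    by (rule joint_C1_gradient) (use V DE Et cDE cEt in auto)
  have cl: "continuous_on (V \<times> {0<..}) (\<lambda>(y, t). l y t)" and cE: "continuous_on (V \<times> {0<..}) (\<lambda>(y, t). E y t)"
    using C1l C1E by (auto dest: C1_gradient_continuous_on)
  have cW: "continuous_on S W" for S
    unfolding W_def by (intro continuous_intros matrix_vector_mult_linear_continuous_on[THEN continuous_on_compose2]) auto
  define K where "K = cball y0 r \<times> {t0 - \<eta>..t0}"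
  have KV: "K \<subseteq> V \<times> {0<..}" using rV \<eta> by (auto simp: K_def)
  have compK: "compact K" unfolding K_def by (intro compact_Times) auto
  have z0K: "(y0, t0) \<in> K" using r \<eta> by (auto simp: K_def)
  have "bounded (W ` cball y0 r)" by (intro compact_imp_bounded compact_continuous_image cW) auto
  then obtain Bd where Bd: "Bd > 0" "\<And>y. y \<in> cball y0 r \<Longrightarrow> norm (W y) \<le> Bd"
    by (auto simp: bounded_pos)
  \<comment> \<open>Steps of size at most \<delta> move a point of \<open>cball y0 r\<close> by at
    most r; this is the reason for the factor 2 in the assumption on r.\<close>
  define \<delta> where "\<delta> = r / Bd"
  have \<delta>: "\<delta> > 0" using r Bd by (simp add: \<delta>_def)
  have \<Phi>V: "y + \<tau> *\<^sub>R W y \<in> V" if "y \<in> cball y0 r" "0 < \<tau>" "\<tau> \<le> \<delta>" for y \<tau>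
  proof -
    have "norm (\<tau> *\<^sub>R W y) \<le> \<delta> * Bd" using Bd(2)[OF that(1)] that \<delta> by (auto intro!: mult_mono)
    also have "\<dots> = r" using Bd by (simp add: \<delta>_def)
    finally have "dist y (y + \<tau> *\<^sub>R W y) \<le> r" by (simp add: dist_norm)
    then have "dist y0 (y + \<tau> *\<^sub>R W y) \<le> 2 * r" using that(1) dist_triangle[of y0 "y + \<tau> *\<^sub>R W y" y] by simp
    then show ?thesis using r by auto
  qed
  \<comment> \<open>The right side is what the Hessian of the penalty, 2 \<epsilon> times the
    identity, contributes. It disappears at the end of the proof by letting \<epsilon> tend to
    0.\<close>
  have main: "?Q \<le> \<epsilon> * (2 * (a y0 \<bullet> mat 1))" if \<epsilon>: "\<epsilon> > 0" for \<epsilon>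
  proof -
    define \<tau> where "\<tau> k = \<delta> / (real k + 1)" for k
    have \<tau>: "\<tau> k > 0" "\<tau> k \<le> \<delta>" for k using \<delta> by (auto simp: \<tau>_def field_simps)
    have \<tau>0: "\<tau> \<longlonglongrightarrow> 0"
      unfolding \<tau>_def using LIMSEQ_Suc[OF lim_const_over_n[of \<delta>]] by (simp add: add.commute)
    define G where "G k = (\<lambda>(y, t). (l y (t + \<tau> k) - l (y + \<tau> k *\<^sub>R W y) t) / \<tau> k + E y t
      + \<epsilon> * ((y - y0) \<bullet> (y - y0) + (t - t0)^2))" for k
    have contG: "continuous_on K (G k)" for k
    proof -
      have 1: "continuous_on K (\<lambda>z. (\<lambda>(y, t). l y t) (fst z, snd z + \<tau> k))"
        by (rule continuous_on_compose2[OF cl]) (use KV \<tau>(1)[of k] in \<open>fastforce intro!: continuous_intros\<close>)+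
      have 2: "continuous_on K (\<lambda>z. (\<lambda>(y, t). l y t) (fst z + \<tau> k *\<^sub>R W (fst z), snd z))"
      proof (rule continuous_on_compose2[OF cl])
        show "continuous_on K (\<lambda>z. (fst z + \<tau> k *\<^sub>R W (fst z), snd z))"
          by (intro continuous_intros continuous_on_compose2[OF cW]) auto
        show "(\<lambda>z. (fst z + \<tau> k *\<^sub>R W (fst z), snd z)) ` K \<subseteq> V \<times> {0<..}"
          using \<Phi>V \<tau> KV by (auto simp: K_def)
      qed
      have 3: "continuous_on K (\<lambda>z. (\<lambda>(y, t). E y t) (fst z, snd z))"
        by (rule continuous_on_compose2[OF cE]) (use KV in \<open>auto intro!: continuous_intros\<close>)
      show ?thesis
        using 1 2 3 \<tau>(1)[of k] unfolding G_def case_prod_beta'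
        by (auto intro!: continuous_intros)
    qed
    have "\<exists>z\<in>K. \<forall>z'\<in>K. G k z \<le> G k z'" for k
      using continuous_attains_inf[OF compK _ contG] z0K by blast
    then obtain z where z: "\<And>k. z k \<in> K" "\<And>k z'. z' \<in> K \<Longrightarrow> G k (z k) \<le> G k z'" by metis
    obtain zs \<rho> where zs: "zs \<in> K" "strict_mono \<rho>" "(z \<circ> \<rho>) \<longlonglongrightarrow> zs"
      using compK z(1) unfolding compact_def by blast
    obtain ys ts where zs_eq: "zs = (ys, ts)" by fastforce
    have ysts: "ys \<in> cball y0 r" "ts \<in> {t0 - \<eta>..t0}" "ys \<in> V" "ts > 0"
      using zs(1) rV \<eta> unfolding zs_eq K_def by auto
    define y where "y k = fst (z (\<rho> k))" for k
    define t where "t k = snd (z (\<rho> k))" for k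
    define \<sigma> where "\<sigma> k = \<tau> (\<rho> k)" for k
    have \<sigma>: "\<sigma> k > 0" "\<sigma> k \<le> \<delta>" for k using \<tau> by (auto simp: \<sigma>_def)
    have \<sigma>0: "\<sigma> \<longlonglongrightarrow> 0"
      unfolding \<sigma>_def[abs_def] using LIMSEQ_subseq_LIMSEQ[OF \<tau>0 zs(2)] by (simp add: o_def)
    have yk: "y \<longlonglongrightarrow> ys" and tk: "t \<longlonglongrightarrow> ts"
      using tendsto_fst[OF zs(3)] tendsto_snd[OF zs(3)] by (auto simp: y_def[abs_def] t_def[abs_def] zs_eq o_def)
    have W_tendsto: "(\<lambda>k. W (u k)) \<longlonglongrightarrow> W x" if "u \<longlonglongrightarrow> x" for u x
      using cW[of UNIV] isCont_tendsto_compose[OF _ that, of W] by (simp add: continuous_on_eq_continuous_at)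
    \<comment> \<open>The first part of \<open>G\<close> is a difference quotient of l with base
      point (u + \<sigma> W u, s) and direction (- W u, 1), so strict differentiability gives its
      limit along moving points.\<close>
    have Glim: "(\<lambda>k. G (\<rho> k) (u k, s k)) \<longlonglongrightarrow>
        lt x s0 - W x \<bullet> Dl x s0 + E x s0 + \<epsilon> * ((x - y0) \<bullet> (x - y0) + (s0 - t0)^2)"
      if u: "u \<longlonglongrightarrow> x" and s: "s \<longlonglongrightarrow> s0" and x: "x \<in> V" "s0 > 0" for u s x s0
    proof -
      have sd: "strict_derivative (\<lambda>(y, t). l y t) (\<lambda>h. (Dl x s0, lt x s0) \<bullet> h) (x, s0)"
        using C1_gradient_strict[OF C1l, of "(x, s0)"] x V by (auto simp: open_Times)
      have "(\<lambda>k. (u k + \<sigma> k *\<^sub>R W (u k), s k)) \<longlonglongrightarrow> (x + 0 *\<^sub>R W x, s0)"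
        by (intro tendsto_intros u s \<sigma>0 W_tendsto)
      then have p: "(\<lambda>k. (u k + \<sigma> k *\<^sub>R W (u k), s k)) \<longlonglongrightarrow> (x, s0)" by simp
      have v: "(\<lambda>k. (- W (u k), 1::real)) \<longlonglongrightarrow> (- W x, 1)"
        by (intro tendsto_intros u W_tendsto)
      have "(\<lambda>k. (l (u k) (s k + \<sigma> k) - l (u k + \<sigma> k *\<^sub>R W (u k)) (s k)) / \<sigma> k) \<longlonglongrightarrow> (Dl x s0, lt x s0) \<bullet> (- W x, 1)"
        using strict_derivativeD[OF sd p v \<sigma>0] \<sigma>(1) by (simp add: less_imp_neq[symmetric] divide_inverse mult.commute)
      moreover have "(\<lambda>k. E (u k) (s k)) \<longlonglongrightarrow> E x s0"
        using continuous_on_tendsto_at[OF cE V x u s] by simp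
      ultimately have "(\<lambda>k. (l (u k) (s k + \<sigma> k) - l (u k + \<sigma> k *\<^sub>R W (u k)) (s k)) / \<sigma> k + E (u k) (s k)
         + \<epsilon> * ((u k - y0) \<bullet> (u k - y0) + (s k - t0)^2)) \<longlonglongrightarrow> (Dl x s0, lt x s0) \<bullet> (- W x, 1) + E x s0
         + \<epsilon> * ((x - y0) \<bullet> (x - y0) + (s0 - t0)^2)"
        by (intro tendsto_intros u s)
      then show ?thesis unfolding G_def \<sigma>_def by (simp add: inner_commute)
    qed
    have "lt ys ts - W ys \<bullet> Dl ys ts + E ys ts + \<epsilon> * ((ys - y0) \<bullet> (ys - y0) + (ts - t0)^2)
       \<le> lt y0 t0 - W y0 \<bullet> Dl y0 t0 + E y0 t0 + \<epsilon> * ((y0 - y0) \<bullet> (y0 - y0) + (t0 - t0)^2)"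
    proof (rule LIMSEQ_le[OF Glim[OF yk tk ysts(3,4)] Glim[OF tendsto_const tendsto_const y0 t0]])
      show "\<exists>N. \<forall>n\<ge>N. G (\<rho> n) (y n, t n) \<le> G (\<rho> n) (y0, t0)"
        using z(2)[OF z0K] by (auto simp: y_def t_def)
    qed
    \<comment> \<open>Without the penalty the limit expression is already minimal at (y0, t0), so
      the penalty at the limit point cannot be positive.\<close>
    with min[OF ysts(1,2)] have "\<epsilon> * ((ys - y0) \<bullet> (ys - y0) + (ts - t0)^2) \<le> 0"
      by (simp add: W_def)
    then have "(ys - y0) \<bullet> (ys - y0) + (ts - t0)^2 \<le> 0" using \<epsilon> by (simp add: mult_le_0_iff)
    moreover have "(ys - y0) \<bullet> (ys - y0) \<ge> 0" "(ts - t0)^2 \<ge> 0" by auto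
    ultimately have "(ys - y0) \<bullet> (ys - y0) = 0" "(ts - t0)^2 = 0" by linarith+
    then have zs0: "ys = y0" "ts = t0" by auto
    note yk = yk[unfolded zs0] and tk = tk[unfolded zs0]
    \<comment> \<open>The claim is proved in an exact discrete form before the limit is taken. The
      two points of the quotient are (y, t + \<sigma>) and (q, t). \<open>A'\<close> and
      \<open>B'\<close> are the quotients of the coefficients, \<open>R'\<close> that of exp l, and
      \<open>Xk\<close> is the quotient of the gradients of l that the first order condition will
      prescribe.\<close>
    define q where "q k = y k + \<sigma> k *\<^sub>R W (y k)" for k
    define p2 where "p2 k = Dl (q k) (t k)" for k
    define M2 where "M2 k = DDl (q k) (t k)" for k
    define A' where "A' k = (a (q k) - a (y k)) /\<^sub>R \<sigma> k" for k
    define B' where "B' k = (b (q k) - b (y k)) /\<^sub>R \<sigma> k" for k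
    define Xk where "Xk k = transpose N *v p2 k - DE (y k) (t k) - (2 * \<epsilon>) *\<^sub>R (y k - y0)" for k
    define R' where "R' k = (exp (l (y k) (t k + \<sigma> k)) - exp (l (q k) (t k))) / \<sigma> k" for k
    define Q where "Q k = a (y k) \<bullet> (transpose N ** M2 k + M2 k ** N) + \<sigma> k * (a (y k) \<bullet> (transpose N ** M2 k ** N)) - A' k \<bullet> M2 k
      + (b (y k) \<bullet> Xk k - B' k \<bullet> p2 k)
      + (2 * (Xk k \<bullet> (a (y k) *v p2 k)) + \<sigma> k * (Xk k \<bullet> (a (y k) *v Xk k)) - p2 k \<bullet> (A' k *v p2 k))
      - c * R' k + (Et (y k) (t k) + 2 * \<epsilon> * (t k - t0)) - a (y k) \<bullet> DDE (y k) (t k) - 2 * \<epsilon> * (a (y k) \<bullet> mat 1)" for k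
    have q0: "q \<longlonglongrightarrow> y0"
      using tendsto_add[OF yk tendsto_scaleR[OF \<sigma>0 W_tendsto[OF yk]]] by (simp add: q_def[abs_def])
    have lim: "Q \<longlonglongrightarrow> a y0 \<bullet> (transpose N ** DDl y0 t0 + DDl y0 t0 ** N) + 0 * (a y0 \<bullet> (transpose N ** DDl y0 t0 ** N)) - a' w \<bullet> DDl y0 t0
      + (b y0 \<bullet> X - b' w \<bullet> Dl y0 t0)
      + (2 * (X \<bullet> (a y0 *v Dl y0 t0)) + 0 * (X \<bullet> (a y0 *v X)) - Dl y0 t0 \<bullet> (a' w *v Dl y0 t0))
      - c * (exp (l y0 t0) * (lt y0 t0 - w \<bullet> Dl y0 t0)) + (Et y0 t0 + 2 * \<epsilon> * (t0 - t0)) - a y0 \<bullet> DDE y0 t0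
      - 2 * \<epsilon> * (a y0 \<bullet> mat 1)"
    proof -
      have p2l: "p2 \<longlonglongrightarrow> Dl y0 t0" and M2l: "M2 \<longlonglongrightarrow> DDl y0 t0"
        using continuous_on_tendsto_at[OF cDl V y0 t0 q0 tk] continuous_on_tendsto_at[OF cDDl V y0 t0 q0 tk]
        by (simp_all add: p2_def[abs_def] M2_def[abs_def])
      have al: "(\<lambda>k. a (y k)) \<longlonglongrightarrow> a y0" and bl: "(\<lambda>k. b (y k)) \<longlonglongrightarrow> b y0"
        using ca cb V y0 yk by (auto simp: continuous_on_eq_continuous_at intro: isCont_tendsto_compose)
      have DEl: "(\<lambda>k. DE (y k) (t k)) \<longlonglongrightarrow> DE y0 t0" and DDEl: "(\<lambda>k. DDE (y k) (t k)) \<longlonglongrightarrow> DDE y0 t0"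
        and Etl: "(\<lambda>k. Et (y k) (t k)) \<longlonglongrightarrow> Et y0 t0"
        using continuous_on_tendsto_at[OF cDE V y0 t0 yk tk] continuous_on_tendsto_at[OF cDDE V y0 t0 yk tk]
          continuous_on_tendsto_at[OF cEt V y0 t0 yk tk] by simp_all
      have Wl: "(\<lambda>k. W (y k)) \<longlonglongrightarrow> w" using W_tendsto[OF yk] by (simp add: W_def)
      have nz: "\<sigma> k \<noteq> 0" for k using \<sigma>(1)[of k] by simp
      have A'l: "A' \<longlonglongrightarrow> a' w" and B'l: "B' \<longlonglongrightarrow> b' w"
        using strict_derivativeD[OF a' yk Wl \<sigma>0 nz] strict_derivativeD[OF b' yk Wl \<sigma>0 nz]
        by (simp_all add: A'_def[abs_def] B'_def[abs_def] q_def)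
      have "Xk \<longlonglongrightarrow> transpose N *v Dl y0 t0 - DE y0 t0 - (2 * \<epsilon>) *\<^sub>R (y0 - y0)"
        unfolding Xk_def[abs_def] by (intro tendsto_intros tendsto_matrix_vector p2l DEl yk)
      then have Xl: "Xk \<longlonglongrightarrow> X" by (simp add: X)
      have "C1_gradient (V \<times> {0<..}) (\<lambda>(y, t). exp (l y t)) (\<lambda>(y, t). exp (l y t) *\<^sub>R (Dl y t, lt y t))"
        using C1_gradient_exp[OF C1l] by (simp add: case_prod_beta')
      then have sd: "strict_derivative (\<lambda>(y, t). exp (l y t)) (\<lambda>h. (exp (l y0 t0) *\<^sub>R (Dl y0 t0, lt y0 t0)) \<bullet> h) (y0, t0)"
        using C1_gradient_strict[of "V \<times> {0<..}" "\<lambda>(y, t). exp (l y t)" "\<lambda>(y, t). exp (l y t) *\<^sub>R (Dl y t, lt y t)" "(y0, t0)"] y0 t0 V by (simp add: open_Times)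
      have p: "(\<lambda>k. (q k, t k)) \<longlonglongrightarrow> (y0, t0)" by (intro tendsto_intros q0 tk)
      have v: "(\<lambda>k. (- W (y k), 1::real)) \<longlonglongrightarrow> (- w, 1)" by (intro tendsto_intros Wl)
      have "(exp (l y0 t0) *\<^sub>R (Dl y0 t0, lt y0 t0)) \<bullet> (- w, 1) = exp (l y0 t0) * (lt y0 t0 - w \<bullet> Dl y0 t0)"
        by (simp add: inner_commute algebra_simps)
      moreover have "R' = (\<lambda>k. ((\<lambda>(y, t). exp (l y t)) ((q k, t k) + \<sigma> k *\<^sub>R (- W (y k), 1)) - (\<lambda>(y, t). exp (l y t)) (q k, t k)) /\<^sub>R \<sigma> k)"
        by (auto simp: R'_def q_def divide_inverse mult.commute)
      ultimately have R'l: "R' \<longlonglongrightarrow> exp (l y0 t0) * (lt y0 t0 - w \<bullet> Dl y0 t0)"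
        using strict_derivativeD[OF sd p v \<sigma>0 nz] by metis
      show ?thesis
        unfolding Q_def[abs_def]
        by (intro tendsto_intros tendsto_matrix_vector tendsto_matrix_matrix p2l M2l al bl DEl DDEl Etl A'l B'l Xl R'l \<sigma>0 tk)
    qed
    have "\<forall>\<^sub>F k in sequentially. Q k \<le> 0"
    proof -
      have "\<forall>\<^sub>F k in sequentially. y k \<in> ball y0 r"
        using topological_tendstoD[OF yk, of "ball y0 r"] r by auto
      moreover have "\<forall>\<^sub>F k in sequentially. t k > t0 - \<eta>"
        using order_tendstoD(1)[OF tk, of "t0 - \<eta>"] \<eta> by auto
      ultimately show ?thesis
      proof eventually_elim
        case (elim k)
        define y1 t1 s1 where "y1 = y k" and "t1 = t k" and "s1 = \<sigma> k"
        have yb: "y1 \<in> ball y0 r" and tb: "t1 > t0 - \<eta>" using elim by (auto simp: y1_def t1_def)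
        have s1: "s1 > 0" "s1 \<le> \<delta>" using \<sigma> by (auto simp: s1_def)
        have zk: "z (\<rho> k) = (y1, t1)" by (simp add: y1_def t1_def y_def t_def)
        have t1: "t1 \<le> t0" "t1 > 0" using z(1)[of "\<rho> k"] \<eta> zk unfolding K_def by auto
        have yV: "y1 \<in> V" using yb rV by auto
        have gmin: "G (\<rho> k) (y1, t1) \<le> G (\<rho> k) (x, s)" if "x \<in> cball y0 r" "s \<in> {t0 - \<eta>..t0}" for x s
          using z(2)[of "(x, s)" "\<rho> k"] zk that by (simp add: K_def)
        have Geq: "G (\<rho> k) (x, s) = (l x (s + s1) - l (x + s1 *\<^sub>R W x) s) / s1 + E x s
      + \<epsilon> * ((x - y0) \<bullet> (x - y0) + (s - t0)^2)" for x s
          by (simp add: G_def s1_def \<sigma>_def)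
        have qk: "q k = y1 + s1 *\<^sub>R W y1" by (simp add: q_def y1_def s1_def)
        have qV: "q k \<in> V" using \<Phi>V[of y1 s1] yb s1 by (simp add: qk)
        \<comment> \<open>The minimum point may lie on the upper face t = t0. Only comparison with
          earlier times is available, and it yields this sign.\<close>
        have time: "(lt y1 (t1 + s1) - lt (q k) t1) / s1 + Et y1 t1 + 2 * \<epsilon> * (t1 - t0) \<le> 0" (is "?D \<le> 0")
        proof (rule ccontr)
          assume "\<not> ?D \<le> 0"
          then have pos: "?D > 0" by simp
          have "((\<lambda>s. l y1 (s + s1)) has_real_derivative lt y1 (t1 + s1)) (at t1)"
            using lt[OF yV, of "t1 + s1"] t1 s1 DERIV_shift[of "l y1" "lt y1 (t1 + s1)" t1 s1] by simp
          then have "((\<lambda>s. G (\<rho> k) (y1, s)) has_real_derivative ?D) (at t1)"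
            unfolding Geq qk[symmetric]
            using lt[OF qV t1(2)] Et[OF yV t1(2)] s1
            by (auto intro!: derivative_eq_intros)
          from DERIV_pos_inc_left[OF this pos] obtain d where d: "d > 0"
            "\<And>h. 0 < h \<Longrightarrow> h < d \<Longrightarrow> G (\<rho> k) (y1, t1 - h) < G (\<rho> k) (y1, t1)" by blast
          define h where "h = min d (t1 - (t0 - \<eta>)) / 2"
          have "0 < h" "h < d" "t1 - h \<ge> t0 - \<eta>" using d tb by (auto simp: h_def min_def field_simps)
          then show False using d(2)[of h] gmin[of y1 "t1 - h"] yb t1 by (auto simp: not_less[symmetric])
        qed
        define P1 where "P1 = Dl y1 (t1 + s1)"
        define M1 where "M1 = DDl y1 (t1 + s1)"
        \<comment> \<open>First and second derivatives of the quotient along v. The affine map y +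
          s1 W y has the derivative 1 + s1 N, which is the factor at the shifted point.\<close>
        define DG where "DG v x = (Dl x (t1 + s1) \<bullet> v - Dl (x + s1 *\<^sub>R W x) t1 \<bullet> (v + s1 *\<^sub>R (N *v v))) / s1 + DE x t1 \<bullet> v
            + 2 * \<epsilon> * ((x - y0) \<bullet> v)" for v x
        define DDG where "DDG v = (v \<bullet> (M1 *v v) - (v + s1 *\<^sub>R (N *v v)) \<bullet> (M2 k *v (v + s1 *\<^sub>R (N *v v)))) / s1
            + v \<bullet> (DDE y1 t1 *v v) + 2 * \<epsilon> * (v \<bullet> v)" for v
        have space: "DG v y1 = 0 \<and> DDG v \<ge> 0" for v
        proof -
          define d where "d = (r - dist y0 y1) / (norm v + 1)"
          have d: "d > 0" "\<And>s. \<bar>s\<bar> < d \<Longrightarrow> y1 + s *\<^sub>R v \<in> ball y0 r"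
          proof -
            have nv: "norm v + 1 > 0" by (simp add: add_nonneg_pos)
            then show "d > 0" using yb by (simp add: d_def)
            fix s :: real assume "\<bar>s\<bar> < d"
            then have "\<bar>s\<bar> * (norm v + 1) < r - dist y0 y1" using nv by (simp add: d_def field_simps)
            then have "norm (s *\<^sub>R v) < r - dist y0 y1" by (simp add: algebra_simps)
            moreover have "dist y0 (y1 + s *\<^sub>R v) \<le> dist y0 y1 + norm (s *\<^sub>R v)"
              using dist_triangle[of y0 "y1 + s *\<^sub>R v" y1] by (simp add: dist_norm)
            ultimately show "y1 + s *\<^sub>R v \<in> ball y0 r" by simp
          qed
          have Wl: "W (y1 + s *\<^sub>R v) = W y1 + s *\<^sub>R (N *v v)" for s
            by (simp add: W_def algebra_simps matrix_vector_right_distrib matrix_vector_mult_diff_distrib matrix_vector_mult_scaleR)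
          have \<Phi>l: "(y1 + s *\<^sub>R v) + s1 *\<^sub>R W (y1 + s *\<^sub>R v) = q k + s *\<^sub>R (v + s1 *\<^sub>R (N *v v))" for s
            by (simp add: Wl qk algebra_simps)
          have in1: "y1 + s *\<^sub>R v \<in> V" "q k + s *\<^sub>R (v + s1 *\<^sub>R (N *v v)) \<in> V" if "\<bar>s\<bar> < d" for s
            using d(2)[OF that] rV \<Phi>V[of "y1 + s *\<^sub>R v" s1] s1 by (auto simp: \<Phi>l)
          have g: "((\<lambda>s. G (\<rho> k) (y1 + s *\<^sub>R v, t1)) has_real_derivative DG v (y1 + s *\<^sub>R v)) (at s)" if "\<bar>s\<bar> < d" for s
          proof -
            have 1: "((\<lambda>s. l (y1 + s *\<^sub>R v) (t1 + s1)) has_real_derivative Dl (y1 + s *\<^sub>R v) (t1 + s1) \<bullet> v) (at s)"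
              unfolding has_real_derivative_iff_has_vector_derivative
              by (rule line_has_derivative, rule Dl) (use in1[OF that] t1 s1 in auto)
            have 2: "((\<lambda>s. l (q k + s *\<^sub>R (v + s1 *\<^sub>R (N *v v))) t1) has_real_derivative
              Dl (q k + s *\<^sub>R (v + s1 *\<^sub>R (N *v v))) t1 \<bullet> (v + s1 *\<^sub>R (N *v v))) (at s)"
              unfolding has_real_derivative_iff_has_vector_derivative
              by (rule line_has_derivative, rule Dl) (use in1[OF that] t1 s1 in auto)
            have 3: "((\<lambda>s. E (y1 + s *\<^sub>R v) t1) has_real_derivative DE (y1 + s *\<^sub>R v) t1 \<bullet> v) (at s)"
              unfolding has_real_derivative_iff_has_vector_derivative
              by (rule line_has_derivative, rule DE) (use in1[OF that] t1 s1 in auto)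
            have 4: "((\<lambda>s. (y1 + s *\<^sub>R v - y0) \<bullet> (y1 + s *\<^sub>R v - y0)) has_real_derivative 2 * ((y1 + s *\<^sub>R v - y0) \<bullet> v)) (at s)"
              unfolding has_field_derivative_def
              by (auto intro!: derivative_eq_intros simp: fun_eq_iff inner_commute algebra_simps)
            show ?thesis unfolding Geq DG_def \<Phi>l
              using 1 2 3 4 s1 by (auto intro!: derivative_eq_intros)
          qed
          have g1: "((\<lambda>s. DG v (y1 + s *\<^sub>R v)) has_real_derivative DDG v) (at 0)"
          proof -
            have 1: "((\<lambda>s. Dl (y1 + s *\<^sub>R v) (t1 + s1)) has_vector_derivative M1 *v v) (at 0)"
              unfolding M1_def
              by (rule line_has_derivative) (use DDl[OF yV, of "t1 + s1"] t1 s1 in auto)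
            have 2: "((\<lambda>s. Dl (q k + s *\<^sub>R (v + s1 *\<^sub>R (N *v v))) t1) has_vector_derivative M2 k *v (v + s1 *\<^sub>R (N *v v))) (at 0)"
              by (rule line_has_derivative) (use DDl[OF qV, of t1] t1 s1 in \<open>auto simp: M2_def t1_def\<close>)
            have 3: "((\<lambda>s. DE (y1 + s *\<^sub>R v) t1) has_vector_derivative DDE y1 t1 *v v) (at 0)"
              by (rule line_has_derivative) (use DDE[OF yV, of t1] t1 s1 in auto)
            have i: "((\<lambda>s. f s \<bullet> u) has_real_derivative u \<bullet> f') (at 0)"
              if "(f has_vector_derivative f') (at 0)" for f and f' u :: "real^'n"
              using bounded_linear.has_vector_derivative[OF bounded_linear_inner_left that, of u]
              by (simp add: has_real_derivative_iff_has_vector_derivative inner_commute)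
            have 4: "((\<lambda>s. (y1 + s *\<^sub>R v - y0) \<bullet> v) has_real_derivative v \<bullet> v) (at 0)"
              unfolding has_field_derivative_def
              by (auto intro!: derivative_eq_intros simp: fun_eq_iff inner_commute algebra_simps)
            show ?thesis unfolding DG_def DDG_def \<Phi>l
              using i[OF 1, of v] i[OF 2, of "v + s1 *\<^sub>R (N *v v)"] i[OF 3, of v] 4 s1
              by (auto intro!: derivative_eq_intros)
          qed
          have mn: "G (\<rho> k) (y1 + 0 *\<^sub>R v, t1) \<le> G (\<rho> k) (y1 + s *\<^sub>R v, t1)" if "\<bar>s\<bar> < d" for s
            using gmin[of "y1 + s *\<^sub>R v" t1] d(2)[OF that] t1 tb by auto
          have "DG v (y1 + 0 *\<^sub>R v) = 0" "DDG v \<ge> 0"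
            using second_derivative_test[OF d(1) g g1 mn] by auto
          then show ?thesis by simp
        qed
        \<comment> \<open>Vanishing of the first derivative in all directions determines the
          gradient of l at the later time from the one at the shifted point.\<close>
        have P1eq: "P1 = p2 k + s1 *\<^sub>R Xk k"
        proof -
          have "(P1 - p2 k - s1 *\<^sub>R Xk k) \<bullet> v = 0" for v
          proof -
            have aux: "(x - x') / s1 + u + u' = 0 \<Longrightarrow> x - x' + s1 * (u + u') = 0" for x x' u u' :: real
              using s1 by (simp add: field_simps)
            have "DG v y1 = 0" using space[of v] by simp
            then have "P1 \<bullet> v - p2 k \<bullet> (v + s1 *\<^sub>R (N *v v)) + s1 * (DE y1 t1 \<bullet> v + 2 * \<epsilon> * ((y1 - y0) \<bullet> v)) = 0"
              unfolding DG_def P1_def p2_def qk t1_def[symmetric] by (rule aux)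
            moreover have "(transpose N *v p2 k) \<bullet> v = p2 k \<bullet> (N *v v)"
              by (metis inner_transpose_vector inner_commute)
            ultimately show ?thesis unfolding Xk_def y1_def[symmetric] t1_def[symmetric]
              by (simp add: inner_diff_left inner_add_right algebra_simps)
          qed
          then have "P1 - p2 k - s1 *\<^sub>R Xk k = 0" by (metis inner_eq_zero_iff)
          then show ?thesis by (simp add: algebra_simps)
        qed
        \<comment> \<open>\<open>B\<close> is the matrix of the quadratic form \<open>DDG\<close>.
          Pairing it with \<open>a\<close> bounds from below the difference of the second order
          terms at the two points.\<close>
        define B where "B = (1 / s1) *\<^sub>R (M1 - M2 k) - (transpose N ** M2 k + M2 k ** N) - s1 *\<^sub>R (transpose N ** M2 k ** N)
           + DDE y1 t1 + (2 * \<epsilon>) *\<^sub>R mat 1"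
        have "v \<bullet> (B *v v) = DDG v" for v
        proof -
          have n1: "v \<bullet> ((transpose N ** M2 k) *v v) = (N *v v) \<bullet> (M2 k *v v)"
            unfolding matrix_vector_mul_assoc[symmetric] inner_transpose_vector ..
          have n2: "v \<bullet> ((M2 k ** N) *v v) = v \<bullet> (M2 k *v (N *v v))"
            unfolding matrix_vector_mul_assoc[symmetric] ..
          have n3: "v \<bullet> ((transpose N ** M2 k ** N) *v v) = (N *v v) \<bullet> (M2 k *v (N *v v))"
            unfolding matrix_vector_mul_assoc[symmetric] inner_transpose_vector ..
          show ?thesis
            unfolding B_def DDG_def
            using s1
            by (simp add: matrix_vector_mult_add_rdistrib matrix_vector_mult_diff_rdistrib matrix_vector_right_distrib
              inner_add_left inner_add_right inner_diff_right n1 n2 n3 scaleR_matrix_vector_assoc[symmetric]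
              matrix_vector_mult_scaleR divide_simps)
             (simp add: algebra_simps)
        qed
        then have "a y1 \<bullet> B \<ge> 0"
          using space by (intro psd_inner_psd a_psd[OF yV] a_sym[OF yV]) auto
        then have aB: "(a y1 \<bullet> M1 - a y1 \<bullet> M2 k) / s1 - a y1 \<bullet> (transpose N ** M2 k + M2 k ** N) - s1 * (a y1 \<bullet> (transpose N ** M2 k ** N))
           + a y1 \<bullet> DDE y1 t1 + 2 * \<epsilon> * (a y1 \<bullet> mat 1) \<ge> 0"
          unfolding B_def by (simp add: inner_add_right inner_diff_right)
        \<comment> \<open>The equation at the two points of the quotient. Their difference takes the
          place of the differentiated equation, which would contain third derivatives of l.\<close>
        have e1: "lt y1 (t1 + s1) = a y1 \<bullet> M1 + b y1 \<bullet> P1 + P1 \<bullet> (a y1 *v P1) + c * (1 - exp (l y1 (t1 + s1)))"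
          using eq[OF yV, of "t1 + s1"] t1 s1 by (simp add: M1_def P1_def)
        have e2: "lt (q k) t1 = a (q k) \<bullet> M2 k + b (q k) \<bullet> p2 k + p2 k \<bullet> (a (q k) *v p2 k) + c * (1 - exp (l (q k) t1))"
          using eq[OF qV, of "t1"] t1 by (simp add: M2_def p2_def t1_def)
        have aq: "a (q k) = a y1 + s1 *\<^sub>R A' k" and bq: "b (q k) = b y1 + s1 *\<^sub>R B' k"
          using s1 by (simp_all add: A'_def B'_def s1_def y1_def)
        have sx: "x \<bullet> (a y1 *v x') = x' \<bullet> (a y1 *v x)" for x x'
          by (metis a_sym[OF yV] inner_transpose_vector inner_commute)
        have Rk: "exp (l y1 (t1 + s1)) = exp (l (q k) t1) + s1 * R' k"
          using s1 by (simp add: R'_def s1_def y1_def t1_def)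
        have "lt y1 (t1 + s1) - lt (q k) t1 = (a y1 \<bullet> M1 - a y1 \<bullet> M2 k) - s1 * (A' k \<bullet> M2 k)
          + s1 * (b y1 \<bullet> Xk k - B' k \<bullet> p2 k) + s1 * (2 * (Xk k \<bullet> (a y1 *v p2 k)) + s1 * (Xk k \<bullet> (a y1 *v Xk k))
          - p2 k \<bullet> (A' k *v p2 k)) - c * (s1 * R' k)"
          unfolding e1 e2 aq bq Rk P1eq
          by (simp add: inner_add_left inner_add_right matrix_vector_mult_add_rdistrib matrix_vector_right_distrib
              scaleR_matrix_vector_assoc[symmetric] matrix_vector_mult_scaleR sx[of "p2 k" "Xk k"] algebra_simps)
        also have "\<dots> = s1 * ((a y1 \<bullet> M1 - a y1 \<bullet> M2 k) / s1 - (A' k \<bullet> M2 k)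
          + (b y1 \<bullet> Xk k - B' k \<bullet> p2 k) + (2 * (Xk k \<bullet> (a y1 *v p2 k)) + s1 * (Xk k \<bullet> (a y1 *v Xk k))
          - p2 k \<bullet> (A' k *v p2 k)) - c * R' k)"
          using s1 by (simp add: field_simps)
        finally have "(lt y1 (t1 + s1) - lt (q k) t1) / s1 = (a y1 \<bullet> M1 - a y1 \<bullet> M2 k) / s1 - (A' k \<bullet> M2 k)
          + (b y1 \<bullet> Xk k - B' k \<bullet> p2 k) + (2 * (Xk k \<bullet> (a y1 *v p2 k)) + s1 * (Xk k \<bullet> (a y1 *v Xk k))
          - p2 k \<bullet> (A' k *v p2 k)) - c * R' k"
          using s1 by (simp del: times_divide_eq_right)
        with time aB show "Q k \<le> 0"
          unfolding Q_def y1_def[symmetric] t1_def[symmetric] s1_def[symmetric] by linarith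
      qed
    qed
    then have "\<exists>N. \<forall>n\<ge>N. Q n \<le> 0" by (simp add: eventually_sequentially)
    from LIMSEQ_le_const2[OF lim this] show ?thesis by simp
  qed
  have "?Q \<le> 0 + e" if e: "e > 0" for e
  proof -
    define C where "C = \<bar>2 * (a y0 \<bullet> mat 1)\<bar> + 1"
    have C: "C > 0" by (simp add: C_def add_nonneg_pos)
    have "?Q \<le> (e / C) * (2 * (a y0 \<bullet> mat 1))" using main[of "e / C"] e C by simp
    also have "\<dots> \<le> (e / C) * C" using e C by (intro mult_left_mono) (auto simp: C_def)
    finally show ?thesis using C by simp
  qed
  then show ?thesis by (rule field_le_epsilon)
qed

section \<open>Partial derivatives\<close>

lemma has_derivative_partial:
  fixes F :: "real^'n \<Rightarrow> 'b::real_normed_vector"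
  assumes "F differentiable (at y)"
  shows "(F has_derivative (\<lambda>v. \<Sum>i\<in>UNIV. v $ i *\<^sub>R partial_deriv i F y)) (at y)"
proof -
  have 1: "(F has_derivative frechet_derivative F (at y)) (at y)"
    using assms frechet_derivative_works by blast
  then have lin: "linear (frechet_derivative F (at y))"
    by (rule has_derivative_linear)
  have "frechet_derivative F (at y) v = (\<Sum>i\<in>UNIV. v $ i *\<^sub>R partial_deriv i F y)" for v
  proof -
    have "v = (\<Sum>i\<in>UNIV. v $ i *\<^sub>R axis i 1)"
      by (simp add: basis_expansion scalar_mult_eq_scaleR[symmetric])
    then have "frechet_derivative F (at y) v = frechet_derivative F (at y) (\<Sum>i\<in>UNIV. v $ i *\<^sub>R axis i 1)"
      by simp
    then show ?thesis
      by (simp add: linear_sum[OF lin] linear_cmul[OF lin] partial_deriv_def)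
  qed
  then have "frechet_derivative F (at y) = (\<lambda>v. \<Sum>i\<in>UNIV. v $ i *\<^sub>R partial_deriv i F y)" by (rule ext)
  with 1 show ?thesis by simp
qed

lemma partial_deriv_eqI:
  assumes "(F has_derivative F') (at y)"
  shows "partial_deriv i F y = F' (axis i 1)"
  using frechet_derivative_at[OF assms] by (simp add: partial_deriv_def)

lemma partial_deriv_cong:
  assumes "open V" "y \<in> V" "\<And>z. z \<in> V \<Longrightarrow> F z = G z"
  shows "partial_deriv i F y = partial_deriv i G y"
proof -
  have "(F has_derivative F') (at y) \<longleftrightarrow> (G has_derivative F') (at y)" for F'
    using has_derivative_transform_within_open[OF _ assms(1,2), of F F' UNIV G]
      has_derivative_transform_within_open[OF _ assms(1,2), of G F' UNIV F] assms(3) by fastforce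
  then show ?thesis by (simp add: partial_deriv_def frechet_derivative_def)
qed

lemma differentiable_on_open_at:
  "open V \<Longrightarrow> y \<in> V \<Longrightarrow> F differentiable_on V \<Longrightarrow> F differentiable (at y)"
  by (metis at_within_open differentiable_on_def)

lemma differentiable_onI_at:
  "(\<And>y. y \<in> V \<Longrightarrow> F differentiable (at y)) \<Longrightarrow> F differentiable_on V"
  by (simp add: differentiable_at_imp_differentiable_on)

lemma Ck_on_cong:
  assumes V: "open V"
  shows "(\<And>z. z \<in> V \<Longrightarrow> F z = G z) \<Longrightarrow> Ck_on k F V \<longleftrightarrow> Ck_on k G V"
proof (induction k arbitrary: F G)
  case 0
  then show ?case by (simp cong: continuous_on_cong)
next
  case (Suc k)
  have "F differentiable_on V \<longleftrightarrow> G differentiable_on V"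
    using Suc.prems unfolding differentiable_on_def differentiable_def
    by (metis has_derivative_transform)
  moreover have "Ck_on k (partial_deriv i F) V \<longleftrightarrow> Ck_on k (partial_deriv i G) V" for i
    by (rule Suc.IH) (rule partial_deriv_cong[OF V _ Suc.prems])
  ultimately show ?case by simp
qed

lemma partial_deriv_linear:
  assumes "bounded_linear L" "F differentiable (at y)"
  shows "partial_deriv i (\<lambda>z. L (F z)) y = L (partial_deriv i F y)"
proof -
  have "(F has_derivative frechet_derivative F (at y)) (at y)"
    using assms frechet_derivative_works by blast
  from bounded_linear.has_derivative[OF assms(1) this] show ?thesis
    by (subst partial_deriv_eqI) (auto simp: partial_deriv_def)
qed

lemma Ck_on_linear:
  assumes V: "open V" and L: "bounded_linear L"
  shows "Ck_on k F V \<Longrightarrow> Ck_on k (\<lambda>z. L (F z)) V"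
proof (induction k arbitrary: F)
  case 0
  then show ?case by (simp add: bounded_linear.continuous_on[OF L])
next
  case (Suc k)
  then have d: "F differentiable (at y)" if "y \<in> V" for y
    by (intro differentiable_on_open_at[OF V that]) simp
  have "(\<lambda>z. L (F z)) differentiable (at y)" if "y \<in> V" for y
    by (rule differentiableI)
      (rule bounded_linear.has_derivative[OF L d[OF that, unfolded frechet_derivative_works]])
  then have "(\<lambda>z. L (F z)) differentiable_on V" by (rule differentiable_onI_at)
  moreover have "Ck_on k (partial_deriv i (\<lambda>z. L (F z))) V" for i
    using Suc by (subst Ck_on_cong[OF V partial_deriv_linear[OF L d]]) auto
  ultimately show ?case by simp
qed

lemma has_derivative_bilinear_partial:
  assumes B: "bounded_bilinear B" and d: "F differentiable (at y)" "G differentiable (at y)"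
  shows "partial_deriv i (\<lambda>z. B (F z) (G z)) y = B (F y) (partial_deriv i G y) + B (partial_deriv i F y) (G y)"
proof -
  have "(F has_derivative frechet_derivative F (at y)) (at y)" "(G has_derivative frechet_derivative G (at y)) (at y)"
    using d frechet_derivative_works by blast+
  from bounded_bilinear.FDERIV[OF B this] show ?thesis
    by (subst partial_deriv_eqI) (auto simp: partial_deriv_def)
qed

abbreviation C1_on :: "(real^'n::finite \<Rightarrow> 'b::real_normed_vector) \<Rightarrow> (real^'n) set \<Rightarrow> bool" where
  "C1_on \<equiv> Ck_on (Suc 0)"

lemma C1_on_differentiable: "C1_on F V \<Longrightarrow> open V \<Longrightarrow> y \<in> V \<Longrightarrow> F differentiable (at y)"
  using differentiable_on_open_at by auto

lemma C1_on_continuous: "C1_on F V \<Longrightarrow> continuous_on V F"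
  by (simp add: differentiable_imp_continuous_on)

lemma partial_deriv_add:
  assumes "F differentiable (at y)" "G differentiable (at y)"
  shows "partial_deriv i (\<lambda>z. F z + G z) y = partial_deriv i F y + partial_deriv i G y"
proof -
  have "(F has_derivative frechet_derivative F (at y)) (at y)" "(G has_derivative frechet_derivative G (at y)) (at y)"
    using assms frechet_derivative_works by blast+
  from has_derivative_add[OF this] show ?thesis
    by (subst partial_deriv_eqI) (auto simp: partial_deriv_def)
qed

lemma partial_deriv_const [simp]: "partial_deriv i (\<lambda>z. c) y = 0"
  by (simp add: partial_deriv_def)

lemma C1_on_const: "C1_on (\<lambda>z. c) V"
  by (simp add: partial_deriv_def[abs_def])

lemma C1_on_add:
  assumes V: "open V" and F: "C1_on F V" "C1_on G V"
  shows "C1_on (\<lambda>z. F z + G z) V"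
proof -
  have "continuous_on V (partial_deriv i (\<lambda>z. F z + G z))" for i
    by (subst continuous_on_cong[OF refl partial_deriv_add])
      (use assms C1_on_differentiable in \<open>auto intro!: continuous_intros\<close>)
  then show ?thesis using F by (simp add: differentiable_on_add)
qed

lemma C1_on_bilinear:
  assumes B: "bounded_bilinear B" and V: "open V" and F: "C1_on F V" "C1_on G V"
  shows "C1_on (\<lambda>z. B (F z) (G z)) V"
proof -
  have "(\<lambda>z. B (F z) (G z)) differentiable (at y)" if "y \<in> V" for y
    by (rule differentiableI)
      (rule bounded_bilinear.FDERIV[OF B C1_on_differentiable[OF F(1) V that, unfolded frechet_derivative_works]
        C1_on_differentiable[OF F(2) V that, unfolded frechet_derivative_works]])
  then have "(\<lambda>z. B (F z) (G z)) differentiable_on V" by (rule differentiable_onI_at)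
  moreover have "continuous_on V (partial_deriv i (\<lambda>z. B (F z) (G z)))" for i
  proof -
    have "continuous_on V (\<lambda>y. B (F y) (partial_deriv i G y) + B (partial_deriv i F y) (G y))"
      using F C1_on_continuous[OF F(1)] C1_on_continuous[OF F(2)]
      by (auto intro!: continuous_on_add bounded_bilinear.continuous_on[OF B])
    then show ?thesis
      by (subst continuous_on_cong[OF refl has_derivative_bilinear_partial[OF B
        C1_on_differentiable[OF F(1) V] C1_on_differentiable[OF F(2) V]]])
  qed
  ultimately show ?thesis by simp
qed

lemma C1_on_sum:
  assumes V: "open V" and F: "\<And>i. i \<in> I \<Longrightarrow> C1_on (F i) V"
  shows "C1_on (\<lambda>z. \<Sum>i\<in>I. F i z) V"
  using F by (induction I rule: infinite_finite_induct) (auto intro!: C1_on_const C1_on_add[OF V] simp del: Ck_on.simps)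

lemma partial_deriv_sum:
  assumes "finite I" and F: "\<And>i. i \<in> I \<Longrightarrow> F i differentiable (at y)"
  shows "partial_deriv k (\<lambda>z. \<Sum>i\<in>I. F i z) y = (\<Sum>i\<in>I. partial_deriv k (F i) y)"
  using assms by (induction I rule: finite_induct) (simp_all add: partial_deriv_add differentiable_sum)

lemma bounded_linear_matrix_component: "bounded_linear (\<lambda>A :: real^'n^'m. A $ i $ j)"
  by (intro bounded_linear_compose[OF bounded_linear_vec_nth bounded_linear_vec_nth])

lemma vec_eq_sum_axis: "x = (\<Sum>i\<in>UNIV. axis i (x $ i))" for x :: "'b::real_normed_vector^'m"
proof -
  have "(\<Sum>i\<in>UNIV. axis i (x $ i)) $ j = x $ j" for j
  proof -
    have "(\<Sum>i\<in>UNIV. axis i (x $ i)) $ j = (\<Sum>i\<in>UNIV. if i = j then x $ i else 0)"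
      unfolding sum_component by (rule sum.cong) (auto simp: axis_def)
    then show ?thesis by simp
  qed
  then show ?thesis by (simp add: vec_eq_iff)
qed

lemma C1_on_vec:
  fixes F :: "real^'k::finite \<Rightarrow> 'b::euclidean_space^'m"
  assumes V: "open V" and F: "\<And>i. C1_on (\<lambda>z. F z $ i) V"
  shows "C1_on F V"
proof -
  have "linear (axis i :: 'b \<Rightarrow> 'b^'m)" for i
    by (intro linearI) (auto simp: axis_def vec_eq_iff)
  then have bl: "bounded_linear (axis i :: 'b \<Rightarrow> 'b^'m)" for i
    by (simp add: linear_conv_bounded_linear)
  have "C1_on (\<lambda>z. \<Sum>i\<in>UNIV. axis i (F z $ i)) V"
    by (intro C1_on_sum V Ck_on_linear[OF V bl] F)
  then show ?thesis by (subst Ck_on_cong[OF V vec_eq_sum_axis])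
qed

lemma C1_on_matrix:
  fixes F :: "real^'k::finite \<Rightarrow> real^'n^'m"
  assumes V: "open V" and F: "\<And>i j. C1_on (\<lambda>z. F z $ i $ j) V"
  shows "C1_on F V"
  by (intro C1_on_vec V F)

lemma C1_on_strict:
  fixes F :: "real^'n \<Rightarrow> real"
  assumes V: "open V" "y \<in> V" and F: "C1_on F V"
  shows "strict_derivative F (\<lambda>v. \<Sum>i\<in>UNIV. v $ i *\<^sub>R partial_deriv i F y) y"
proof -
  have "C1_gradient V F (\<lambda>y. \<chi> i. partial_deriv i F y)"
    unfolding C1_gradient_def
  proof (intro conjI ballI)
    fix z assume "z \<in> V"
    moreover have "(\<lambda>v. (\<chi> i. partial_deriv i F z) \<bullet> v) = (\<lambda>v. \<Sum>i\<in>UNIV. v $ i *\<^sub>R partial_deriv i F z)"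
      by (simp add: fun_eq_iff inner_vec_def mult.commute)
    ultimately show "(F has_derivative (\<lambda>v. (\<chi> i. partial_deriv i F z) \<bullet> v)) (at z)"
      using has_derivative_partial[OF C1_on_differentiable[OF F V(1)]] by simp
  next
    show "continuous_on V (\<lambda>y. \<chi> i. partial_deriv i F y)"
      using F by (auto intro!: continuous_on_vec_lambda)
  qed
  from C1_gradient_strict[OF this V] show ?thesis by (simp add: inner_vec_def mult.commute)
qed

lemma C1_on_strict_vec:
  fixes F :: "real^'n \<Rightarrow> real^'m"
  assumes V: "open V" "y \<in> V" and F: "C1_on F V"
  shows "strict_derivative F (\<lambda>v. \<Sum>i\<in>UNIV. v $ i *\<^sub>R partial_deriv i F y) y"
proof -
  have "strict_derivative F (\<lambda>v. \<chi> j. \<Sum>i\<in>UNIV. v $ i *\<^sub>R partial_deriv i (\<lambda>z. F z $ j) y) y"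
    by (intro strict_derivative_vec C1_on_strict[OF V] Ck_on_linear[OF V(1) bounded_linear_vec_nth F])
  moreover have "partial_deriv i (\<lambda>z. F z $ j) y = partial_deriv i F y $ j" for i j
    using partial_deriv_linear[OF bounded_linear_vec_nth C1_on_differentiable[OF F V]] .
  moreover have "(\<chi> j. \<Sum>i\<in>UNIV. v $ i *\<^sub>R partial_deriv i F y $ j) = (\<Sum>i\<in>UNIV. v $ i *\<^sub>R partial_deriv i F y)" for v
    by (simp add: vec_eq_iff)
  ultimately show ?thesis by simp
qed

lemma C1_on_strict_matrix:
  fixes F :: "real^'n \<Rightarrow> real^'k^'m"
  assumes V: "open V" "y \<in> V" and F: "C1_on F V"
  shows "strict_derivative F (\<lambda>v. \<Sum>i\<in>UNIV. v $ i *\<^sub>R partial_deriv i F y) y"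
proof -
  have "strict_derivative F (\<lambda>v. \<chi> j. \<Sum>i\<in>UNIV. v $ i *\<^sub>R partial_deriv i (\<lambda>z. F z $ j) y) y"
    by (intro strict_derivative_vec C1_on_strict_vec[OF V] Ck_on_linear[OF V(1) bounded_linear_vec_nth F])
  moreover have "partial_deriv i (\<lambda>z. F z $ j) y = partial_deriv i F y $ j" for i j
    using partial_deriv_linear[OF bounded_linear_vec_nth C1_on_differentiable[OF F V]] .
  moreover have "(\<chi> j. \<Sum>i\<in>UNIV. v $ i *\<^sub>R partial_deriv i F y $ j) = (\<Sum>i\<in>UNIV. v $ i *\<^sub>R partial_deriv i F y)" for v
    by (simp add: vec_eq_iff)
  ultimately show ?thesis by simp
qed

text \<open>The second difference \<open>Q\<close> is symmetric in i and j. The mean value theorem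
  in direction i turns it into a difference quotient of the i-th partial derivative with moving base
  point, whose limit strict differentiability provides.\<close>

lemma partial_deriv_symmetric:
  fixes u :: "real^'n \<Rightarrow> real"
  assumes V: "open V" "y \<in> V" and u: "Ck_on 2 u V"
  shows "partial_deriv i (partial_deriv j u) y = partial_deriv j (partial_deriv i u) y"
proof -
  have u1: "Ck_on (Suc (Suc 0)) u V" using u by (simp add: numeral_2_eq_2)
  have du: "\<And>z. z \<in> V \<Longrightarrow> u differentiable (at z)" using u1 by (intro differentiable_on_open_at[OF V(1)]) auto
  obtain r where r: "r > 0" "ball y r \<subseteq> V" using V openE by blast
  \<comment> \<open>With steps of at most r / 3 the whole coordinate parallelogram lies within
    distance 2 r / 3 of y, hence in the ball.\<close>
  define \<tau> where "\<tau> k = r / 3 / (real k + 1)" for k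
  have \<tau>: "\<tau> k > 0" "\<tau> k \<le> r / 3" for k using r by (auto simp: \<tau>_def field_simps)
  have \<tau>0: "\<tau> \<longlonglongrightarrow> 0"
    unfolding \<tau>_def[abs_def] using LIMSEQ_Suc[OF lim_const_over_n[of "r/3"]] by (simp add: add.commute)
  define Q where "Q i j k = (u (y + \<tau> k *\<^sub>R axis i 1 + \<tau> k *\<^sub>R axis j 1) - u (y + \<tau> k *\<^sub>R axis i 1)
     - (u (y + \<tau> k *\<^sub>R axis j 1) - u y)) / (\<tau> k)^2" for i j k
  have lim: "Q i j \<longlonglongrightarrow> partial_deriv j (partial_deriv i u) y" for i j :: 'n
  proof -
    have ex: "\<exists>s. 0 < s \<and> s < \<tau> k \<and> Q i j k = (partial_deriv i u (y + s *\<^sub>R axis i 1 + \<tau> k *\<^sub>R axis j 1) - partial_deriv i u (y + s *\<^sub>R axis i 1)) / \<tau> k" for k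
    proof -
      define g where "g s = u (y + s *\<^sub>R axis i 1 + \<tau> k *\<^sub>R axis j 1) - u (y + s *\<^sub>R axis i 1)" for s
      have inV: "y + s *\<^sub>R axis i 1 + s' *\<^sub>R axis j 1 \<in> V" if "0 \<le> s" "s \<le> \<tau> k" "0 \<le> s'" "s' \<le> \<tau> k" for s s'
      proof -
        have "norm (s *\<^sub>R axis i 1 + s' *\<^sub>R (axis j 1 :: real^'n)) \<le> s + s'"
          using that by (intro norm_triangle_le) simp
        moreover have "dist y (y + s *\<^sub>R axis i 1 + s' *\<^sub>R axis j 1) = norm (s *\<^sub>R axis i 1 + s' *\<^sub>R (axis j 1 :: real^'n))"
          by (metis add.assoc add_diff_cancel_left' dist_commute dist_norm)
        ultimately have "dist y (y + s *\<^sub>R axis i 1 + s' *\<^sub>R axis j 1) < r"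
          using that \<tau>(2)[of k] r by linarith
        then show ?thesis using r by auto
      qed
      have pd: "((\<lambda>s. u (x + s *\<^sub>R axis i 1)) has_real_derivative partial_deriv i u (x + s *\<^sub>R axis i 1)) (at s)"
        if "x + s *\<^sub>R axis i 1 \<in> V" for x s
        unfolding has_real_derivative_iff_has_vector_derivative partial_deriv_def
        by (rule line_has_derivative) (rule du[OF that, unfolded frechet_derivative_works])
      have "\<exists>s. s > 0 \<and> s < \<tau> k \<and> g (\<tau> k) - g 0 = (\<tau> k - 0) * (partial_deriv i u (y + s *\<^sub>R axis i 1 + \<tau> k *\<^sub>R axis j 1) - partial_deriv i u (y + s *\<^sub>R axis i 1))"
      proof (rule MVT2)
        fix s assume s: "0 \<le> s" "s \<le> \<tau> k"
        have "((\<lambda>s. u ((y + \<tau> k *\<^sub>R axis j 1) + s *\<^sub>R axis i 1)) has_real_derivative partial_deriv i u ((y + \<tau> k *\<^sub>R axis j 1) + s *\<^sub>R axis i 1)) (at s)"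
          using inV[OF s, of "\<tau> k"] \<tau>(1)[of k] by (intro pd) (simp add: algebra_simps)
        moreover have "((\<lambda>s. u (y + s *\<^sub>R axis i 1)) has_real_derivative partial_deriv i u (y + s *\<^sub>R axis i 1)) (at s)"
          using inV[OF s, of 0] \<tau>(1)[of k] by (intro pd) simp
        ultimately show "(g has_real_derivative (partial_deriv i u (y + s *\<^sub>R axis i 1 + \<tau> k *\<^sub>R axis j 1) - partial_deriv i u (y + s *\<^sub>R axis i 1))) (at s)"
          unfolding g_def[abs_def] by (auto intro!: derivative_eq_intros simp: algebra_simps)
      qed (use \<tau> in auto)
      then obtain s where s: "s > 0" "s < \<tau> k" "g (\<tau> k) - g 0 = \<tau> k * (partial_deriv i u (y + s *\<^sub>R axis i 1 + \<tau> k *\<^sub>R axis j 1) - partial_deriv i u (y + s *\<^sub>R axis i 1))"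
        by auto
      have "Q i j k = (g (\<tau> k) - g 0) / (\<tau> k)^2" by (simp add: Q_def g_def)
      then show ?thesis using s \<tau>(1)[of k] by (auto simp: power2_eq_square)
    qed
    then obtain s where s: "\<And>k. 0 < s k" "\<And>k. s k < \<tau> k"
      "\<And>k. Q i j k = (partial_deriv i u (y + s k *\<^sub>R axis i 1 + \<tau> k *\<^sub>R axis j 1) - partial_deriv i u (y + s k *\<^sub>R axis i 1)) / \<tau> k"
      by metis
    have s0: "s \<longlonglongrightarrow> 0"
      by (rule tendsto_sandwich[OF _ _ tendsto_const \<tau>0]) (auto intro!: always_eventually less_imp_le s)
    have "(\<lambda>k. y + s k *\<^sub>R axis i 1) \<longlonglongrightarrow> y + 0 *\<^sub>R axis i 1" by (intro tendsto_intros s0)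
    then have p: "(\<lambda>k. y + s k *\<^sub>R axis i 1) \<longlonglongrightarrow> y" by simp
    have "C1_on (partial_deriv i u) V" using u1 by simp
    from strict_derivativeD[OF C1_on_strict[OF V this] p tendsto_const \<tau>0, of "axis j 1"] \<tau>(1)
    have "(\<lambda>k. Q i j k) \<longlonglongrightarrow> (\<Sum>m\<in>UNIV. (axis j 1 :: real^'n) $ m *\<^sub>R partial_deriv m (partial_deriv i u) y)"
      by (simp add: s(3) divide_inverse mult.commute less_imp_neq[symmetric])
    then show ?thesis by (simp add: axis_def if_distrib if_distribR cong: if_cong)
  qed
  have "Q j i = Q i j"
  proof
    fix k
    have "y + \<tau> k *\<^sub>R axis j 1 + \<tau> k *\<^sub>R axis i 1 = y + \<tau> k *\<^sub>R axis i 1 + \<tau> k *\<^sub>R axis j 1"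
      by (simp add: add_ac)
    note * = this
    show "Q j i k = Q i j k" unfolding Q_def by (subst *) simp
  qed
  then show ?thesis using lim[of i j] lim[of j i] LIMSEQ_unique by metis
qed

section \<open>Metric coefficients in a chart\<close>

lemmas matrix_vector_minus_left = bounded_bilinear.minus_left[OF bounded_bilinear_matrix_vector]
lemmas matrix_mul_rdistrib = bounded_bilinear.add_left[OF bounded_bilinear_matrix_matrix]

lemma differentiable_cong_open:
  assumes "F differentiable (at y)" "open V" "y \<in> V" "\<And>z. z \<in> V \<Longrightarrow> F z = G z"
  shows "G differentiable (at y)"
  by (rule differentiableI)
    (rule has_derivative_transform_within_open[OF assms(1)[unfolded frechet_derivative_works] assms(2-4)])

lemma differentiable_vec:
  fixes F :: "'a::real_normed_vector \<Rightarrow> 'b::euclidean_space^'m"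
  assumes "\<And>i. (\<lambda>z. F z $ i) differentiable (at y)"
  shows "F differentiable (at y)"
proof -
  have "linear (axis i :: 'b \<Rightarrow> 'b^'m)" for i
    by (intro linearI) (auto simp: axis_def vec_eq_iff)
  then have bl: "bounded_linear (axis i :: 'b \<Rightarrow> 'b^'m)" for i
    by (simp add: linear_conv_bounded_linear)
  have "(\<lambda>z. axis i (F z $ i) :: 'b^'m) differentiable (at y)" for i
    by (rule differentiableI, rule bounded_linear.has_derivative[OF bl])
      (rule assms[unfolded frechet_derivative_works])
  then have "(\<lambda>z. \<Sum>i\<in>UNIV. axis i (F z $ i)) differentiable (at y)"
    by (intro differentiable_sum) auto
  then show ?thesis by (simp only: vec_eq_sum_axis[symmetric])
qed

lemma det_differentiable:
  fixes F :: "'a::real_normed_vector \<Rightarrow> real^'n^'n"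
  assumes "\<And>i j. (\<lambda>z. F z $ i $ j) differentiable (at y)"
  shows "(\<lambda>z. det (F z)) differentiable (at y)"
proof -
  obtain D where D: "\<And>i j. ((\<lambda>z. F z $ i $ j) has_derivative D i j) (at y)"
    using assms unfolding differentiable_def by metis
  have "((\<lambda>z. \<Prod>i\<in>UNIV. F z $ i $ p i) has_derivative
     (\<lambda>v. \<Sum>i\<in>UNIV. D i (p i) v * (\<Prod>j\<in>UNIV - {i}. F y $ j $ p j))) (at y)" for p
    by (rule has_derivative_prod) (rule D)
  from has_derivative_sum[of "{p. p permutes UNIV}", OF has_derivative_mult_right[OF this]]
  show ?thesis unfolding det_def by (rule differentiableI)
qed

text \<open>Jacobi's formula at the identity. A permutation other than the identity moves at least
  two indices, so in the Leibniz expansion an off-diagonal zero remains after one factor has been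
  differentiated.\<close>

lemma partial_deriv_det:
  fixes F :: "real^'k \<Rightarrow> real^'n^'n"
  assumes d: "F differentiable (at y)" and F: "F y = mat 1"
  shows "partial_deriv k (\<lambda>z. det (F z)) y = trace (partial_deriv k F y)"
proof -
  have F': "(F has_derivative frechet_derivative F (at y)) (at y)"
    using d frechet_derivative_works by blast
  define D where "D v = frechet_derivative F (at y) v" for v
  have D: "((\<lambda>z. F z $ i $ j) has_derivative (\<lambda>v. D v $ i $ j)) (at y)" for i j
    using bounded_linear.has_derivative[OF bounded_linear_matrix_component F'] by (simp add: D_def)
  have "((\<lambda>z. \<Prod>i\<in>UNIV. F z $ i $ p i) has_derivative
     (\<lambda>v. \<Sum>i\<in>UNIV. D v $ i $ p i * (\<Prod>j\<in>UNIV - {i}. F y $ j $ p j))) (at y)" for p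
    by (rule has_derivative_prod) (rule D)
  from has_derivative_sum[of "{p. p permutes UNIV}", OF has_derivative_mult_right[OF this]]
  have "((\<lambda>z. det (F z)) has_derivative (\<lambda>v. \<Sum>p | p permutes UNIV. of_int (sign p) *
     (\<Sum>i\<in>UNIV. D v $ i $ p i * (\<Prod>j\<in>UNIV - {i}. F y $ j $ p j)))) (at y)"
    unfolding det_def .
  from partial_deriv_eqI[OF this]
  have "partial_deriv k (\<lambda>z. det (F z)) y = (\<Sum>p | p permutes UNIV. of_int (sign p) *
     (\<Sum>i\<in>UNIV. D (axis k 1) $ i $ p i * (\<Prod>j\<in>UNIV - {i}. F y $ j $ p j)))" .
  also have "\<dots> = (\<Sum>p\<in>{id}. of_int (sign p) *
     (\<Sum>i\<in>UNIV. D (axis k 1) $ i $ p i * (\<Prod>j\<in>UNIV - {i}. F y $ j $ p j)))"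
  proof (rule sum.mono_neutral_right)
    show "\<forall>p\<in>{p. p permutes UNIV} - {id}. of_int (sign p) *
       (\<Sum>i\<in>UNIV. D (axis k 1) $ i $ p i * (\<Prod>j\<in>UNIV - {i}. F y $ j $ p j)) = 0"
    proof
      fix p :: "'n \<Rightarrow> 'n" assume p: "p \<in> {p. p permutes UNIV} - {id}"
      have "(\<Prod>j\<in>UNIV - {i}. F y $ j $ p j) = 0" for i
      proof -
        have "\<exists>j. j \<noteq> i \<and> j \<noteq> p j"
        proof (rule ccontr)
          assume *: "\<not> ?thesis"
          have inj: "inj p" using p permutes_inj by blast
          have "p i = i"
          proof (rule ccontr)
            assume "p i \<noteq> i"
            moreover have "\<not> (p i \<noteq> i \<and> p i \<noteq> p (p i))" using * by blast
            ultimately have "p (p i) = p i" by metis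
            then show False using injD[OF inj] \<open>p i \<noteq> i\<close> by blast
          qed
          then have "p j = j" for j using * by metis
          then have "p = id" by auto
          with p show False by simp
        qed
        then obtain j where "j \<noteq> i" "j \<noteq> p j" by blast
        then show ?thesis by (intro prod_zero) (auto simp: F mat_def intro!: bexI[of _ j])
      qed
      then show "of_int (sign p) * (\<Sum>i\<in>UNIV. D (axis k 1) $ i $ p i * (\<Prod>j\<in>UNIV - {i}. F y $ j $ p j)) = 0"
        by (simp only: mult_zero_right sum.neutral_const)
    qed
  qed (auto simp: permutes_id)
  also have "\<dots> = trace (D (axis k 1))"
    by (simp add: F mat_def trace_def)
  finally show ?thesis by (simp add: D_def partial_deriv_def)
qed

text \<open>The coordinates of the differential; the Riemannian gradient is the inverse metric
  applied to this vector.\<close>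

definition pgrad :: "(real^'n::finite \<Rightarrow> real) \<Rightarrow> real^'n \<Rightarrow> real^'n" where
  "pgrad u y = (\<chi> i. partial_deriv i u y)"

definition jac :: "(real^'n::finite \<Rightarrow> real^'m::finite) \<Rightarrow> real^'n \<Rightarrow> real^'n^'m" where
  "jac F y = (\<chi> i j. partial_deriv j F y $ i)"

lemma has_derivative_pgrad:
  assumes "u differentiable (at y)"
  shows "(u has_derivative (\<lambda>v. pgrad u y \<bullet> v)) (at y)"
proof -
  have "(\<lambda>v. pgrad u y \<bullet> v) = (\<lambda>v. \<Sum>i\<in>UNIV. v $ i *\<^sub>R partial_deriv i u y)"
    by (simp add: fun_eq_iff pgrad_def inner_vec_def mult.commute)
  then show ?thesis using has_derivative_partial[OF assms] by simp
qed

lemma has_derivative_jac: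
  assumes "F differentiable (at y)"
  shows "(F has_derivative (\<lambda>v. jac F y *v v)) (at y)"
proof -
  have "(\<lambda>v. jac F y *v v) = (\<lambda>v. \<Sum>i\<in>UNIV. v $ i *\<^sub>R partial_deriv i F y)"
    by (simp add: fun_eq_iff jac_def matrix_vector_mult_def vec_eq_iff mult.commute)
  then show ?thesis using has_derivative_partial[OF assms] by simp
qed

lemma C1_on_pgrad:
  assumes "open V" "Ck_on 2 u V"
  shows "C1_on (pgrad u) V"
proof (rule C1_on_vec[OF assms(1)])
  fix i
  have "C1_on (partial_deriv i u) V" using assms(2) by (simp add: numeral_2_eq_2)
  then show "C1_on (\<lambda>z. pgrad u z $ i) V" by (simp add: pgrad_def del: Ck_on.simps)
qed

text \<open>Both sides contract X with a family that is symmetric in its two lower indices, so only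
  the symmetric part of X matters. It will be applied to the Christoffel symbols.\<close>

lemma symmetric_family_sum:
  fixes T :: "'n::finite \<Rightarrow> real^'n^'m"
  assumes T: "\<And>i j. T i *v axis j 1 = T j *v axis i 1"
  shows "(\<Sum>i\<in>UNIV. T i *v (X *v axis i 1)) = (\<Sum>i\<in>UNIV. T i *v (transpose X *v axis i 1))"
proof -
  have e: "X *v axis i 1 = (\<Sum>m\<in>UNIV. X $ m $ i *\<^sub>R axis m 1)" for X :: "real^'n^'n" and i
    by (subst basis_expansion[symmetric, of "X *v axis i 1"])
      (simp add: scalar_mult_eq_scaleR matrix_vector_mult_basis column_def)
  have "(\<Sum>i\<in>UNIV. T i *v (X *v axis i 1)) = (\<Sum>i\<in>UNIV. \<Sum>m\<in>UNIV. X $ m $ i *\<^sub>R (T i *v axis m 1))" for X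
    unfolding e by (simp add: linear_sum[OF matrix_vector_mul_linear] linear_cmul[OF matrix_vector_mul_linear])
  note * = this
  have "(\<Sum>i\<in>UNIV. T i *v (X *v axis i 1)) = (\<Sum>i\<in>UNIV. \<Sum>m\<in>UNIV. X $ m $ i *\<^sub>R (T m *v axis i 1))"
    unfolding * by (intro sum.cong refl) (metis T)
  also have "\<dots> = (\<Sum>m\<in>UNIV. \<Sum>i\<in>UNIV. X $ m $ i *\<^sub>R (T m *v axis i 1))" by (rule sum.swap)
  also have "\<dots> = (\<Sum>i\<in>UNIV. T i *v (transpose X *v axis i 1))"
    unfolding * by (simp add: transpose_def)
  finally show ?thesis .
qed

section \<open>Christoffel symbols and the Laplacian in one chart\<close>

locale chart_metric =
  fixes V :: "(real^'n::finite) set" and h :: "real^'n \<Rightarrow> real^'n^'n"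
  assumes V: "open V" and smooth: "smooth_on h V"
    and sym: "y \<in> V \<Longrightarrow> transpose (h y) = h y"
    and pos: "y \<in> V \<Longrightarrow> v \<noteq> 0 \<Longrightarrow> v \<bullet> (h y *v v) > 0"
begin

definition a :: "real^'n \<Rightarrow> real^'n^'n" where "a y = matrix_inv (h y)"
text \<open>The connection matrix in direction k: the covariant derivative of a field W in this
  direction is its partial derivative plus \<open>\<Gamma> k y *v W y\<close>. Working with these
  matrices replaces most index calculations.\<close>

definition \<Gamma> :: "'n \<Rightarrow> real^'n \<Rightarrow> real^'n^'n" where "\<Gamma> k y = (\<chi> p i. christoffel h p k i y)"
text \<open>The first order coefficient of the Laplacian, that is, minus the trace of the
  Christoffel symbols with respect to the inverse metric.\<close>

definition b :: "real^'n \<Rightarrow> real^'n" where "b y = - (\<Sum>i\<in>UNIV. \<Gamma> i y *v (a y *v axis i 1))"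

lemma h_inv: 
  assumes "y \<in> V" shows "a y ** h y = mat 1" "h y ** a y = mat 1" "det (h y) \<noteq> 0"
proof -
  have "x = 0" if "h y *v x = 0" for x
    using pos[OF assms, of x] that by (cases "x = 0") auto
  then have "invertible (h y)"
    by (simp add: invertible_left_inverse matrix_left_invertible_ker)
  then show "a y ** h y = mat 1" "h y ** a y = mat 1" "det (h y) \<noteq> 0"
    using someI_ex[of "\<lambda>B. h y ** B = mat 1 \<and> B ** h y = mat 1"] invertible_det_nz[of "h y"]
    unfolding a_def matrix_inv_def invertible_def by blast+
qed

lemma h_a: "y \<in> V \<Longrightarrow> h y *v (a y *v v) = v" and a_h: "y \<in> V \<Longrightarrow> a y *v (h y *v v) = v"
  using h_inv by (simp_all add: matrix_vector_mul_assoc)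

lemma a_sym: assumes "y \<in> V" shows "transpose (a y) = a y"
proof -
  have "transpose (a y) = transpose (a y) ** (h y ** a y)" by (simp add: h_inv assms)
  also have "\<dots> = (transpose (a y) ** transpose (h y)) ** a y" by (simp add: sym assms matrix_mul_assoc)
  also have "transpose (a y) ** transpose (h y) = mat 1"
    by (metis h_inv(2) assms matrix_transpose_mul transpose_mat)
  finally show ?thesis by simp
qed

lemma h_swap: "y \<in> V \<Longrightarrow> v \<bullet> (h y *v w) = (h y *v v) \<bullet> w"
  and a_swap: "y \<in> V \<Longrightarrow> v \<bullet> (a y *v w) = (a y *v v) \<bullet> w"
  using inner_transpose_vector[of v "h y" w] inner_transpose_vector[of v "a y" w] sym a_sym by simp_all

lemma a_pos: assumes "y \<in> V" shows "v \<bullet> (a y *v v) \<ge> 0"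
proof -
  have "v \<bullet> (a y *v v) = (a y *v v) \<bullet> (h y *v (a y *v v))"
    by (metis assms h_a inner_commute)
  then show ?thesis using pos[OF assms, of "a y *v v"] by (cases "a y *v v = 0") auto
qed

lemma h_Ck: "Ck_on k h V"
  using smooth by (simp add: smooth_on_def)

lemma h_C1: "C1_on h V" and dh_C1: "C1_on (partial_deriv k h) V"
  using h_Ck[of "Suc 0"] h_Ck[of "Suc (Suc 0)"] by auto

lemma h_diff: "y \<in> V \<Longrightarrow> h differentiable (at y)"
  by (rule C1_on_differentiable[OF h_C1 V])

lemma h_component_diff: "y \<in> V \<Longrightarrow> (\<lambda>z. h z $ i $ j) differentiable (at y)"
  by (rule differentiableI, rule bounded_linear.has_derivative[OF bounded_linear_matrix_component])
    (rule h_diff[unfolded frechet_derivative_works])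

text \<open>By Cramer's rule the entries of the inverse are quotients of determinants of
  differentiable matrices.\<close>

lemma a_diff: assumes y: "y \<in> V" shows "a differentiable (at y)"
proof -
  define C where "C z i k = (\<chi> r s. if s = i then (if r = k then 1 else 0) else h z $ r $ s) " for z :: "real^'n" and i k :: 'n
  have ent: "a z $ i $ k = det (C z i k) / det (h z)" if "z \<in> V" for z i k
  proof -
    have "h z *v (a z *v axis k 1) = axis k 1" using h_a[OF that] .
    then have "a z *v axis k 1 = (\<chi> i. det (\<chi> r s. if s = i then (axis k 1 :: real^'n) $ r else h z $ r $ s) / det (h z))"
      using cramer[OF h_inv(3)[OF that]] by blast
    then have "(a z *v axis k 1) $ i = det (C z i k) / det (h z)"
      by (simp add: C_def axis_def cong: if_cong)
    then show ?thesis by (simp add: matrix_vector_mult_basis column_def)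
  qed
  have quot: "(\<lambda>z. det (C z i k) / det (h z)) differentiable (at y)" for i k
  proof (intro differentiable_divide det_differentiable h_component_diff y h_inv(3))
    fix r s show "(\<lambda>z. C z i k $ r $ s) differentiable (at y)"
      by (cases "s = i") (simp_all add: C_def h_component_diff y)
  qed
  have "(\<lambda>z. a z $ i $ k) differentiable (at y)" for i k
    by (rule differentiable_cong_open[OF quot[of i k] V y]) (simp add: ent)
  then show ?thesis by (intro differentiable_vec)
qed

text \<open>Follows by differentiating \<open>a z ** h z = mat 1\<close>.\<close>

lemma partial_a:
  assumes y: "y \<in> V"
  shows "partial_deriv k a y = - (a y ** partial_deriv k h y ** a y)"
proof -
  have "partial_deriv k (\<lambda>z. a z ** h z) y = partial_deriv k (\<lambda>z. mat 1) y"
    by (rule partial_deriv_cong[OF V y]) (rule h_inv)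
  then have "a y ** partial_deriv k h y + partial_deriv k a y ** h y = 0"
    by (simp add: has_derivative_bilinear_partial[OF bounded_bilinear_matrix_matrix a_diff[OF y] h_diff[OF y]])
  then have "(a y ** partial_deriv k h y + partial_deriv k a y ** h y) ** a y = 0" by simp
  then have "a y ** partial_deriv k h y ** a y + partial_deriv k a y = 0"
    by (simp add: matrix_mul_rdistrib matrix_mul_assoc[symmetric] h_inv[OF y])
  then show ?thesis by (simp add: add_eq_0_iff)
qed

lemma a_C1: "C1_on a V"
proof -
  have da: "a differentiable_on V" by (rule differentiable_onI_at) (rule a_diff)
  have "continuous_on V (partial_deriv k a)" for k
  proof -
    have "continuous_on V (\<lambda>y. - (a y ** partial_deriv k h y ** a y))"
      by (intro continuous_on_minus bounded_bilinear.continuous_on[OF bounded_bilinear_matrix_matrix]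
          differentiable_imp_continuous_on[OF da] C1_on_continuous[OF dh_C1])
    then show ?thesis by (subst continuous_on_cong[OF refl partial_a])
  qed
  with da show ?thesis by simp
qed

lemma dh_component: "y \<in> V \<Longrightarrow> partial_deriv k (\<lambda>z. h z $ i $ j) y = partial_deriv k h y $ i $ j"
  by (rule partial_deriv_linear[OF bounded_linear_matrix_component h_diff])

lemma dh_sym: assumes "y \<in> V" shows "partial_deriv k h y $ i $ j = partial_deriv k h y $ j $ i"
proof -
  have "h z $ i $ j = h z $ j $ i" if "z \<in> V" for z
    using sym[OF that] by (metis transpose_def vec_lambda_beta)
  then have "partial_deriv k (\<lambda>z. h z $ i $ j) y = partial_deriv k (\<lambda>z. h z $ j $ i) y"
    by (rule partial_deriv_cong[OF V assms])
  then show ?thesis by (simp add: dh_component assms)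
qed

lemma \<Gamma>_entry:
  assumes "y \<in> V"
  shows "\<Gamma> k y $ p $ i = (\<Sum>l\<in>UNIV. a y $ p $ l * ((partial_deriv k h y $ i $ l + partial_deriv i h y $ k $ l
      - partial_deriv l h y $ k $ i) / 2))"
  unfolding \<Gamma>_def christoffel_def a_def using assms
  by (simp add: dh_component sum_distrib_left mult_ac)

lemma \<Gamma>_C1: "C1_on (\<Gamma> k) V"
proof (rule C1_on_matrix[OF V])
  fix p i
  have "C1_on (\<lambda>y. \<Sum>l\<in>UNIV. a y $ p $ l * (((partial_deriv k h y $ i $ l + partial_deriv i h y $ k $ l)
      + - 1 * (partial_deriv l h y $ k $ i)) / 2)) V"
    by (intro C1_on_sum V C1_on_bilinear[OF bounded_bilinear_mult V]
        Ck_on_linear[OF V bounded_linear_divide] C1_on_add[OF V] Ck_on_linear[OF V bounded_linear_matrix_component]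
        a_C1 dh_C1 C1_on_const)
  then show "C1_on (\<lambda>z. \<Gamma> k z $ p $ i) V"
    by (subst Ck_on_cong[OF V \<Gamma>_entry]) simp_all
qed

lemma \<Gamma>_diff: "y \<in> V \<Longrightarrow> \<Gamma> k differentiable (at y)"
  by (rule C1_on_differentiable[OF \<Gamma>_C1 V])

lemma \<Gamma>_sym: assumes "y \<in> V" shows "\<Gamma> k y *v axis i 1 = \<Gamma> i y *v axis k 1"
proof -
  have "\<Gamma> k y $ p $ i = \<Gamma> i y $ p $ k" for p
    unfolding \<Gamma>_entry[OF assms] by (simp add: dh_sym[OF assms, of _ i k] add.commute)
  then show ?thesis by (simp add: matrix_vector_mult_basis column_def)
qed

lemma \<Gamma>_sym_entry: "y \<in> V \<Longrightarrow> \<Gamma> k y $ p $ i = \<Gamma> i y $ p $ k"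
  using \<Gamma>_sym[of y k i] by (simp add: matrix_vector_mult_basis column_def vec_eq_iff)

text \<open>The metric is parallel for the Levi-Civita connection. The lowered matrix
  \<open>h y ** \<Gamma> k y\<close> is \<open>L\<close>; its symmetric part is half of the
  derivative of h in direction k, since the other two terms of the Christoffel formula are
  antisymmetric.\<close>

lemma dh_\<Gamma>:
  assumes y: "y \<in> V"
  shows "partial_deriv k h y = h y ** \<Gamma> k y + transpose (\<Gamma> k y) ** h y"
proof -
  define L where "L = (\<chi> l i. (partial_deriv k h y $ i $ l + partial_deriv i h y $ k $ l
      - partial_deriv l h y $ k $ i) / 2)"
  have "\<Gamma> k y = a y ** L"
    by (simp add: vec_eq_iff \<Gamma>_entry[OF y] matrix_matrix_mult_def L_def)
  then have hL: "h y ** \<Gamma> k y = L" by (simp add: matrix_mul_assoc h_inv[OF y])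
  have "transpose (\<Gamma> k y) ** h y = transpose (h y ** \<Gamma> k y)"
    by (simp add: matrix_transpose_mul sym[OF y])
  then have "h y ** \<Gamma> k y + transpose (\<Gamma> k y) ** h y = L + transpose L" by (simp add: hL)
  also have "\<dots> = partial_deriv k h y"
    unfolding vec_eq_iff
  proof (intro allI)
    fix l i show "(L + transpose L) $ l $ i = partial_deriv k h y $ l $ i"
      using dh_sym[OF y, of k i l] by (simp add: L_def transpose_def field_simps)
  qed
  finally show ?thesis by simp
qed

lemma da_\<Gamma>:
  assumes y: "y \<in> V"
  shows "partial_deriv k a y = - (\<Gamma> k y ** a y) - a y ** transpose (\<Gamma> k y)"
proof -
  have "a y ** (h y ** \<Gamma> k y) ** a y = \<Gamma> k y ** a y" by (simp add: matrix_mul_assoc h_inv[OF y])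
  moreover have "a y ** (transpose (\<Gamma> k y) ** h y) ** a y = a y ** transpose (\<Gamma> k y)"
    by (simp add: matrix_mul_assoc[symmetric] h_inv[OF y])
  ultimately show ?thesis
    unfolding partial_a[OF y] dh_\<Gamma>[OF y] by (simp add: matrix_add_ldistrib matrix_mul_rdistrib)
qed

text \<open>Jacobi's formula. The factorisation of det (h z) as det (h y) det
  (\<open>a y ** h z\<close>) reduces it to a matrix function that is the identity at y.\<close>

lemma det_h_partial:
  assumes y: "y \<in> V"
  shows "partial_deriv k (\<lambda>z. det (h z)) y = 2 * det (h y) * trace (\<Gamma> k y)"
proof -
  have bl: "bounded_linear (\<lambda>A. a y ** A)"
    using bounded_bilinear.bounded_linear_right[OF bounded_bilinear_matrix_matrix] .
  have dF: "(\<lambda>z. a y ** h z) differentiable (at y)"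
    by (rule differentiableI, rule bounded_linear.has_derivative[OF bl])
      (rule h_diff[OF y, unfolded frechet_derivative_works])
  have dd: "det (h y) * det (a y) = 1"
    using arg_cong[OF h_inv(2)[OF y], of det] by (simp add: det_mul)
  have "det (h z) = det (h y) * det (a y ** h z)" for z
    by (simp add: det_mul mult.assoc[symmetric] dd)
  then have "(\<lambda>z. det (h z)) = (\<lambda>z. det (h y) * det (a y ** h z))" by (rule ext)
  then have "partial_deriv k (\<lambda>z. det (h z)) y = partial_deriv k (\<lambda>z. det (h y) * det (a y ** h z)) y"
    by (rule arg_cong)
  also have "\<dots> = det (h y) * partial_deriv k (\<lambda>z. det (a y ** h z)) y"
  proof (rule partial_deriv_linear[OF bounded_linear_mult_right])
    show "(\<lambda>z. det (a y ** h z)) differentiable (at y)"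
      by (rule det_differentiable, rule differentiableI,
          rule bounded_linear.has_derivative[OF bounded_linear_matrix_component],
          rule dF[unfolded frechet_derivative_works])
  qed
  also have "partial_deriv k (\<lambda>z. det (a y ** h z)) y = trace (partial_deriv k (\<lambda>z. a y ** h z) y)"
    by (rule partial_deriv_det[OF dF h_inv(1)[OF y]])
  also have "partial_deriv k (\<lambda>z. a y ** h z) y = a y ** partial_deriv k h y"
    by (rule partial_deriv_linear[OF bl h_diff[OF y]])
  also have "trace (a y ** partial_deriv k h y) = trace (\<Gamma> k y) + trace (a y ** (transpose (\<Gamma> k y) ** h y))"
    unfolding dh_\<Gamma>[OF y] matrix_add_ldistrib matrix_mul_assoc h_inv(1)[OF y] by (simp add: trace_add)
  also have "trace (a y ** (transpose (\<Gamma> k y) ** h y)) = trace (transpose (\<Gamma> k y))"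
    by (subst trace_mul_sym) (simp add: matrix_mul_assoc[symmetric] h_inv[OF y])
  also have "trace (transpose (\<Gamma> k y)) = trace (\<Gamma> k y)" by (simp add: trace_def transpose_def)
  also have "det (h y) * (trace (\<Gamma> k y) + trace (\<Gamma> k y)) = 2 * det (h y) * trace (\<Gamma> k y)" by simp
  finally show ?thesis .
qed

text \<open>The real \<open>sqrt\<close> is odd, so that only \<open>det \<noteq> 0\<close> is needed here and not the sign of the determinant.\<close>

lemma sqrt_det_partial:
  assumes y: "y \<in> V"
  shows "(\<lambda>z. sqrt (det (h z))) differentiable (at y)"
    "partial_deriv k (\<lambda>z. sqrt (det (h z))) y = sqrt (det (h y)) * trace (\<Gamma> k y)"
proof -
  define d where "d = det (h y)"
  have d: "d \<noteq> 0" using h_inv(3)[OF y] by (simp add: d_def)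
  define D where "D = (if d > 0 then inverse (sqrt d) / 2 else - inverse (sqrt d) / 2)"
  have 1: "(sqrt has_derivative (\<lambda>x. D * x)) (at (det (h y)))"
    using DERIV_real_sqrt_generic[OF d, of D] unfolding D_def d_def has_field_derivative_def by auto
  have "(\<lambda>z. det (h z)) differentiable (at y)" by (intro det_differentiable h_component_diff y)
  from has_derivative_compose[OF this[unfolded frechet_derivative_works] 1]
  have *: "((\<lambda>z. sqrt (det (h z))) has_derivative (\<lambda>v. D * frechet_derivative (\<lambda>z. det (h z)) (at y) v)) (at y)" .
  then show "(\<lambda>z. sqrt (det (h z))) differentiable (at y)" by (rule differentiableI)
  have "partial_deriv k (\<lambda>z. sqrt (det (h z))) y = D * partial_deriv k (\<lambda>z. det (h z)) y"
    using partial_deriv_eqI[OF *] by (simp add: partial_deriv_def)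
  also have "\<dots> = D * 2 * d * trace (\<Gamma> k y)" by (simp add: det_h_partial[OF y] d_def)
  also have "D * 2 * d = sqrt d"
  proof (cases "d > 0")
    case True
    then show ?thesis by (simp add: D_def field_simps)
  next
    case False
    then have "sqrt d * sqrt d = - d" using d by (simp add: real_sqrt_mult_self)
    then show ?thesis using False d by (simp add: D_def field_simps)
  qed
  finally show "partial_deriv k (\<lambda>z. sqrt (det (h z))) y = sqrt (det (h y)) * trace (\<Gamma> k y)"
    by (simp add: d_def)
qed

text \<open>The non-divergence form of the Laplacian. Differentiating the volume density gives the
  traces of the \<open>\<Gamma> i\<close>. By the symmetry of the lower indices these cancel one
  half of the derivative of \<open>a\<close>, and the other half is \<open>b\<close>.\<close>

lemma laplace_beltrami_eq:
  assumes y: "y \<in> V" and u: "Ck_on 2 u V"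
  shows "laplace_beltrami h u y = a y \<bullet> jac (pgrad u) y + b y \<bullet> pgrad u y"
proof -
  define S where "S z = sqrt (det (h z))" for z
  define x where "x = a y *v pgrad u y"
  have S: "S y \<noteq> 0" using h_inv(3)[OF y] by (simp add: S_def)
  have du: "pgrad u differentiable (at y)" by (rule C1_on_differentiable[OF C1_on_pgrad[OF V u] V y])
  have d1: "(\<lambda>z. a z *v pgrad u z) differentiable (at y)"
    by (rule C1_on_differentiable[OF C1_on_bilinear[OF bounded_bilinear_matrix_vector V a_C1 C1_on_pgrad[OF V u]] V y])
  have d2: "(\<lambda>z. (a z *v pgrad u z) $ i) differentiable (at y)" for i
    by (rule differentiableI, rule bounded_linear.has_derivative[OF bounded_linear_vec_nth])
      (rule d1[unfolded frechet_derivative_works])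
  have 1: "partial_deriv i (\<lambda>z. S z * (a z *v pgrad u z) $ i) y
     = S y * ((a y *v partial_deriv i (pgrad u) y) $ i + (partial_deriv i a y *v pgrad u y) $ i + trace (\<Gamma> i y) * x $ i)" for i
    using has_derivative_bilinear_partial[OF bounded_bilinear_mult sqrt_det_partial(1)[OF y] d2, of i i]
      sqrt_det_partial(2)[OF y]
      partial_deriv_linear[OF bounded_linear_vec_nth d1, of i i]
      has_derivative_bilinear_partial[OF bounded_bilinear_matrix_vector a_diff[OF y] du, of i]
    by (simp add: S_def x_def algebra_simps)
  have "laplace_beltrami h u y = (\<Sum>i\<in>UNIV. partial_deriv i (\<lambda>z. S z * (a z *v pgrad u z) $ i) y) / S y"
    unfolding laplace_beltrami_def riem_div_def riem_grad_def S_def a_def pgrad_def ..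
  also have "\<dots> = (\<Sum>i\<in>UNIV. (a y *v partial_deriv i (pgrad u) y) $ i) + (\<Sum>i\<in>UNIV. (partial_deriv i a y *v pgrad u y) $ i)
     + (\<Sum>i\<in>UNIV. trace (\<Gamma> i y) * x $ i)"
    using S by (simp only: 1 sum_distrib_left[symmetric] sum.distrib nonzero_mult_div_cancel_left not_False_eq_True)
  also have "(\<Sum>i\<in>UNIV. (a y *v partial_deriv i (pgrad u) y) $ i) = a y \<bullet> jac (pgrad u) y"
  proof -
    have sw: "a y $ i $ j = a y $ j $ i" for i j
      using arg_cong[OF a_sym[OF y], of "\<lambda>A. A $ j $ i"] by (simp add: transpose_def)
    have "(\<Sum>i\<in>UNIV. (a y *v partial_deriv i (pgrad u) y) $ i)
      = (\<Sum>i\<in>UNIV. \<Sum>j\<in>UNIV. a y $ i $ j * partial_deriv i (pgrad u) y $ j)"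
      by (simp add: matrix_vector_mult_def)
    also have "\<dots> = (\<Sum>j\<in>UNIV. \<Sum>i\<in>UNIV. a y $ i $ j * partial_deriv i (pgrad u) y $ j)"
      by (rule sum.swap)
    also have "\<dots> = (\<Sum>j\<in>UNIV. \<Sum>i\<in>UNIV. a y $ j $ i * jac (pgrad u) y $ j $ i)"
    proof (intro sum.cong refl)
      fix j i
      show "a y $ i $ j * partial_deriv i (pgrad u) y $ j = a y $ j $ i * jac (pgrad u) y $ j $ i"
        unfolding jac_def sw[of j i] by simp
    qed
    finally show ?thesis by (simp only: matrix_inner_alt)
  qed
  also have "(\<Sum>i\<in>UNIV. (partial_deriv i a y *v pgrad u y) $ i)
     = - (\<Sum>i\<in>UNIV. (\<Gamma> i y *v x) $ i) - (\<Sum>i\<in>UNIV. (a y *v (transpose (\<Gamma> i y) *v pgrad u y)) $ i)"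
    unfolding da_\<Gamma>[OF y] x_def
    by (simp add: matrix_vector_mult_diff_rdistrib matrix_vector_minus_left matrix_vector_mul_assoc sum_subtractf sum_negf
        del: transpose_matrix_vector)
  also have "(\<Sum>i\<in>UNIV. (\<Gamma> i y *v x) $ i) = (\<Sum>i\<in>UNIV. trace (\<Gamma> i y) * x $ i)"
  proof -
    have "(\<Sum>i\<in>UNIV. (\<Gamma> i y *v x) $ i) = (\<Sum>i\<in>UNIV. \<Sum>s\<in>UNIV. \<Gamma> i y $ i $ s * x $ s)"
      by (simp add: matrix_vector_mult_def)
    also have "\<dots> = (\<Sum>s\<in>UNIV. \<Sum>i\<in>UNIV. \<Gamma> i y $ i $ s * x $ s)"
      by (rule sum.swap)
    also have "\<dots> = (\<Sum>s\<in>UNIV. \<Sum>i\<in>UNIV. \<Gamma> s y $ i $ i * x $ s)"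
      by (intro sum.cong refl) (metis \<Gamma>_sym_entry[OF y])
    finally show ?thesis by (simp only: trace_def sum_distrib_right)
  qed
  also have "(\<Sum>i\<in>UNIV. (a y *v (transpose (\<Gamma> i y) *v pgrad u y)) $ i) = - (b y \<bullet> pgrad u y)"
  proof -
    have "(a y *v (transpose (\<Gamma> i y) *v pgrad u y)) $ i = (\<Gamma> i y *v (a y *v axis i 1)) \<bullet> pgrad u y" for i
    proof -
      have "(a y *v (transpose (\<Gamma> i y) *v pgrad u y)) $ i = axis i 1 \<bullet> (a y *v (transpose (\<Gamma> i y) *v pgrad u y))"
        by (simp add: inner_axis' del: transpose_matrix_vector)
      also have "\<dots> = (a y *v axis i 1) \<bullet> (transpose (\<Gamma> i y) *v pgrad u y)" by (rule a_swap[OF y])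
      finally show ?thesis unfolding inner_transpose_vector .
    qed
    then show ?thesis by (simp add: b_def inner_sum_left del: transpose_matrix_vector)
  qed
  finally show ?thesis by simp
qed

lemma b_C1: "C1_on b V"
proof -
  have "C1_on (\<lambda>y. - (\<Sum>i\<in>UNIV. \<Gamma> i y *v (a y *v axis i 1))) V"
    by (intro Ck_on_linear[OF V bounded_linear_minus[OF bounded_linear_ident]] C1_on_sum V
        C1_on_bilinear[OF bounded_bilinear_matrix_vector V] \<Gamma>_C1 a_C1 C1_on_const)
  then show ?thesis unfolding b_def[abs_def] .
qed

end

section \<open>The Bochner identity\<close>

lemma bounded_linear_transpose: "bounded_linear (transpose :: real^'n^'m \<Rightarrow> real^'m^'n)"
  unfolding linear_conv_bounded_linear[symmetric] by (intro linearI) (simp_all add: transpose_def vec_eq_iff)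

lemmas matrix_ring_simps =
  matrix_add_ldistrib matrix_mul_rdistrib
  bounded_bilinear.diff_left[OF bounded_bilinear_matrix_matrix]
  bounded_bilinear.diff_right[OF bounded_bilinear_matrix_matrix]
  matrix_mul_assoc matrix_transpose_mul
  linear_add[OF bounded_linear.linear[OF bounded_linear_transpose]]
  linear_diff[OF bounded_linear.linear[OF bounded_linear_transpose]]

lemma matrix_vector_sum_left: "(\<Sum>i\<in>I. A i) *v x = (\<Sum>i\<in>I. A i *v (x :: real^'n))"
  by (rule bounded_bilinear.sum_left[OF bounded_bilinear_matrix_vector])

lemma matrix_vector_sum_right: "A *v (\<Sum>i\<in>I. x i) = (\<Sum>i\<in>I. A *v (x i :: real^'n))"
  by (rule bounded_bilinear.sum_right[OF bounded_bilinear_matrix_vector])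

lemma matrix_vector_scaleR_left: "(r *\<^sub>R A) *v x = r *\<^sub>R (A *v (x :: real^'n))"
  by (rule bounded_bilinear.scaleR_left[OF bounded_bilinear_matrix_vector])

lemma vector_eq_sum: "x = (\<Sum>i\<in>UNIV. x $ i *\<^sub>R axis i (1::real))"
  by (simp add: basis_expansion scalar_mult_eq_scaleR[symmetric])

context chart_metric
begin

definition D\<Gamma> :: "'n \<Rightarrow> 'n \<Rightarrow> real^'n \<Rightarrow> real^'n^'n" where
  "D\<Gamma> j i y = partial_deriv j (\<Gamma> i) y"

text \<open>The endomorphism R(\<partial>_i, \<partial>_j), written as the curvature of the
  connection matrices.\<close>

definition Rm :: "'n \<Rightarrow> 'n \<Rightarrow> real^'n \<Rightarrow> real^'n^'n" where
  "Rm i j y = D\<Gamma> i j y - D\<Gamma> j i y + \<Gamma> i y ** \<Gamma> j y - \<Gamma> j y ** \<Gamma> i y"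

lemma riemann_Rm: assumes "y \<in> V" shows "riemann h l k i j y = Rm i j y $ l $ k"
proof -
  have c: "christoffel h l j k = (\<lambda>z. \<Gamma> j z $ l $ k)" for l j k by (simp add: \<Gamma>_def fun_eq_iff)
  have "partial_deriv i (\<lambda>z. \<Gamma> j z $ l $ k) y = D\<Gamma> i j y $ l $ k" for i j l k
    unfolding D\<Gamma>_def by (rule partial_deriv_linear[OF bounded_linear_matrix_component \<Gamma>_diff[OF assms]])
  then show ?thesis
    by (simp add: riemann_def c Rm_def matrix_matrix_mult_def sum_subtractf)
qed

lemma D\<Gamma>_sym: assumes "y \<in> V" shows "D\<Gamma> j i y *v axis m 1 = D\<Gamma> j m y *v axis i 1"
proof -
  have bl: "bounded_linear (\<lambda>A. A *v (axis m 1 :: real^'n))" for m and A :: "real^'n^'n"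
    by (rule bounded_bilinear.bounded_linear_left[OF bounded_bilinear_matrix_vector])
  have 1: "partial_deriv j (\<lambda>z. \<Gamma> i z *v axis m 1) y = D\<Gamma> j i y *v axis m 1" for i m
    unfolding D\<Gamma>_def by (rule partial_deriv_linear[OF bl \<Gamma>_diff[OF assms]])
  have "partial_deriv j (\<lambda>z. \<Gamma> i z *v axis m 1) y = partial_deriv j (\<lambda>z. \<Gamma> m z *v axis i 1) y"
    by (rule partial_deriv_cong[OF V assms]) (rule \<Gamma>_sym)
  then show ?thesis unfolding 1 .
qed

lemma ddh_sym:
  assumes y: "y \<in> V"
  shows "partial_deriv i (partial_deriv j h) y = partial_deriv j (partial_deriv i h) y"
proof -
  have e: "partial_deriv i (partial_deriv j h) y $ p $ q = partial_deriv i (partial_deriv j (\<lambda>z. h z $ p $ q)) y" for i j p q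
  proof -
    have "partial_deriv i (\<lambda>z. partial_deriv j h z $ p $ q) y = partial_deriv i (partial_deriv j h) y $ p $ q"
      by (rule partial_deriv_linear[OF bounded_linear_matrix_component C1_on_differentiable[OF dh_C1 V y]])
    moreover have "partial_deriv i (\<lambda>z. partial_deriv j h z $ p $ q) y = partial_deriv i (partial_deriv j (\<lambda>z. h z $ p $ q)) y"
      by (rule partial_deriv_cong[OF V y]) (simp add: dh_component)
    ultimately show ?thesis by simp
  qed
  have "partial_deriv i (partial_deriv j (\<lambda>z. h z $ p $ q)) y = partial_deriv j (partial_deriv i (\<lambda>z. h z $ p $ q)) y" for p q
    by (rule partial_deriv_symmetric[OF V y Ck_on_linear[OF V bounded_linear_matrix_component h_Ck]])
  then show ?thesis by (simp only: vec_eq_iff e) simp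
qed

lemma ddh_\<Gamma>:
  assumes y: "y \<in> V"
  shows "partial_deriv i (partial_deriv j h) y = h y ** D\<Gamma> i j y + partial_deriv i h y ** \<Gamma> j y
     + (transpose (\<Gamma> j y) ** partial_deriv i h y + transpose (D\<Gamma> i j y) ** h y)"
proof -
  have dt: "(\<lambda>z. transpose (\<Gamma> j z)) differentiable (at y)"
    by (rule differentiableI, rule bounded_linear.has_derivative[OF bounded_linear_transpose])
      (rule \<Gamma>_diff[OF y, unfolded frechet_derivative_works])
  have pt: "partial_deriv i (\<lambda>z. transpose (\<Gamma> j z)) y = transpose (D\<Gamma> i j y)"
    unfolding D\<Gamma>_def by (rule partial_deriv_linear[OF bounded_linear_transpose \<Gamma>_diff[OF y]])
  note dm = bounded_bilinear.FDERIV[OF bounded_bilinear_matrix_matrix]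
  have "partial_deriv i (partial_deriv j h) y = partial_deriv i (\<lambda>z. h z ** \<Gamma> j z + transpose (\<Gamma> j z) ** h z) y"
    by (rule partial_deriv_cong[OF V y]) (rule dh_\<Gamma>)
  also have "\<dots> = partial_deriv i (\<lambda>z. h z ** \<Gamma> j z) y + partial_deriv i (\<lambda>z. transpose (\<Gamma> j z) ** h z) y"
  proof (rule partial_deriv_add)
    show "(\<lambda>z. h z ** \<Gamma> j z) differentiable (at y)"
      by (rule differentiableI) (rule dm[OF h_diff[OF y, unfolded frechet_derivative_works] \<Gamma>_diff[OF y, unfolded frechet_derivative_works]])
    show "(\<lambda>z. transpose (\<Gamma> j z) ** h z) differentiable (at y)"
      by (rule differentiableI) (rule dm[OF dt[unfolded frechet_derivative_works] h_diff[OF y, unfolded frechet_derivative_works]])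
  qed
  also have "partial_deriv i (\<lambda>z. h z ** \<Gamma> j z) y = h y ** D\<Gamma> i j y + partial_deriv i h y ** \<Gamma> j y"
    unfolding D\<Gamma>_def by (rule has_derivative_bilinear_partial[OF bounded_bilinear_matrix_matrix h_diff[OF y] \<Gamma>_diff[OF y]])
  also have "partial_deriv i (\<lambda>z. transpose (\<Gamma> j z) ** h z) y = transpose (\<Gamma> j y) ** partial_deriv i h y + transpose (D\<Gamma> i j y) ** h y"
    unfolding pt[symmetric] by (rule has_derivative_bilinear_partial[OF bounded_bilinear_matrix_matrix dt h_diff[OF y]])
  finally show ?thesis .
qed

text \<open>Expressing second derivatives of h through the connection matrices, by using that the
  metric is parallel twice, leaves only the curvature in their commutator; the commutator vanishes
  since partial derivatives commute.\<close>

lemma Rm_skew: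
  assumes y: "y \<in> V"
  shows "h y ** Rm i j y + transpose (Rm i j y) ** h y = 0"
proof -
  have "h y ** Rm i j y + transpose (Rm i j y) ** h y
      = partial_deriv i (partial_deriv j h) y - partial_deriv j (partial_deriv i h) y"
    unfolding ddh_\<Gamma>[OF y] dh_\<Gamma>[OF y] Rm_def by (simp add: matrix_ring_simps)
  then show ?thesis by (simp add: ddh_sym[OF y, of i j])
qed

text \<open>The right side is the trace of X \<mapsto> R(X, w) w.\<close>

lemma ricci_Rm:
  assumes y: "y \<in> V"
  shows "w \<bullet> (ricci h y *v w) = (\<Sum>j\<in>UNIV. axis j 1 \<bullet> ((\<Sum>r\<in>UNIV. w $ r *\<^sub>R Rm j r y) *v w))"
proof -
  have "w \<bullet> (ricci h y *v w) = (\<Sum>r\<in>UNIV. \<Sum>k\<in>UNIV. \<Sum>j\<in>UNIV. w $ r * Rm j r y $ j $ k * w $ k)"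
    unfolding inner_matrix_vector ricci_def by (simp add: riemann_Rm[OF y] sum_distrib_left sum_distrib_right)
  also have "\<dots> = (\<Sum>r\<in>UNIV. \<Sum>j\<in>UNIV. \<Sum>k\<in>UNIV. w $ r * Rm j r y $ j $ k * w $ k)"
    by (rule sum.cong[OF refl], rule sum.swap)
  also have "\<dots> = (\<Sum>j\<in>UNIV. \<Sum>r\<in>UNIV. \<Sum>k\<in>UNIV. w $ r * Rm j r y $ j $ k * w $ k)"
    by (rule sum.swap)
  also have "\<dots> = (\<Sum>j\<in>UNIV. axis j 1 \<bullet> ((\<Sum>r\<in>UNIV. w $ r *\<^sub>R Rm j r y) *v w))"
    unfolding matrix_vector_sum_left matrix_vector_scaleR_left
    by (simp add: inner_axis' sum_component matrix_vector_mult_def sum_distrib_left mult.assoc)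
  finally show ?thesis .
qed

lemma a_sum_inner:
  assumes y: "y \<in> V"
  shows "(\<Sum>i\<in>UNIV. \<Sum>j\<in>UNIV. a y $ i $ j * ((T i *v axis j 1) \<bullet> s)) = (\<Sum>i\<in>UNIV. T i *v (a y *v axis i 1)) \<bullet> s"
proof -
  have sw: "a y $ i $ j = a y $ j $ i" for i j
    using arg_cong[OF a_sym[OF y], of "\<lambda>A. A $ j $ i"] by (simp add: transpose_def)
  have "a y *v axis i 1 = (\<Sum>j\<in>UNIV. a y $ i $ j *\<^sub>R axis j 1)" for i
    by (subst vector_eq_sum[of "a y *v axis i 1"])
      (intro sum.cong refl, simp add: matrix_vector_mult_basis column_def sw[of i])
  then show ?thesis
    by (simp add: matrix_vector_sum_right matrix_vector_mult_scaleR inner_sum_left)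
qed

text \<open>\<open>Hq\<close> is the Hessian at \<open>y\<close> of \<open>|W|\<^sup>2\<close> for an affine field \<open>W\<close> with \<open>W y = w\<close> and covariant
  derivative \<open>\<kappa>\<close> times the identity at \<open>y\<close>; see \<open>quadratic_field\<close>.\<close>

lemma bochner:
  fixes w :: "real^'n" and \<kappa> :: real
  assumes y: "y \<in> V"
  defines "s \<equiv> h y *v w" and "Gw \<equiv> \<Sum>q\<in>UNIV. w $ q *\<^sub>R \<Gamma> q y"
    and "bw \<equiv> \<Sum>r\<in>UNIV. w $ r *\<^sub>R partial_deriv r b y"
  defines "Hq \<equiv> \<chi> i j. 2 * ((D\<Gamma> j i y *v w - \<Gamma> i y *v (\<Gamma> j y *v w) + \<kappa> *\<^sub>R (\<Gamma> i y *v axis j 1)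
        + \<kappa> *\<^sub>R (\<Gamma> j y *v axis i 1)) \<bullet> s) + 2 * \<kappa>^2 * h y $ i $ j"
  shows "- 4 * \<kappa> * (b y \<bullet> s) - 2 * ((Gw *v b y) \<bullet> s) - 2 * (bw \<bullet> s) - a y \<bullet> Hq
    = 2 * (w \<bullet> (ricci h y *v w)) - 2 * real CARD('n) * \<kappa>^2"
proof -
  define e where "e i = (axis i 1 :: real^'n)" for i
  define dW where "dW j = (\<Sum>r\<in>UNIV. w $ r *\<^sub>R D\<Gamma> j r y)" for j
  define dG where "dG j = (\<Sum>r\<in>UNIV. w $ r *\<^sub>R D\<Gamma> r j y)" for j
  \<comment> \<open>All terms of the identity reduce to four contractions with \<open>s\<close>:
    \<open>s1\<close> and \<open>s2\<close> contain first derivatives of the connection matrices,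
    \<open>s3\<close> and \<open>s4\<close> products of two of them.\<close>
  define s1 where "s1 = (\<Sum>i\<in>UNIV. dW i *v (a y *v e i)) \<bullet> s"
  define s2 where "s2 = (\<Sum>i\<in>UNIV. dG i *v (a y *v e i)) \<bullet> s"
  define s3 where "s3 = (\<Sum>i\<in>UNIV. \<Gamma> i y *v (Gw *v (a y *v e i))) \<bullet> s"
  define s4 where "s4 = (\<Sum>i\<in>UNIV. Gw *v (\<Gamma> i y *v (a y *v e i))) \<bullet> s"
  have sums: "w = (\<Sum>r\<in>UNIV. w $ r *\<^sub>R e r)" unfolding e_def by (rule vector_eq_sum)
  have Gw_e: "Gw *v e i = \<Gamma> i y *v w" for i
  proof -
    have "\<Gamma> i y *v w = (\<Sum>r\<in>UNIV. w $ r *\<^sub>R (\<Gamma> i y *v e r))"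
      by (subst sums) (simp add: matrix_vector_sum_right matrix_vector_mult_scaleR)
    also have "\<dots> = Gw *v e i"
      unfolding Gw_def e_def matrix_vector_sum_left matrix_vector_scaleR_left \<Gamma>_sym[OF y, of i] ..
    finally show ?thesis by simp
  qed
  have dW_e: "dW j *v e i = D\<Gamma> j i y *v w" for i j
  proof -
    have "D\<Gamma> j i y *v w = (\<Sum>r\<in>UNIV. w $ r *\<^sub>R (D\<Gamma> j i y *v e r))"
      by (subst sums) (simp add: matrix_vector_sum_right matrix_vector_mult_scaleR)
    also have "\<dots> = dW j *v e i"
      unfolding dW_def e_def matrix_vector_sum_left matrix_vector_scaleR_left D\<Gamma>_sym[OF y, of j i] ..
    finally show ?thesis by simp
  qed
  have Gwb: "(Gw *v b y) \<bullet> s = - s4"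
    unfolding b_def s4_def e_def
    by (simp add: matrix_vector_sum_right bounded_bilinear.minus_right[OF bounded_bilinear_matrix_vector])
  have db: "partial_deriv r b y = - (\<Sum>i\<in>UNIV. D\<Gamma> r i y *v (a y *v e i))
     + (\<Sum>i\<in>UNIV. \<Gamma> i y *v (\<Gamma> r y *v (a y *v e i))) + (\<Sum>i\<in>UNIV. \<Gamma> i y *v (a y *v (transpose (\<Gamma> r y) *v e i)))" for r
  proof -
    have bl: "bounded_linear (\<lambda>A. A *v e i)" for i and A :: "real^'n^'n"
      by (rule bounded_bilinear.bounded_linear_left[OF bounded_bilinear_matrix_vector])
    have da: "(\<lambda>z. a z *v e i) differentiable (at y)" for i
      by (rule differentiableI, rule bounded_linear.has_derivative[OF bl])
        (rule a_diff[OF y, unfolded frechet_derivative_works])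
    have dga: "(\<lambda>z. \<Gamma> i z *v (a z *v e i)) differentiable (at y)" for i
      by (rule differentiableI) (rule bounded_bilinear.FDERIV[OF bounded_bilinear_matrix_vector
          \<Gamma>_diff[OF y, unfolded frechet_derivative_works] da[unfolded frechet_derivative_works]])
    have ds: "(\<lambda>z. \<Sum>i\<in>UNIV. \<Gamma> i z *v (a z *v e i)) differentiable (at y)"
      using dga by (intro differentiable_sum) auto
    have "partial_deriv r (\<lambda>z. \<Gamma> i z *v (a z *v e i)) y
       = \<Gamma> i y *v (partial_deriv r a y *v e i) + D\<Gamma> r i y *v (a y *v e i)" for i
      unfolding D\<Gamma>_def
      by (subst has_derivative_bilinear_partial[OF bounded_bilinear_matrix_vector \<Gamma>_diff[OF y] da])
        (simp add: partial_deriv_linear[OF bl a_diff[OF y]])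
    then have "partial_deriv r (\<lambda>z. \<Sum>i\<in>UNIV. \<Gamma> i z *v (a z *v e i)) y
       = (\<Sum>i\<in>UNIV. \<Gamma> i y *v (partial_deriv r a y *v e i) + D\<Gamma> r i y *v (a y *v e i))"
      by (subst partial_deriv_sum) (simp_all add: dga)
    moreover have "partial_deriv r b y = - partial_deriv r (\<lambda>z. \<Sum>i\<in>UNIV. \<Gamma> i z *v (a z *v e i)) y"
      unfolding b_def[abs_def] e_def[symmetric]
      by (rule partial_deriv_linear[OF bounded_linear_minus[OF bounded_linear_ident] ds])
    ultimately show ?thesis
      unfolding da_\<Gamma>[OF y]
      by (simp add: matrix_vector_mult_diff_rdistrib matrix_vector_mult_diff_distrib matrix_vector_minus_left
         bounded_bilinear.minus_right[OF bounded_bilinear_matrix_vector] matrix_vector_mul_assoc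
         sum.distrib sum_subtractf sum_negf del: transpose_matrix_vector)
  qed
  have bws: "bw \<bullet> s = - s2 + 2 * s3"
  proof -
    have g: "(\<Sum>r\<in>UNIV. w $ r *\<^sub>R (\<Sum>i\<in>UNIV. A r i *v x i)) = (\<Sum>i\<in>UNIV. (\<Sum>r\<in>UNIV. w $ r *\<^sub>R A r i) *v x i)"
      for A :: "'n \<Rightarrow> 'n \<Rightarrow> real^'n^'n" and x :: "'n \<Rightarrow> real^'n"
      unfolding matrix_vector_sum_left matrix_vector_scaleR_left scaleR_sum_right by (rule sum.swap)
    have "bw = - (\<Sum>i\<in>UNIV. dG i *v (a y *v e i))
      + (\<Sum>r\<in>UNIV. w $ r *\<^sub>R (\<Sum>i\<in>UNIV. \<Gamma> i y *v (\<Gamma> r y *v (a y *v e i))))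
      + (\<Sum>r\<in>UNIV. w $ r *\<^sub>R (\<Sum>i\<in>UNIV. \<Gamma> i y *v (a y *v (transpose (\<Gamma> r y) *v e i))))"
      unfolding bw_def db dG_def g[symmetric]
      by (simp add: scaleR_add_right scaleR_diff_right sum.distrib sum_negf sum_subtractf del: transpose_matrix_vector)
    also have "(\<Sum>r\<in>UNIV. w $ r *\<^sub>R (\<Sum>i\<in>UNIV. \<Gamma> i y *v (\<Gamma> r y *v (a y *v e i))))
        = (\<Sum>i\<in>UNIV. \<Gamma> i y *v (Gw *v (a y *v e i)))"
      unfolding Gw_def matrix_vector_sum_left matrix_vector_scaleR_left scaleR_sum_right matrix_vector_sum_right matrix_vector_mult_scaleR
      by (rule sum.swap)
    also have "(\<Sum>r\<in>UNIV. w $ r *\<^sub>R (\<Sum>i\<in>UNIV. \<Gamma> i y *v (a y *v (transpose (\<Gamma> r y) *v e i))))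
        = (\<Sum>i\<in>UNIV. \<Gamma> i y *v (a y *v (transpose Gw *v e i)))"
    proof -
      have "transpose Gw = (\<Sum>r\<in>UNIV. w $ r *\<^sub>R transpose (\<Gamma> r y))"
        unfolding Gw_def by (simp add: vec_eq_iff transpose_def)
      then show ?thesis
        unfolding matrix_vector_sum_left matrix_vector_scaleR_left scaleR_sum_right
        by (simp only: matrix_vector_sum_left matrix_vector_scaleR_left scaleR_sum_right matrix_vector_sum_right matrix_vector_mult_scaleR)
          (rule sum.swap)
    qed
    also have "\<dots> = (\<Sum>i\<in>UNIV. \<Gamma> i y *v ((a y ** transpose Gw) *v e i))"
      by (simp only: matrix_vector_mul_assoc)
    \<comment> \<open>By the symmetry of the lower indices the inner matrix may be replaced by its
      transpose. This turns the term into a second copy of \<open>s3\<close>.\<close>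
    also have "\<dots> = (\<Sum>i\<in>UNIV. \<Gamma> i y *v (transpose (a y ** transpose Gw) *v e i))"
      unfolding e_def by (rule symmetric_family_sum) (rule \<Gamma>_sym[OF y])
    also have "\<dots> = (\<Sum>i\<in>UNIV. \<Gamma> i y *v (Gw *v (a y *v e i)))"
      by (simp only: matrix_transpose_mul transpose_transpose a_sym[OF y] matrix_vector_mul_assoc)
    finally show ?thesis
      unfolding s2_def s3_def by (simp only: inner_add_left inner_minus_left mult_2 add.assoc)
  qed
  have Ric: "w \<bullet> (ricci h y *v w) = - s1 + s2 - s3 + s4"
  proof -
    define R where "R j = (\<Sum>r\<in>UNIV. w $ r *\<^sub>R Rm j r y)" for j
    have R_eq: "R j = dW j - dG j + \<Gamma> j y ** Gw - Gw ** \<Gamma> j y" for j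
      unfolding R_def Rm_def dW_def dG_def Gw_def
      by (simp add: scaleR_add_right scaleR_diff_right sum.distrib sum_subtractf
        bounded_bilinear.sum_left[OF bounded_bilinear_matrix_matrix] bounded_bilinear.sum_right[OF bounded_bilinear_matrix_matrix]
        bounded_bilinear.scaleR_left[OF bounded_bilinear_matrix_matrix] bounded_bilinear.scaleR_right[OF bounded_bilinear_matrix_matrix])
    have skew: "h y *v (R j *v x) = - (transpose (R j) *v (h y *v x))" for j x
    proof -
      have "transpose (R j) = (\<Sum>r\<in>UNIV. w $ r *\<^sub>R transpose (Rm j r y))"
        unfolding R_def by (simp add: vec_eq_iff transpose_def)
      then have "h y ** R j + transpose (R j) ** h y = (\<Sum>r\<in>UNIV. w $ r *\<^sub>R (h y ** Rm j r y + transpose (Rm j r y) ** h y))"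
        unfolding R_def
        by (simp add: bounded_bilinear.sum_left[OF bounded_bilinear_matrix_matrix] bounded_bilinear.sum_right[OF bounded_bilinear_matrix_matrix]
          bounded_bilinear.scaleR_left[OF bounded_bilinear_matrix_matrix] bounded_bilinear.scaleR_right[OF bounded_bilinear_matrix_matrix]
          scaleR_add_right sum.distrib)
      then have "h y ** R j + transpose (R j) ** h y = 0" by (simp add: Rm_skew[OF y])
      then have "(h y ** R j + transpose (R j) ** h y) *v x = 0" by simp
      then show ?thesis
        by (simp only: matrix_vector_mult_add_rdistrib matrix_vector_mul_assoc add_eq_0_iff)
          (simp add: eq_neg_iff_add_eq_0 add.commute)
    qed
    \<comment> \<open>Antisymmetry of the curvature moves \<open>R j\<close> from w to the raised
      basis vector, so that the trace acquires the same form as \<open>s1\<close> to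
      \<open>s4\<close>, with reversed sign.\<close>
    have "e j \<bullet> (R j *v w) = - ((R j *v (a y *v e j)) \<bullet> s)" for j
    proof -
      have "e j \<bullet> (R j *v w) = (h y *v (a y *v e j)) \<bullet> (R j *v w)" by (simp only: h_a[OF y])
      also have "\<dots> = (a y *v e j) \<bullet> (h y *v (R j *v w))" by (simp only: h_swap[OF y])
      also have "\<dots> = - ((R j *v (a y *v e j)) \<bullet> s)"
        unfolding skew s_def inner_minus_right inner_transpose_vector ..
      finally show ?thesis .
    qed
    then have "w \<bullet> (ricci h y *v w) = - (\<Sum>j\<in>UNIV. (R j *v (a y *v e j)) \<bullet> s)"
      unfolding ricci_Rm[OF y] R_def e_def by (simp add: sum_negf)
    also have "\<dots> = - s1 + s2 - s3 + s4"
      unfolding R_eq s1_def s2_def s3_def s4_def inner_sum_left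
      by (simp add: matrix_vector_mult_diff_rdistrib matrix_vector_mult_add_rdistrib matrix_vector_mul_assoc[symmetric]
        inner_diff_left inner_add_left sum.distrib sum_subtractf)
    finally show ?thesis .
  qed
  have aHq: "a y \<bullet> Hq = 2 * s1 - 2 * s3 - 4 * \<kappa> * (b y \<bullet> s) + 2 * real CARD('n) * \<kappa>^2"
  proof -
    have t1: "(\<Sum>i\<in>UNIV. \<Sum>j\<in>UNIV. a y $ i $ j * ((D\<Gamma> j i y *v w) \<bullet> s)) = s1"
    proof -
      have "(\<Sum>i\<in>UNIV. \<Sum>j\<in>UNIV. a y $ i $ j * ((D\<Gamma> j i y *v w) \<bullet> s))
         = (\<Sum>j\<in>UNIV. \<Sum>i\<in>UNIV. a y $ i $ j * ((dW j *v e i) \<bullet> s))"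
        unfolding dW_e by (rule sum.swap)
      also have "\<dots> = (\<Sum>j\<in>UNIV. \<Sum>i\<in>UNIV. a y $ j $ i * ((dW j *v e i) \<bullet> s))"
      proof (intro sum.cong refl)
        fix j i
        have "a y $ i $ j = a y $ j $ i"
          using arg_cong[OF a_sym[OF y], of "\<lambda>A. A $ j $ i"] by (simp add: transpose_def)
        then show "a y $ i $ j * ((dW j *v e i) \<bullet> s) = a y $ j $ i * ((dW j *v e i) \<bullet> s)" by (rule arg_cong)
      qed
      finally show ?thesis unfolding s1_def e_def a_sum_inner[OF y] .
    qed
    have t2: "(\<Sum>i\<in>UNIV. \<Sum>j\<in>UNIV. a y $ i $ j * ((\<Gamma> i y *v (\<Gamma> j y *v w)) \<bullet> s)) = s3"
      using a_sum_inner[OF y, of "\<lambda>i. \<Gamma> i y ** Gw" s]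
      unfolding s3_def Gw_e[symmetric] e_def matrix_vector_mul_assoc[symmetric] .
    have t3: "(\<Sum>i\<in>UNIV. \<Sum>j\<in>UNIV. a y $ i $ j * ((\<Gamma> i y *v axis j 1) \<bullet> s)) = - (b y \<bullet> s)"
      unfolding a_sum_inner[OF y] b_def by simp
    have t4: "(\<Sum>i\<in>UNIV. \<Sum>j\<in>UNIV. a y $ i $ j * ((\<Gamma> j y *v axis i 1) \<bullet> s)) = - (b y \<bullet> s)"
      using t3 by (simp only: \<Gamma>_sym[OF y])
    have t5: "(\<Sum>i\<in>UNIV. \<Sum>j\<in>UNIV. a y $ i $ j * h y $ i $ j) = real CARD('n)"
    proof -
      have "(\<Sum>j\<in>UNIV. a y $ i $ j * h y $ i $ j) = 1" for i
      proof -
        have "(\<Sum>j\<in>UNIV. a y $ i $ j * h y $ i $ j) = (\<Sum>j\<in>UNIV. a y $ i $ j * transpose (h y) $ j $ i)"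
          by (simp add: transpose_def)
        also have "\<dots> = (a y ** h y) $ i $ i" unfolding sym[OF y] by (simp add: matrix_matrix_mult_def)
        finally show ?thesis by (simp add: h_inv[OF y] mat_def)
      qed
      then show ?thesis by simp
    qed
    have "a y \<bullet> Hq = 2 * (\<Sum>i\<in>UNIV. \<Sum>j\<in>UNIV. a y $ i $ j * ((D\<Gamma> j i y *v w) \<bullet> s))
      - 2 * (\<Sum>i\<in>UNIV. \<Sum>j\<in>UNIV. a y $ i $ j * ((\<Gamma> i y *v (\<Gamma> j y *v w)) \<bullet> s))
      + 2 * \<kappa> * (\<Sum>i\<in>UNIV. \<Sum>j\<in>UNIV. a y $ i $ j * ((\<Gamma> i y *v axis j 1) \<bullet> s))
      + 2 * \<kappa> * (\<Sum>i\<in>UNIV. \<Sum>j\<in>UNIV. a y $ i $ j * ((\<Gamma> j y *v axis i 1) \<bullet> s))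
      + 2 * \<kappa>^2 * (\<Sum>i\<in>UNIV. \<Sum>j\<in>UNIV. a y $ i $ j * h y $ i $ j)"
      unfolding matrix_inner_alt Hq_def
      by (simp add: inner_add_left inner_diff_left sum_distrib_left distrib_left right_diff_distrib
        sum.distrib sum_subtractf mult_ac)
    then show ?thesis unfolding t1 t2 t3 t4 t5 by simp
  qed
  show ?thesis unfolding Gwb bws Ric aHq by simp
qed

text \<open>Since \<open>Gw\<close> maps e_i to \<open>\<Gamma> i y0 *v w\<close>, the choice of
  \<open>N\<close> makes the covariant derivative of W at y0 equal to \<kappa> times the identity.
  As the metric is parallel, the derivative of |W|^2 is twice the product of W with its covariant
  derivative, which is \<open>Dq\<close>; its Jacobian at y0 is the matrix in the Bochner
  identity.\<close>

lemma quadratic_field: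
  fixes w :: "real^'n" and \<kappa> :: real
  assumes y0: "y0 \<in> V"
  defines "s \<equiv> h y0 *v w" and "Gw \<equiv> \<Sum>q\<in>UNIV. w $ q *\<^sub>R \<Gamma> q y0"
  defines "N \<equiv> \<kappa> *\<^sub>R mat 1 - Gw"
  defines "W \<equiv> \<lambda>y. w + N *v (y - y0)"
  defines "q \<equiv> \<lambda>y. W y \<bullet> (h y *v W y)"
  defines "Dq \<equiv> \<lambda>y. \<chi> i. 2 * ((N *v axis i 1 + \<Gamma> i y *v W y) \<bullet> (h y *v W y))"
  shows "\<And>y. y \<in> V \<Longrightarrow> (q has_derivative (\<lambda>v. Dq y \<bullet> v)) (at y)"
    and "C1_on Dq V" and "Dq y0 = (2 * \<kappa>) *\<^sub>R s"
    and "jac Dq y0 = (\<chi> i j. 2 * ((D\<Gamma> j i y0 *v w - \<Gamma> i y0 *v (\<Gamma> j y0 *v w) + \<kappa> *\<^sub>R (\<Gamma> i y0 *v axis j 1)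
        + \<kappa> *\<^sub>R (\<Gamma> j y0 *v axis i 1)) \<bullet> s) + 2 * \<kappa>^2 * h y0 $ i $ j)"
proof -
  have Wd: "(W has_derivative (\<lambda>v. N *v v)) (at y)" for y
  proof -
    have "((\<lambda>y. N *v (y - y0)) has_derivative (\<lambda>v. N *v v)) (at y)"
      by (rule bounded_linear.has_derivative[OF matrix_vector_mul_bounded_linear]) (auto intro!: derivative_eq_intros)
    then show ?thesis unfolding W_def by (auto intro!: derivative_eq_intros)
  qed
  then have Wdiff: "W differentiable (at y)" for y by (rule differentiableI)
  have pW: "partial_deriv i W y = N *v axis i 1" for i y by (rule partial_deriv_eqI[OF Wd])
  have W_C1: "C1_on W V" using differentiable_onI_at[OF Wdiff] by (simp add: pW[abs_def])
  have hW_C1: "C1_on (\<lambda>y. h y *v W y) V"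
    by (rule C1_on_bilinear[OF bounded_bilinear_matrix_vector V h_C1 W_C1])
  have GW_C1: "C1_on (\<lambda>y. N *v axis i 1 + \<Gamma> i y *v W y) V" for i
    by (intro C1_on_add[OF V] C1_on_const C1_on_bilinear[OF bounded_bilinear_matrix_vector V \<Gamma>_C1 W_C1])
  have q_C1: "C1_on q V" unfolding q_def
    by (rule C1_on_bilinear[OF bounded_bilinear_inner V W_C1 hW_C1])
  have phW: "partial_deriv i (\<lambda>y. h y *v W y) y = h y *v (N *v axis i 1) + partial_deriv i h y *v W y" if "y \<in> V" for i y
    using has_derivative_bilinear_partial[OF bounded_bilinear_matrix_vector h_diff[OF that] Wdiff] by (simp add: pW)
  show Dq: "(q has_derivative (\<lambda>v. Dq y \<bullet> v)) (at y)" if y: "y \<in> V" for y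
  proof -
    have "partial_deriv i q y = Dq y $ i" for i
    proof -
      have "partial_deriv i q y = W y \<bullet> partial_deriv i (\<lambda>y. h y *v W y) y + partial_deriv i W y \<bullet> (h y *v W y)"
        unfolding q_def
        by (rule has_derivative_bilinear_partial[OF bounded_bilinear_inner Wdiff C1_on_differentiable[OF hW_C1 V y]])
      then have "partial_deriv i q y = W y \<bullet> (h y *v (N *v axis i 1) + partial_deriv i h y *v W y) + (N *v axis i 1) \<bullet> (h y *v W y)"
        by (simp only: phW[OF y] pW)
      moreover have "W y \<bullet> (h y *v (N *v axis i 1)) = (N *v axis i 1) \<bullet> (h y *v W y)"
        by (rule trans[OF h_swap[OF y] inner_commute])
      moreover have "W y \<bullet> (partial_deriv i h y *v W y) = 2 * ((\<Gamma> i y *v W y) \<bullet> (h y *v W y))"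
      proof -
        have "W y \<bullet> ((h y ** \<Gamma> i y) *v W y) = (\<Gamma> i y *v W y) \<bullet> (h y *v W y)"
          unfolding matrix_vector_mul_assoc[symmetric] by (rule trans[OF h_swap[OF y] inner_commute])
        moreover have "W y \<bullet> ((transpose (\<Gamma> i y) ** h y) *v W y) = (\<Gamma> i y *v W y) \<bullet> (h y *v W y)"
          unfolding matrix_vector_mul_assoc[symmetric] inner_transpose_vector ..
        ultimately show ?thesis
          unfolding dh_\<Gamma>[OF y] matrix_vector_mult_add_rdistrib inner_add_right by simp
      qed
      ultimately show ?thesis unfolding Dq_def by (simp add: inner_add_right inner_add_left)
    qed
    then have "pgrad q y = Dq y" by (simp add: pgrad_def vec_eq_iff)
    then show ?thesis using has_derivative_pgrad[OF C1_on_differentiable[OF q_C1 V y]] by simp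
  qed
  have comp_C1: "C1_on (\<lambda>y. Dq y $ i) V" for i
  proof -
    have "C1_on (\<lambda>y. 2 * ((N *v axis i 1 + \<Gamma> i y *v W y) \<bullet> (h y *v W y))) V"
      by (intro Ck_on_linear[OF V bounded_linear_mult_right] C1_on_bilinear[OF bounded_bilinear_inner V GW_C1 hW_C1])
    then show ?thesis by (simp add: Dq_def del: Ck_on.simps)
  qed
  show Dq_C1: "C1_on Dq V" by (rule C1_on_vec[OF V comp_C1])
  have Gw_e: "Gw *v axis i 1 = \<Gamma> i y0 *v w" for i
  proof -
    have "\<Gamma> i y0 *v w = (\<Sum>r\<in>UNIV. w $ r *\<^sub>R (\<Gamma> i y0 *v axis r 1))"
      by (subst vector_eq_sum[of w]) (simp only: matrix_vector_sum_right matrix_vector_mult_scaleR)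
    also have "\<dots> = Gw *v axis i 1"
      unfolding Gw_def matrix_vector_sum_left matrix_vector_scaleR_left \<Gamma>_sym[OF y0, of i] ..
    finally show ?thesis by simp
  qed
  have Ne: "N *v axis i 1 = \<kappa> *\<^sub>R axis i 1 - \<Gamma> i y0 *v w" for i
    unfolding N_def matrix_vector_mult_diff_rdistrib matrix_vector_scaleR_left Gw_e by simp
  have W0: "W y0 = w" by (simp add: W_def)
  have cov: "N *v axis i 1 + \<Gamma> i y0 *v W y0 = \<kappa> *\<^sub>R axis i 1" for i by (simp add: Ne W0)
  show "Dq y0 = (2 * \<kappa>) *\<^sub>R s"
    unfolding Dq_def cov by (simp add: vec_eq_iff W0 s_def inner_axis')
  have "jac Dq y0 $ i $ j = 2 * ((D\<Gamma> j i y0 *v w - \<Gamma> i y0 *v (\<Gamma> j y0 *v w) + \<kappa> *\<^sub>R (\<Gamma> i y0 *v axis j 1)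
        + \<kappa> *\<^sub>R (\<Gamma> j y0 *v axis i 1)) \<bullet> s) + 2 * \<kappa>^2 * h y0 $ i $ j" for i j
  proof -
    note d1 = C1_on_differentiable[OF GW_C1 V y0] and d2 = C1_on_differentiable[OF hW_C1 V y0]
    have p1: "partial_deriv j (\<lambda>y. N *v axis i 1 + \<Gamma> i y *v W y) y0 = \<Gamma> i y0 *v (N *v axis j 1) + D\<Gamma> j i y0 *v w"
    proof -
      have "(\<lambda>y. \<Gamma> i y *v W y) differentiable (at y0)"
        by (rule C1_on_differentiable[OF C1_on_bilinear[OF bounded_bilinear_matrix_vector V \<Gamma>_C1 W_C1] V y0])
      then have "partial_deriv j (\<lambda>y. N *v axis i 1 + \<Gamma> i y *v W y) y0 = partial_deriv j (\<lambda>y. \<Gamma> i y *v W y) y0"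
        by (subst partial_deriv_add) simp_all
      also have "\<dots> = \<Gamma> i y0 *v (N *v axis j 1) + D\<Gamma> j i y0 *v w"
        unfolding has_derivative_bilinear_partial[OF bounded_bilinear_matrix_vector \<Gamma>_diff[OF y0] Wdiff] pW W0 D\<Gamma>_def ..
      finally show ?thesis .
    qed
    have "jac Dq y0 $ i $ j = partial_deriv j Dq y0 $ i" by (simp add: jac_def)
    also have "\<dots> = partial_deriv j (\<lambda>y. Dq y $ i) y0"
      by (rule partial_deriv_linear[OF bounded_linear_vec_nth C1_on_differentiable[OF Dq_C1 V y0], symmetric])
    also have "\<dots> = partial_deriv j (\<lambda>y. 2 * ((N *v axis i 1 + \<Gamma> i y *v W y) \<bullet> (h y *v W y))) y0"
      by (simp add: Dq_def)
    also have "\<dots> = 2 * partial_deriv j (\<lambda>y. (N *v axis i 1 + \<Gamma> i y *v W y) \<bullet> (h y *v W y)) y0"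
      by (rule partial_deriv_linear[OF bounded_linear_mult_right])
        (rule C1_on_differentiable[OF C1_on_bilinear[OF bounded_bilinear_inner V GW_C1 hW_C1] V y0])
    also have "partial_deriv j (\<lambda>y. (N *v axis i 1 + \<Gamma> i y *v W y) \<bullet> (h y *v W y)) y0
      = (\<kappa> *\<^sub>R axis i 1) \<bullet> (h y0 *v (N *v axis j 1) + partial_deriv j h y0 *v w)
      + (\<Gamma> i y0 *v (N *v axis j 1) + D\<Gamma> j i y0 *v w) \<bullet> s"
      unfolding has_derivative_bilinear_partial[OF bounded_bilinear_inner d1 d2] p1 phW[OF y0] W0 cov[unfolded W0] s_def ..
    also have "h y0 *v (N *v axis j 1) + partial_deriv j h y0 *v w = \<kappa> *\<^sub>R (h y0 *v axis j 1) + transpose (\<Gamma> j y0) *v s"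
      unfolding dh_\<Gamma>[OF y0] Ne s_def
      by (simp add: matrix_vector_mult_add_rdistrib matrix_vector_mult_diff_distrib matrix_vector_mult_scaleR matrix_vector_mul_assoc del: transpose_matrix_vector)
    also have "(\<kappa> *\<^sub>R axis i 1) \<bullet> (\<kappa> *\<^sub>R (h y0 *v axis j 1) + transpose (\<Gamma> j y0) *v s)
       = \<kappa>^2 * h y0 $ i $ j + \<kappa> * ((\<Gamma> j y0 *v axis i 1) \<bullet> s)"
    proof -
      have "axis i 1 \<bullet> (h y0 *v axis j 1) = h y0 $ i $ j"
        by (simp add: inner_axis' matrix_vector_mult_basis column_def)
      then show ?thesis
        by (simp only: inner_add_right inner_scaleR_left inner_scaleR_right inner_transpose_vector)
          (simp add: power2_eq_square algebra_simps)
    qed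
    finally show ?thesis
      unfolding Ne by (simp add: matrix_vector_mult_diff_distrib matrix_vector_mult_scaleR inner_add_left inner_diff_left algebra_simps)
  qed
  then show "jac Dq y0 = (\<chi> i j. 2 * ((D\<Gamma> j i y0 *v w - \<Gamma> i y0 *v (\<Gamma> j y0 *v w) + \<kappa> *\<^sub>R (\<Gamma> i y0 *v axis j 1)
        + \<kappa> *\<^sub>R (\<Gamma> j y0 *v axis i 1)) \<bullet> s) + 2 * \<kappa>^2 * h y0 $ i $ j)"
    by (simp add: vec_eq_iff)
qed

end

section \<open>The minimum principle in a chart\<close>

lemma matrix_inner_trace: "A \<bullet> B = trace (transpose A ** B)" for A B :: "real^'n^'m"
  unfolding matrix_inner_alt trace_def matrix_matrix_mult_def transpose_def
  by (simp, rule sum.swap)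

lemma matrix_inner_mult_left: "A \<bullet> (transpose B ** C) = (B ** A) \<bullet> C" for A :: "real^'k^'n" and B :: "real^'n^'m"
  by (simp add: matrix_inner_trace matrix_transpose_mul matrix_mul_assoc)

lemma matrix_inner_mult_right: "A \<bullet> (C ** B) = (A ** transpose B) \<bullet> C" for A :: "real^'k^'n" and B :: "real^'k^'m"
proof -
  have "trace (transpose A ** (C ** B)) = trace (B ** (transpose A ** C))"
    by (simp add: trace_mul_sym[of _ B] matrix_mul_assoc)
  then show ?thesis by (simp add: matrix_inner_trace matrix_transpose_mul matrix_mul_assoc)
qed

definition outer :: "real^'n::finite \<Rightarrow> real^'n \<Rightarrow> real^'n^'n" where
  "outer p q = (\<chi> i j. p $ i * q $ j)"

lemma inner_outer: "A \<bullet> outer p q = p \<bullet> (A *v q)"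
  unfolding matrix_inner_alt inner_matrix_vector outer_def by (simp add: mult_ac)

lemma outer_vector: "outer p q *v v = (q \<bullet> v) *\<^sub>R p"
  by (simp add: outer_def vec_eq_iff matrix_vector_mult_def inner_vec_def sum_distrib_left sum_distrib_right mult_ac)

lemma jac_pgrad:
  assumes "open V" "y \<in> V" "Ck_on 2 u V"
  shows "jac (pgrad u) y $ i $ j = partial_deriv j (partial_deriv i u) y"
  using partial_deriv_linear[OF bounded_linear_vec_nth C1_on_differentiable[OF C1_on_pgrad[OF assms(1,3)] assms(1,2)], of j i]
  by (simp add: jac_def pgrad_def)

context chart_metric
begin

text \<open>\<open>P\<close>, \<open>u\<close> and \<open>L\<close> are |grad l|^2, f and the
  Laplacian of l at the minimum point. The square of \<open>L\<close> results from the optimal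
  \<kappa> in the Bochner identity, after the Ricci term has been discarded as nonnegative. The
  other terms come from the reaction term of the equation and from (\<beta> + c) f in H. Only times
  up to t0 enter the minimum, so that t0 may be the end of a time interval.\<close>

lemma local_minimum_inequality:
  fixes v :: "real \<Rightarrow> real^'n \<Rightarrow> real" and vt :: "real^'n \<Rightarrow> real \<Rightarrow> real" and c \<alpha> \<beta> :: real
    and \<phi> \<phi>' :: "real \<Rightarrow> real"
  assumes v_pos: "\<And>y t. y \<in> V \<Longrightarrow> t > 0 \<Longrightarrow> 0 < v t y"
    and v_C2: "\<And>t. t > 0 \<Longrightarrow> Ck_on 2 (v t) V"
    and vt: "\<And>y t. y \<in> V \<Longrightarrow> t > 0 \<Longrightarrow> ((\<lambda>s. v s y) has_real_derivative vt y t) (at t)"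
    and v_eq: "\<And>y t. y \<in> V \<Longrightarrow> t > 0 \<Longrightarrow> vt y t = laplace_beltrami h (v t) y + c * v t y * (1 - v t y)"
    and cv: "continuous_on (V \<times> {0<..}) (\<lambda>(y, t). v t y)"
    and cv1: "\<And>i. continuous_on (V \<times> {0<..}) (\<lambda>(y, t). partial_deriv i (v t) y)"
    and cv2: "\<And>i j. continuous_on (V \<times> {0<..}) (\<lambda>(y, t). partial_deriv i (partial_deriv j (v t)) y)"
    and cvt: "continuous_on (V \<times> {0<..}) (\<lambda>(y, t). vt y t)"
    and ric: "\<And>y w. y \<in> V \<Longrightarrow> w \<bullet> (ricci h y *v w) \<ge> 0"
    and \<phi>: "\<And>t. t > 0 \<Longrightarrow> (\<phi> has_real_derivative \<phi>' t) (at t)" and c\<phi>': "continuous_on {0<..} \<phi>'"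
    and \<alpha>: "\<alpha> < 1"
    and r: "r > 0" "cball y0 (2 * r) \<subseteq> V" and \<eta>: "0 < \<eta>" "\<eta> < t0"
  defines "G \<equiv> \<lambda>y t. pgrad (v t) y \<bullet> (a y *v pgrad (v t) y) / (v t y)^2"
  defines "H \<equiv> \<lambda>y t. vt y t / v t y - (1 - \<alpha>) * G y t + (- c + (\<beta> + c) * v t y) + \<phi> t"
  assumes min: "\<And>y t. y \<in> cball y0 r \<Longrightarrow> t \<in> {t0 - \<eta>..t0} \<Longrightarrow> H y0 t0 \<le> H y t"
  defines "P \<equiv> G y0 t0" and "u \<equiv> v t0 y0"
  defines "L \<equiv> vt y0 t0 / u - P - c * (1 - u)"
  shows "(2 * (1 - \<alpha>) / real CARD('n)) * L^2 - c * u * L - P * u * (2 * \<beta> + c + 2 * \<alpha> * c)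
    + \<beta> * c * u * (1 - u) + \<phi>' t0 \<le> 0" and "P \<ge> 0"
proof -
  have y0: "y0 \<in> V" using r by (intro subsetD[OF r(2)]) auto
  have t0: "t0 > 0" using \<eta> by simp
  define m where "m = 2 * (1 - \<alpha>)"
  have m: "m > 0" using \<alpha> by (simp add: m_def)
  define n where "n = real CARD('n)"
  have n: "n > 0" by (simp add: n_def)
  define l where "l y t = ln (v t y)" for y t
  define Dl where "Dl y t = (1 / v t y) *\<^sub>R pgrad (v t) y" for y t
  define J where "J y t = jac (pgrad (v t)) y" for y t
  define DDl where "DDl y t = (1 / v t y) *\<^sub>R J y t - outer (Dl y t) (Dl y t)" for y t
  define lt where "lt y t = vt y t / v t y" for y t
  have v_diff: "v t differentiable (at y)" if "y \<in> V" "t > 0" for y t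
    using v_C2[OF that(2)] by (intro differentiable_on_open_at[OF V that(1)]) (simp add: numeral_2_eq_2)
  have Dv: "(v t has_derivative (\<lambda>x. pgrad (v t) y \<bullet> x)) (at y)" if "y \<in> V" "t > 0" for y t
    by (rule has_derivative_pgrad[OF v_diff[OF that]])
  have DDv: "(pgrad (v t) has_derivative (\<lambda>x. J y t *v x)) (at y)" if "y \<in> V" "t > 0" for y t
    unfolding J_def
    by (rule has_derivative_jac[OF C1_on_differentiable[OF C1_on_pgrad[OF V v_C2[OF that(2)]] V that(1)]])
  have exp_l: "exp (l y t) = v t y" if "y \<in> V" "t > 0" for y t
    using v_pos[OF that] by (simp add: l_def)
  have Dl': "((\<lambda>y. l y t) has_derivative (\<lambda>x. Dl y t \<bullet> x)) (at y)" if "y \<in> V" "t > 0" for y t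
    unfolding l_def Dl_def using v_pos[OF that]
    by (auto intro!: derivative_eq_intros Dv[OF that] simp: divide_inverse)
  have DDl': "((\<lambda>y. Dl y t) has_derivative (\<lambda>x. DDl y t *v x)) (at y)" if "y \<in> V" "t > 0" for y t
  proof -
    note vp = v_pos[OF that]
    have "((\<lambda>y. inverse (v t y)) has_derivative (\<lambda>x. - (inverse (v t y) * (pgrad (v t) y \<bullet> x) * inverse (v t y)))) (at y)"
      by (rule Deriv.has_derivative_inverse[OF _ Dv[OF that]]) (use vp in auto)
    from has_derivative_scaleR[OF this DDv[OF that]]
    have "((\<lambda>y. Dl y t) has_derivative (\<lambda>x. inverse (v t y) *\<^sub>R (J y t *v x)
       + (- (inverse (v t y) * (pgrad (v t) y \<bullet> x) * inverse (v t y))) *\<^sub>R pgrad (v t) y)) (at y)"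
      unfolding Dl_def by (simp add: inverse_eq_divide)
    moreover have "(\<lambda>x. inverse (v t y) *\<^sub>R (J y t *v x)
       + (- (inverse (v t y) * (pgrad (v t) y \<bullet> x) * inverse (v t y))) *\<^sub>R pgrad (v t) y) = (\<lambda>x. DDl y t *v x)"
      unfolding DDl_def Dl_def
      by (simp add: fun_eq_iff matrix_vector_mult_diff_rdistrib matrix_vector_scaleR_left outer_vector inverse_eq_divide)
    ultimately show ?thesis by simp
  qed
  have lt': "(l y has_real_derivative lt y t) (at t)" if "y \<in> V" "t > 0" for y t
    unfolding l_def lt_def using v_pos[OF that]
    by (auto intro!: derivative_eq_intros vt[OF that] simp: divide_inverse)
  have vnz: "\<And>z. z \<in> V \<times> {0<..} \<Longrightarrow> v (snd z) (fst z) \<noteq> 0" using v_pos by (auto simp: less_imp_neq[symmetric])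
  have cinv: "continuous_on (V \<times> {0<..}) (\<lambda>z. 1 / v (snd z) (fst z))"
    using cv vnz by (intro continuous_intros) (auto simp: case_prod_beta')
  have cDl: "continuous_on (V \<times> {0<..}) (\<lambda>(y, t). Dl y t)"
    unfolding Dl_def case_prod_beta' using cv1
    by (intro continuous_on_scaleR cinv) (auto simp: pgrad_def case_prod_beta' intro!: continuous_on_vec_lambda)
  have cJ: "continuous_on (V \<times> {0<..}) (\<lambda>z. J (fst z) (snd z))"
  proof -
    have "continuous_on (V \<times> {0<..}) (\<lambda>z. \<chi> i j. partial_deriv j (partial_deriv i (v (snd z))) (fst z))"
      using cv2 by (auto simp: case_prod_beta' intro!: continuous_on_vec_lambda)
    moreover have "J (fst z) (snd z) = (\<chi> i j. partial_deriv j (partial_deriv i (v (snd z))) (fst z))" if "z \<in> V \<times> {0<..}" for z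
      using that v_C2 V by (auto simp: J_def vec_eq_iff jac_pgrad)
    ultimately show ?thesis by (simp cong: continuous_on_cong)
  qed
  have couter: "continuous_on (V \<times> {0<..}) (\<lambda>z. outer (Dl (fst z) (snd z)) (Dl (fst z) (snd z)))"
    unfolding outer_def using cDl
    by (auto simp: case_prod_beta' intro!: continuous_on_vec_lambda continuous_on_mult continuous_on_component)
  have cDDl: "continuous_on (V \<times> {0<..}) (\<lambda>(y, t). DDl y t)"
    unfolding DDl_def case_prod_beta' by (intro continuous_on_diff continuous_on_scaleR cinv cJ couter)
  have clt: "continuous_on (V \<times> {0<..}) (\<lambda>(y, t). lt y t)"
    using cvt cv vnz unfolding lt_def case_prod_beta' by (intro continuous_on_divide) auto
  define p where "p = Dl y0 t0"
  define M where "M = DDl y0 t0"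
  \<comment> \<open>The equality case of the linearisation: W = 2 (1 - \<alpha>) grad l, with the
    index of the differential raised by \<open>a\<close>.\<close>
  define w where "w = m *\<^sub>R (a y0 *v p)"
  define \<kappa> where "\<kappa> = m * L / n"
  define Gw where "Gw = (\<Sum>q\<in>UNIV. w $ q *\<^sub>R \<Gamma> q y0)"
  define N where "N = \<kappa> *\<^sub>R mat 1 - Gw"
  define W where "W y = w + N *v (y - y0)" for y
  define q where "q y = W y \<bullet> (h y *v W y)" for y
  define Dq where "Dq y = (\<chi> i. 2 * ((N *v axis i 1 + \<Gamma> i y *v W y) \<bullet> (h y *v W y)))" for y
  define s where "s = h y0 *v w"
  have s: "s = m *\<^sub>R p" unfolding s_def w_def by (simp add: matrix_vector_mult_scaleR h_a[OF y0])
  note qf = quadratic_field[OF y0, where w = w and \<kappa> = \<kappa>, folded Gw_def s_def, folded N_def, folded W_def, folded q_def Dq_def]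
  define Hq where "Hq = (\<chi> i j. 2 * ((D\<Gamma> j i y0 *v w - \<Gamma> i y0 *v (\<Gamma> j y0 *v w) + \<kappa> *\<^sub>R (\<Gamma> i y0 *v axis j 1)
        + \<kappa> *\<^sub>R (\<Gamma> j y0 *v axis i 1)) \<bullet> s) + 2 * \<kappa>^2 * h y0 $ i $ j)"
  define bw where "bw = (\<Sum>r\<in>UNIV. w $ r *\<^sub>R partial_deriv r b y0)"
  \<comment> \<open>Everything in the linearised H except lt - W . Dl. Here \<open>q\<close> is
    |W|^2, and its denominator is 2 m = 4 (1 - \<alpha>).\<close>
  define E where "E y t = q y / (2 * m) + (- c + (\<beta> + c) * exp (l y t)) + \<phi> t" for y t
  define DE where "DE y t = (1 / (2 * m)) *\<^sub>R Dq y + ((\<beta> + c) * v t y) *\<^sub>R Dl y t" for y t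
  define DDE where "DDE y t = (1 / (2 * m)) *\<^sub>R jac Dq y + ((\<beta> + c) * v t y) *\<^sub>R (DDl y t + outer (Dl y t) (Dl y t))" for y t
  define Et where "Et y t = (\<beta> + c) * v t y * lt y t + \<phi>' t" for y t
  have E1: "((\<lambda>y. E y t) has_derivative (\<lambda>x. DE y t \<bullet> x)) (at y)" if "y \<in> V" "t > 0" for y t
  proof -
    have "((\<lambda>y. E y t) has_derivative (\<lambda>x. (Dq y \<bullet> x) / (2 * m) + (\<beta> + c) * (exp (l y t) * (Dl y t \<bullet> x)))) (at y)"
      unfolding E_def using m
      by (auto intro!: derivative_eq_intros qf(1)[OF that(1)] Dl'[OF that])
    then show ?thesis unfolding DE_def exp_l[OF that] by (simp add: inner_add_left mult.assoc)
  qed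
  have E2: "((\<lambda>y. DE y t) has_derivative (\<lambda>x. DDE y t *v x)) (at y)" if "y \<in> V" "t > 0" for y t
  proof -
    have 1: "(Dq has_derivative (\<lambda>x. jac Dq y *v x)) (at y)"
      by (rule has_derivative_jac[OF C1_on_differentiable[OF qf(2) V that(1)]])
    have v': "(v t has_derivative (\<lambda>x. v t y * (Dl y t \<bullet> x))) (at y)"
      using Dv[OF that] v_pos[OF that] by (simp add: Dl_def)
    have "((\<lambda>y. DE y t) has_derivative (\<lambda>x. (1 / (2 * m)) *\<^sub>R (jac Dq y *v x) +
       (((\<beta> + c) * v t y) *\<^sub>R (DDl y t *v x) + ((\<beta> + c) * (v t y * (Dl y t \<bullet> x))) *\<^sub>R Dl y t))) (at y)"
      unfolding DE_def by (intro has_derivative_add has_derivative_scaleR_right has_derivative_scaleR has_derivative_mult_right 1 v' DDl'[OF that])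
    then show ?thesis unfolding DDE_def
      by (simp add: matrix_vector_mult_add_rdistrib matrix_vector_scaleR_left outer_vector scaleR_add_right mult.assoc)
  qed
  have E3: "(E y has_real_derivative Et y t) (at t)" if "y \<in> V" "t > 0" for y t
    unfolding E_def Et_def
    by (auto intro!: derivative_eq_intros lt'[OF that] \<phi>[OF that(2)] simp: exp_l[OF that])
  have cD: "continuous_on (V \<times> {0<..}) (\<lambda>z. F (fst z))" if "continuous_on V F" for F :: "real^'n \<Rightarrow> 'b::topological_space"
    by (rule continuous_on_compose2[OF that]) (auto intro!: continuous_intros)
  have cDE: "continuous_on (V \<times> {0<..}) (\<lambda>(y, t). DE y t)"
    unfolding DE_def case_prod_beta' using cv cDl
    by (intro continuous_on_add continuous_on_scaleR continuous_on_mult continuous_on_const cD[OF C1_on_continuous[OF qf(2)]])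
      (auto simp: case_prod_beta')
  have cjac: "continuous_on V (jac Dq)"
    unfolding jac_def[abs_def] using qf(2)
    by (intro continuous_on_vec_lambda continuous_on_component) auto
  have cDDE: "continuous_on (V \<times> {0<..}) (\<lambda>(y, t). DDE y t)"
    unfolding DDE_def case_prod_beta' using cv cDDl couter
    by (intro continuous_on_add continuous_on_scaleR continuous_on_mult continuous_on_const cD[OF cjac])
      (auto simp: case_prod_beta')
  have c\<phi>2: "continuous_on (V \<times> {0<..}) (\<lambda>z. \<phi>' (snd z))"
    by (rule continuous_on_compose2[OF c\<phi>']) (auto intro!: continuous_intros)
  have cEt: "continuous_on (V \<times> {0<..}) (\<lambda>(y, t). Et y t)"
    unfolding Et_def case_prod_beta' using cv clt
    by (intro continuous_on_add continuous_on_mult continuous_on_const c\<phi>2) (auto simp: case_prod_beta')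
  have eq: "lt y t = a y \<bullet> DDl y t + b y \<bullet> Dl y t + Dl y t \<bullet> (a y *v Dl y t) + c * (1 - exp (l y t))"
    if "y \<in> V" "t > 0" for y t
  proof -
    have "vt y t = a y \<bullet> J y t + b y \<bullet> pgrad (v t) y + c * v t y * (1 - v t y)"
      unfolding v_eq[OF that] laplace_beltrami_eq[OF that(1) v_C2[OF that(2)]] J_def ..
    then show ?thesis
      unfolding lt_def exp_l[OF that] DDl_def inner_diff_right inner_outer using v_pos[OF that]
      by (simp add: Dl_def add_divide_distrib)
  qed
  have G_eq: "G y t = Dl y t \<bullet> (a y *v Dl y t)" if "y \<in> V" "t > 0" for y t
    using v_pos[OF that] unfolding G_def Dl_def by (simp add: matrix_vector_mult_scaleR power2_eq_square)
  \<comment> \<open>Completing the square: the vector z - m grad l has nonnegative squared length.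
    In \<open>min'\<close> this shows that the linearised quantity lies above H, with equality at
    (y0, t0).\<close>
  have quad: "- ((1 - \<alpha>) * (x \<bullet> (a y *v x))) \<le> - (z \<bullet> x) + z \<bullet> (h y *v z) / (2 * m)" if y: "y \<in> V" for y x z
  proof -
    define d where "d = z - m *\<^sub>R (a y *v x)"
    have "0 \<le> d \<bullet> (h y *v d)" using pos[OF y, of d] by (cases "d = 0") auto
    also have "\<dots> = z \<bullet> (h y *v z) - 2 * m * (z \<bullet> x) + m * m * (x \<bullet> (a y *v x))"
    proof -
      have "(a y *v x) \<bullet> (h y *v z) = z \<bullet> x" by (metis h_swap[OF y] h_a[OF y] inner_commute)
      then show ?thesis unfolding d_def
        by (simp add: inner_diff_left inner_diff_right matrix_vector_mult_diff_distrib matrix_vector_mult_scaleR h_a[OF y]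
           inner_commute[of "a y *v x" x] algebra_simps)
    qed
    finally have "(2 * m * (z \<bullet> x) - m * m * (x \<bullet> (a y *v x))) / (2 * m) \<le> z \<bullet> (h y *v z) / (2 * m)"
      using m by (intro divide_right_mono) auto
    also have "(2 * m * (z \<bullet> x) - m * m * (x \<bullet> (a y *v x))) / (2 * m) = z \<bullet> x - (1 - \<alpha>) * (x \<bullet> (a y *v x))"
      using m by (simp add: field_simps m_def)
    finally show ?thesis by (simp add: algebra_simps)
  qed
  have wp: "w \<bullet> p = m * P"
    unfolding w_def P_def G_eq[OF y0 t0] p_def by (simp add: inner_commute)
  have min': "lt y0 t0 - w \<bullet> Dl y0 t0 + E y0 t0 \<le> lt y t - (w + N *v (y - y0)) \<bullet> Dl y t + E y t"
    if y: "y \<in> cball y0 r" and t: "t \<in> {t0 - \<eta>..t0}" for y t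
  proof -
    have yV: "y \<in> V" and tp: "t > 0" using y t r \<eta> subset_cball[of r "2 * r" y0] by auto
    have "W y0 = w" by (simp add: W_def)
    then have "q y0 = w \<bullet> s" by (simp add: q_def s_def)
    have "q y0 / (2 * m) = (w \<bullet> p) / 2" using \<open>q y0 = w \<bullet> s\<close> m by (simp add: s)
    also have "(w \<bullet> p) / 2 = (1 - \<alpha>) * P" unfolding wp by (simp add: m_def)
    finally have qv: "q y0 / (2 * m) = (1 - \<alpha>) * P" .
    have "w \<bullet> Dl y0 t0 = 2 * ((1 - \<alpha>) * P)" using wp by (simp add: m_def p_def)
    then have "lt y0 t0 - w \<bullet> Dl y0 t0 + E y0 t0 = H y0 t0"
      unfolding E_def H_def exp_l[OF y0 t0] lt_def qv P_def[symmetric] by simp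
    also have "\<dots> \<le> H y t" by (rule min[OF y t])
    also have "\<dots> \<le> lt y t - W y \<bullet> Dl y t + E y t"
      unfolding H_def E_def q_def lt_def exp_l[OF yV tp] G_eq[OF yV tp] using quad[OF yV, of "Dl y t" "W y"] by simp
    finally show ?thesis by (simp add: W_def)
  qed
  define X where "X = transpose N *v Dl y0 t0 - DE y0 t0"
  define a' where "a' = (\<lambda>x. \<Sum>i\<in>UNIV. x $ i *\<^sub>R partial_deriv i a y0)"
  define b' where "b' = (\<lambda>x. \<Sum>i\<in>UNIV. x $ i *\<^sub>R partial_deriv i b y0)"
  have a'w: "a' w = - (Gw ** a y0) - a y0 ** transpose Gw"
  proof -
    have tG: "transpose Gw = (\<Sum>r\<in>UNIV. w $ r *\<^sub>R transpose (\<Gamma> r y0))"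
      unfolding Gw_def by (simp add: vec_eq_iff transpose_def)
    show ?thesis unfolding a'_def da_\<Gamma>[OF y0] tG unfolding Gw_def
      by (simp add: bounded_bilinear.sum_left[OF bounded_bilinear_matrix_matrix] bounded_bilinear.sum_right[OF bounded_bilinear_matrix_matrix]
          bounded_bilinear.scaleR_left[OF bounded_bilinear_matrix_matrix] bounded_bilinear.scaleR_right[OF bounded_bilinear_matrix_matrix]
          scaleR_diff_right sum_subtractf sum_negf)
  qed
  have Q: "a y0 \<bullet> (transpose N ** M + M ** N) - a' w \<bullet> M + (b y0 \<bullet> X - b' w \<bullet> p)
    + (2 * (X \<bullet> (a y0 *v p)) - p \<bullet> (a' w *v p)) - c * exp (l y0 t0) * (lt y0 t0 - w \<bullet> p)
    + Et y0 t0 - a y0 \<bullet> DDE y0 t0 \<le> 0"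
    unfolding M_def p_def
    by (rule minimum_inequality[OF V Dl' DDl' lt' cDl cDDl clt E1 E2 E3 cDE cDDE cEt C1_on_continuous[OF a_C1]
        C1_on_continuous[OF b_C1] a_sym a_pos _ _ eq r \<eta> min' X_def])
      (auto simp: a'_def b'_def intro!: C1_on_strict_matrix[OF V y0 a_C1] C1_on_strict_vec[OF V y0 b_C1])
  define aM where "aM = a y0 \<bullet> M"
  define bp where "bp = b y0 \<bullet> p"
  define Ric where "Ric = w \<bullet> (ricci h y0 *v w)"
  define Gb where "Gb = (Gw *v b y0) \<bullet> p"
  define pG where "pG = (Gw *v (a y0 *v p)) \<bullet> p"
  have Peq: "P = p \<bullet> (a y0 *v p)" unfolding P_def G_eq[OF y0 t0] p_def ..
  have u_pos: "u > 0" unfolding u_def by (rule v_pos[OF y0 t0])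
  have Lsum: "L = aM + bp"
    using eq[OF y0 t0] unfolding L_def aM_def bp_def M_def p_def Peq lt_def exp_l[OF y0 t0] u_def by simp
  have lt0: "lt y0 t0 = L + P + c * (1 - u)" by (simp add: L_def lt_def u_def)
  \<comment> \<open>The part - \<open>Gw\<close> of \<open>N\<close> cancels the derivative of
    \<open>a\<close> along w, because the inverse metric is parallel. The same cancellation removes
    \<open>pG\<close> in \<open>T3\<close>, while \<open>Gb\<close> in \<open>T2\<close> survives
    and enters the Bochner identity.\<close>
  have T1: "a y0 \<bullet> (transpose N ** M + M ** N) - a' w \<bullet> M = 2 * \<kappa> * aM"
  proof -
    have tN: "transpose N = \<kappa> *\<^sub>R mat 1 - transpose Gw"
      unfolding N_def by (simp add: vec_eq_iff transpose_def mat_def)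
    have "a y0 \<bullet> (transpose N ** M) = (N ** a y0) \<bullet> M" by (rule matrix_inner_mult_left)
    also have "N ** a y0 = \<kappa> *\<^sub>R a y0 - Gw ** a y0"
      unfolding N_def by (simp add: matrix_ring_simps bounded_bilinear.scaleR_left[OF bounded_bilinear_matrix_matrix])
    finally have 1: "a y0 \<bullet> (transpose N ** M) = \<kappa> * aM - (Gw ** a y0) \<bullet> M"
      by (simp add: aM_def inner_diff_left)
    have "a y0 \<bullet> (M ** N) = (a y0 ** transpose N) \<bullet> M" by (rule matrix_inner_mult_right)
    also have "a y0 ** transpose N = \<kappa> *\<^sub>R a y0 - a y0 ** transpose Gw"
      unfolding tN by (simp add: matrix_ring_simps bounded_bilinear.scaleR_right[OF bounded_bilinear_matrix_matrix])
    finally have 2: "a y0 \<bullet> (M ** N) = \<kappa> * aM - (a y0 ** transpose Gw) \<bullet> M"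
      by (simp add: aM_def inner_diff_left)
    show ?thesis unfolding inner_add_right 1 2 a'w by (simp add: inner_diff_left)
  qed
  have DE0: "DE y0 t0 = (\<kappa> + (\<beta> + c) * u) *\<^sub>R p"
    unfolding DE_def qf(3) s using m by (simp add: p_def u_def scaleR_add_left)
  have Xp: "X \<bullet> x = - ((Gw *v x) \<bullet> p) - (\<beta> + c) * u * (p \<bullet> x)" for x
  proof -
    have "X \<bullet> x = (N *v x) \<bullet> p - DE y0 t0 \<bullet> x"
      unfolding X_def inner_diff_left p_def[symmetric] by (simp only: inner_commute[of _ x] inner_transpose_vector)
    then show ?thesis
      unfolding DE0 N_def
      by (simp add: matrix_vector_mult_diff_rdistrib matrix_vector_scaleR_left inner_diff_left inner_commute[of x p] algebra_simps)
  qed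
  have T2: "b y0 \<bullet> X = - Gb - (\<beta> + c) * u * bp"
    using Xp[of "b y0"] by (simp add: inner_commute Gb_def bp_def)
  have T3: "2 * (X \<bullet> (a y0 *v p)) - p \<bullet> (a' w *v p) = - 2 * (\<beta> + c) * u * P"
  proof -
    have "p \<bullet> ((a y0 ** transpose Gw) *v p) = pG"
      unfolding matrix_vector_mul_assoc[symmetric] a_swap[OF y0] inner_transpose_vector pG_def ..
    moreover have "p \<bullet> ((Gw ** a y0) *v p) = pG"
      unfolding matrix_vector_mul_assoc[symmetric] pG_def by (rule inner_commute)
    ultimately have "p \<bullet> (a' w *v p) = - 2 * pG"
      unfolding a'w by (simp add: matrix_vector_mult_diff_rdistrib matrix_vector_minus_left inner_diff_right)
    then show ?thesis unfolding Xp Peq pG_def by (simp add: algebra_simps)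
  qed
  have T4: "a y0 \<bullet> DDE y0 t0 = (a y0 \<bullet> Hq) / (2 * m) + (\<beta> + c) * u * (aM + P)"
    unfolding DDE_def qf(4) Hq_def[symmetric]
    by (simp add: inner_add_right inner_outer aM_def M_def p_def u_def Peq)
  have B: "- 4 * \<kappa> * (m * bp) - 2 * (m * Gb) - 2 * (m * (bw \<bullet> p)) - a y0 \<bullet> Hq = 2 * Ric - 2 * n * \<kappa>^2"
    using bochner[OF y0, where w = w and \<kappa> = \<kappa>, folded s_def Gw_def bw_def n_def Ric_def, folded Hq_def]
    unfolding s bp_def Gb_def by simp
  have B': "- Gb - bw \<bullet> p - (a y0 \<bullet> Hq) / (2 * m) = (Ric - n * \<kappa>^2) / m + 2 * \<kappa> * bp"
    using B m by (simp add: field_simps)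
  have bw: "b' w = bw" by (simp add: b'_def bw_def)
  \<comment> \<open>The value of 2 \<kappa> L - n \<kappa>^2 / m at its maximiser \<kappa> = m L /
    n.\<close>
  have \<kappa>2: "2 * \<kappa> * L - n * \<kappa>^2 / m = m / n * L^2"
    using m n by (simp add: \<kappa>_def field_simps power2_eq_square)
  have Ric0: "Ric / m \<ge> 0" using ric[OF y0, of w] m by (simp add: Ric_def)
  have "2 * \<kappa> * L + (Ric - n * \<kappa>^2) / m - (\<beta> + c) * u * L - 2 * (\<beta> + c) * u * P
    - c * u * (lt y0 t0 - m * P) + Et y0 t0 - (\<beta> + c) * u * P \<le> 0"
    using Q unfolding T1 T2 T3 T4 bw wp exp_l[OF y0 t0] u_def[symmetric] Lsum using B' by (simp add: algebra_simps)
  then have "m / n * L^2 - (\<beta> + c) * u * L - 3 * (\<beta> + c) * u * P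
    - c * u * (lt y0 t0 - m * P) + ((\<beta> + c) * u * lt y0 t0 + \<phi>' t0) \<le> 0"
    using \<kappa>2 Ric0 unfolding Et_def u_def[symmetric] diff_divide_distrib by (simp add: algebra_simps)
  also have "m / n * L^2 - (\<beta> + c) * u * L - 3 * (\<beta> + c) * u * P
    - c * u * (lt y0 t0 - m * P) + ((\<beta> + c) * u * lt y0 t0 + \<phi>' t0)
    = m / n * L^2 - c * u * L - P * u * (2 * \<beta> + c + 2 * \<alpha> * c) + \<beta> * c * u * (1 - u) + \<phi>' t0"
    unfolding lt0 m_def by (simp add: algebra_simps)
  finally show "(2 * (1 - \<alpha>) / real CARD('n)) * L^2 - c * u * L - P * u * (2 * \<beta> + c + 2 * \<alpha> * c)
    + \<beta> * c * u * (1 - u) + \<phi>' t0 \<le> 0" by (simp add: m_def n_def)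
  show "P \<ge> 0" unfolding Peq by (rule a_pos[OF y0])
qed

end

section \<open>The differential Harnack inequality\<close>

text \<open>Let - m be the negative value of H. Eliminating L = - m - \<alpha> P - x turns the left
  side of \<open>ineq\<close> into a sum of nonnegative terms, of which A m^2 is positive. The
  assumption \<open>adm\<close> is the sign of the coefficient of u P, and \<open>Q\<close> collects
  the terms free of P and m.\<close>

lemma harnack_quadratic_contradiction:
  fixes A L P u \<phi> \<phi>' \<alpha> \<beta> c :: real
  assumes A: "A > 0" and P: "P \<ge> 0" and u: "0 < u" "u < 1" and \<alpha>: "0 < \<alpha>" and c: "c > 0" and \<beta>: "\<beta> < 0"
    and adm: "2 * A * \<alpha> * \<beta> - 2 * \<beta> - c * (1 + \<alpha>) \<ge> 0"
    and \<phi>: "\<phi> \<ge> - \<beta>" and neg: "L + \<alpha> * P + \<beta> * u + \<phi> < 0"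
    and ineq: "A * L^2 - c * u * L - P * u * (2 * \<beta> + c + 2 * \<alpha> * c) + \<beta> * c * u * (1 - u) + \<phi>' \<le> 0"
    and Q: "A * (\<beta> * u + \<phi>)^2 + c * u * (\<phi> + \<beta>) + \<phi>' \<ge> 0"
  shows False
proof -
  define m where "m = - (L + \<alpha> * P + \<beta> * u + \<phi>)"
  have m: "m > 0" using neg by (simp add: m_def)
  define x where "x = \<beta> * u + \<phi>"
  have "\<beta> * u \<ge> \<beta>" using u \<beta> by (simp add: mult_le_cancel_left1)
  then have x: "x \<ge> 0" using \<phi> by (simp add: x_def)
  have \<phi>0: "\<phi> + m \<ge> 0" using \<phi> \<beta> m by simp
  have L: "L = - m - \<alpha> * P - x" by (simp add: m_def x_def)
  have "A * L^2 - c * u * L - P * u * (2 * \<beta> + c + 2 * \<alpha> * c) + \<beta> * c * u * (1 - u) + \<phi>'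
    = A * \<alpha>^2 * P^2 + 2 * A * \<alpha> * P * (\<phi> + m) + u * P * (2 * A * \<alpha> * \<beta> - 2 * \<beta> - c * (1 + \<alpha>))
     + 2 * A * m * x + A * m^2 + c * u * m + (A * (\<beta> * u + \<phi>)^2 + c * u * (\<phi> + \<beta>) + \<phi>')"
    unfolding L x_def by (simp add: power2_eq_square algebra_simps)
  moreover have "A * \<alpha>^2 * P^2 \<ge> 0" "2 * A * \<alpha> * P * (\<phi> + m) \<ge> 0" "u * P * (2 * A * \<alpha> * \<beta> - 2 * \<beta> - c * (1 + \<alpha>)) \<ge> 0"
    "2 * A * m * x \<ge> 0" "A * m^2 > 0" "c * u * m > 0"
    using A \<alpha> P \<phi>0 u adm m x c by simp_all
  ultimately show False using ineq Q by linarith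
qed

section \<open>Charts of the manifold, and minima of functions that are continuous in charts\<close>

context closed_riemannian_manifold
begin

lemma chart_dom_subset: "\<kappa> \<in> A \<Longrightarrow> chart_dom \<kappa> \<subseteq> topspace M"
  using chart_dom_open openin_subset by blast

lemma chart_at: "p \<in> topspace M \<Longrightarrow> chart_at A p \<in> A \<and> p \<in> chart_dom (chart_at A p)"
  unfolding chart_at_def using charts_cover someI_ex[of "\<lambda>\<kappa>. \<kappa> \<in> A \<and> p \<in> chart_dom \<kappa>"] by blast

lemma topspace_chart_dom: "\<kappa> \<in> A \<Longrightarrow> topspace (subtopology M (chart_dom \<kappa>)) = chart_dom \<kappa>"
  using chart_dom_subset by (intro topspace_subtopology_subset)

lemma chart_inj: "\<kappa> \<in> A \<Longrightarrow> inj_on (chart_map \<kappa>) (chart_dom \<kappa>)"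
  using homeomorphic_imp_injective_map[OF chart_homeo] topspace_chart_dom by metis

lemma chart_inv_map: "\<kappa> \<in> A \<Longrightarrow> p \<in> chart_dom \<kappa> \<Longrightarrow> chart_inv \<kappa> (chart_map \<kappa> p) = p"
  unfolding chart_inv_def by (rule inv_into_f_f[OF chart_inj])

lemma chart_map_inv: "y \<in> chart_img \<kappa> \<Longrightarrow> chart_map \<kappa> (chart_inv \<kappa> y) = y"
  unfolding chart_inv_def chart_img_def by (rule f_inv_into_f)

lemma chart_inv_dom: "y \<in> chart_img \<kappa> \<Longrightarrow> chart_inv \<kappa> y \<in> chart_dom \<kappa>"
  unfolding chart_inv_def chart_img_def by (rule inv_into_into)

lemma chart_map_img: "p \<in> chart_dom \<kappa> \<Longrightarrow> chart_map \<kappa> p \<in> chart_img \<kappa>"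
  by (simp add: chart_img_def)

lemma chart_inv_topspace: "\<kappa> \<in> A \<Longrightarrow> y \<in> chart_img \<kappa> \<Longrightarrow> chart_inv \<kappa> y \<in> topspace M"
  using chart_inv_dom chart_dom_subset by blast

lemma open_chart_image:
  assumes "\<kappa> \<in> A" "openin M U" "U \<subseteq> chart_dom \<kappa>"
  shows "open (chart_map \<kappa> ` U)"
proof -
  have "openin (subtopology M (chart_dom \<kappa>)) U"
    using assms by (simp add: openin_open_subtopology chart_dom_open)
  then have "openin (top_of_set (chart_img \<kappa>)) (chart_map \<kappa> ` U)"
    using homeomorphic_imp_open_map[OF chart_homeo[OF assms(1)]] unfolding open_map_def by blast
  then show ?thesis using chart_img_open[OF assms(1)] openin_open_trans by blast
qed

lemma openin_chart_preimage:
  assumes "\<kappa> \<in> A" "open B"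
  shows "openin M {p \<in> chart_dom \<kappa>. chart_map \<kappa> p \<in> B}"
proof -
  have "continuous_map (subtopology M (chart_dom \<kappa>)) (top_of_set (chart_img \<kappa>)) (chart_map \<kappa>)"
    using homeomorphic_imp_continuous_map[OF chart_homeo[OF assms(1)]] .
  moreover have "openin (top_of_set (chart_img \<kappa>)) (chart_img \<kappa> \<inter> B)"
    using assms(2) by (simp add: openin_open_Int)
  ultimately have "openin (subtopology M (chart_dom \<kappa>)) {p \<in> topspace (subtopology M (chart_dom \<kappa>)). chart_map \<kappa> p \<in> chart_img \<kappa> \<inter> B}"
    by (rule openin_continuous_map_preimage)
  moreover have "{p \<in> topspace (subtopology M (chart_dom \<kappa>)). chart_map \<kappa> p \<in> chart_img \<kappa> \<inter> B} = {p \<in> chart_dom \<kappa>. chart_map \<kappa> p \<in> B}"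
    unfolding topspace_chart_dom[OF assms(1)] by (auto simp: chart_map_img)
  ultimately show ?thesis
    using openin_trans_full chart_dom_open[OF assms(1)] by fastforce
qed

definition overlap :: "('a, 'n) chart \<Rightarrow> ('a, 'n) chart \<Rightarrow> (real^'n) set" where
  "overlap \<kappa> \<kappa>' = chart_map \<kappa> ` (chart_dom \<kappa> \<inter> chart_dom \<kappa>')"

lemma overlap_open: "\<kappa> \<in> A \<Longrightarrow> \<kappa>' \<in> A \<Longrightarrow> open (overlap \<kappa> \<kappa>')"
  unfolding overlap_def by (intro open_chart_image openin_Int chart_dom_open) auto

lemma overlap_inv:
  assumes "\<kappa> \<in> A" "y \<in> overlap \<kappa> \<kappa>'"
  shows "y \<in> chart_img \<kappa>" "chart_inv \<kappa> y \<in> chart_dom \<kappa>" "chart_inv \<kappa> y \<in> chart_dom \<kappa>'"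
  using assms chart_inv_map unfolding overlap_def chart_img_def by fastforce+

lemma transition_map:
  "\<kappa> \<in> A \<Longrightarrow> p \<in> chart_dom \<kappa> \<Longrightarrow> transition \<kappa> \<kappa>' (chart_map \<kappa> p) = chart_map \<kappa>' p"
  by (simp add: transition_def chart_inv_map)

lemma transition_Ck: "\<kappa> \<in> A \<Longrightarrow> \<kappa>' \<in> A \<Longrightarrow> Ck_on k (transition \<kappa> \<kappa>') (overlap \<kappa> \<kappa>')"
  using transition_smooth unfolding smooth_on_def overlap_def by blast

lemma transition_diff: "\<kappa> \<in> A \<Longrightarrow> \<kappa>' \<in> A \<Longrightarrow> y \<in> overlap \<kappa> \<kappa>' \<Longrightarrow> transition \<kappa> \<kappa>' differentiable (at y)"
  using C1_on_differentiable[OF transition_Ck overlap_open] by blast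

lemma chart_metric: "\<kappa> \<in> A \<Longrightarrow> chart_metric (chart_img \<kappa>) (g \<kappa>)"
  by unfold_locales (use chart_img_open metric_smooth metric_sym metric_pos in auto)

lemma metric_jac:
  assumes "\<kappa> \<in> A" "\<kappa>' \<in> A" "p \<in> chart_dom \<kappa>" "p \<in> chart_dom \<kappa>'"
  shows "g \<kappa> (chart_map \<kappa> p) = transpose (jac (transition \<kappa> \<kappa>') (chart_map \<kappa> p)) ** g \<kappa>' (chart_map \<kappa>' p)
     ** jac (transition \<kappa> \<kappa>') (chart_map \<kappa> p)"
proof (rule metric_tensor[OF assms(1,2)])
  show "p \<in> chart_dom \<kappa> \<inter> chart_dom \<kappa>'" using assms by simp
  show "jac (transition \<kappa> \<kappa>') (chart_map \<kappa> p) = matrix (frechet_derivative (transition \<kappa> \<kappa>') (at (chart_map \<kappa> p)))"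
    by (simp add: jac_def matrix_def partial_deriv_def)
qed

text \<open>The differential pulls back by the transpose of the Jacobian J, and the metric by J on
  both sides. Hence J maps one gradient to the other, and the pairing of differential and gradient
  is preserved.\<close>

lemma gradient_norm_chart_independent:
  fixes F :: "'a \<Rightarrow> real"
  assumes \<kappa>: "\<kappa> \<in> A" "\<kappa>' \<in> A" and p: "p \<in> chart_dom \<kappa>" "p \<in> chart_dom \<kappa>'"
    and d: "(\<lambda>y. F (chart_inv \<kappa>' y)) differentiable (at (chart_map \<kappa>' p))"
  shows "pgrad (\<lambda>y. F (chart_inv \<kappa> y)) (chart_map \<kappa> p) \<bullet>
      (chart_metric.a (g \<kappa>) (chart_map \<kappa> p) *v pgrad (\<lambda>y. F (chart_inv \<kappa> y)) (chart_map \<kappa> p))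
    = pgrad (\<lambda>y. F (chart_inv \<kappa>' y)) (chart_map \<kappa>' p) \<bullet>
      (chart_metric.a (g \<kappa>') (chart_map \<kappa>' p) *v pgrad (\<lambda>y. F (chart_inv \<kappa>' y)) (chart_map \<kappa>' p))"
proof -
  interpret c1: chart_metric "chart_img \<kappa>" "g \<kappa>" by (rule chart_metric[OF \<kappa>(1)])
  interpret c2: chart_metric "chart_img \<kappa>'" "g \<kappa>'" by (rule chart_metric[OF \<kappa>(2)])
  define y where "y = chart_map \<kappa> p"
  define y' where "y' = chart_map \<kappa>' p"
  define J where "J = jac (transition \<kappa> \<kappa>') y"
  have yo: "y \<in> overlap \<kappa> \<kappa>'" using p by (simp add: y_def overlap_def)
  have yi: "y \<in> chart_img \<kappa>" "y' \<in> chart_img \<kappa>'" using p by (simp_all add: y_def y'_def chart_map_img)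
  have Ty: "transition \<kappa> \<kappa>' y = y'" unfolding y_def y'_def by (rule transition_map[OF \<kappa>(1) p(1)])
  define D where "D = pgrad (\<lambda>y. F (chart_inv \<kappa> y)) y"
  define D' where "D' = pgrad (\<lambda>y. F (chart_inv \<kappa>' y)) y'"
  have dT: "(transition \<kappa> \<kappa>' has_derivative (\<lambda>v. J *v v)) (at y)"
    unfolding J_def by (rule has_derivative_jac[OF transition_diff[OF \<kappa> yo]])
  have "((\<lambda>y. F (chart_inv \<kappa>' y)) has_derivative (\<lambda>v. D' \<bullet> v)) (at (transition \<kappa> \<kappa>' y))"
    unfolding Ty D'_def using d unfolding y'_def by (rule has_derivative_pgrad)
  from has_derivative_compose[OF dT this]
  have "((\<lambda>y. F (chart_inv \<kappa>' (transition \<kappa> \<kappa>' y))) has_derivative (\<lambda>v. D' \<bullet> (J *v v))) (at y)" .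
  then have "((\<lambda>y. F (chart_inv \<kappa> y)) has_derivative (\<lambda>v. D' \<bullet> (J *v v))) (at y)"
  proof (rule has_derivative_transform_within_open[OF _ overlap_open[OF \<kappa>] yo])
    fix z assume "z \<in> overlap \<kappa> \<kappa>'"
    then show "F (chart_inv \<kappa>' (transition \<kappa> \<kappa>' z)) = F (chart_inv \<kappa> z)"
      using overlap_inv[OF \<kappa>(1)] chart_inv_map[OF \<kappa>(2)] by (simp add: transition_def)
  qed
  from partial_deriv_eqI[OF this] have Dv: "D = transpose J *v D'"
    unfolding D_def pgrad_def
    by (simp add: vec_eq_iff matrix_vector_mult_basis column_def inner_vec_def)
      (simp add: vector_matrix_mult_def mult.commute)
  have gJ: "g \<kappa> y = transpose J ** g \<kappa>' y' ** J"
    unfolding y_def y'_def J_def by (rule metric_jac[OF \<kappa> p])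
  \<comment> \<open>Invertibility of J is read off from the transformation law, because the metric
    is nondegenerate.\<close>
  have "det (g \<kappa> y) \<noteq> 0" by (rule c1.h_inv(3)[OF yi(1)])
  then have "det (transpose J) \<noteq> 0" unfolding gJ by (auto simp: det_mul)
  then have inj: "x = x'" if "transpose J *v x = transpose J *v x'" for x x'
    using that unfolding invertible_det_nz[symmetric] invertible_left_inverse
    by (metis matrix_vector_mul_assoc matrix_vector_mul_lid)
  define x where "x = c1.a y *v D"
  have "transpose J *v D' = g \<kappa> y *v x" using c1.h_a[OF yi(1), of D] by (simp add: x_def Dv)
  also have "\<dots> = transpose J *v (g \<kappa>' y' *v (J *v x))"
    unfolding gJ by (simp only: matrix_vector_mul_assoc matrix_mul_assoc)
  finally have "D' = g \<kappa>' y' *v (J *v x)" by (rule inj)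
  then have Jx: "J *v x = c2.a y' *v D'" using c2.a_h[OF yi(2)] by simp
  have "D \<bullet> x = x \<bullet> (transpose J *v D')" by (simp only: Dv inner_commute)
  also have "\<dots> = D' \<bullet> (J *v x)" unfolding inner_transpose_vector by (rule inner_commute)
  finally show ?thesis using Jx by (simp add: x_def D_def D'_def y_def y'_def)
qed

text \<open>Finitely many coordinate balls cover M. The values of F on the corresponding closed
  balls times S form a compact set \<open>R\<close> of reals, which is the whole range of F, so its
  least element is a value of F.\<close>

lemma attains_min_chartwise:
  fixes F :: "'a \<Rightarrow> real \<Rightarrow> real"
  assumes F: "\<And>\<kappa>. \<kappa> \<in> A \<Longrightarrow> continuous_on (chart_img \<kappa> \<times> S) (\<lambda>(y, t). F (chart_inv \<kappa> y) t)"
    and S: "compact S" "S \<noteq> {}" and M: "topspace M \<noteq> {}"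
  obtains p t where "p \<in> topspace M" "t \<in> S" "\<And>q s. q \<in> topspace M \<Longrightarrow> s \<in> S \<Longrightarrow> F p t \<le> F q s"
proof -
  \<comment> \<open>Each open set is recorded with its chart, centre and radius, so that a finite
    subcover still knows its closed balls.\<close>
  define Us where "Us = {({p \<in> chart_dom \<kappa>. chart_map \<kappa> p \<in> ball y r}, \<kappa>, y, r) |\<kappa> y r. \<kappa> \<in> A \<and> r > 0 \<and> cball y r \<subseteq> chart_img \<kappa>}"
  have op: "openin M U" if "U \<in> fst ` Us" for U
  proof -
    from that obtain \<kappa> y r where "U = {p \<in> chart_dom \<kappa>. chart_map \<kappa> p \<in> ball y r}" "\<kappa> \<in> A"
      unfolding Us_def by force
    then show ?thesis using openin_chart_preimage[OF _ open_ball] by simp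
  qed
  have cover: "topspace M \<subseteq> \<Union>(fst ` Us)"
  proof
    fix p assume "p \<in> topspace M"
    then obtain \<kappa> where \<kappa>: "\<kappa> \<in> A" "p \<in> chart_dom \<kappa>" using charts_cover by blast
    obtain r where r: "r > 0" "cball (chart_map \<kappa> p) r \<subseteq> chart_img \<kappa>"
      using open_contains_cball chart_img_open[OF \<kappa>(1)] chart_map_img[OF \<kappa>(2)] by meson
    have "({q \<in> chart_dom \<kappa>. chart_map \<kappa> q \<in> ball (chart_map \<kappa> p) r}, \<kappa>, chart_map \<kappa> p, r) \<in> Us"
      using \<kappa> r unfolding Us_def by blast
    moreover have "p \<in> {q \<in> chart_dom \<kappa>. chart_map \<kappa> q \<in> ball (chart_map \<kappa> p) r}" using \<kappa> r by simp
    ultimately show "p \<in> \<Union>(fst ` Us)" by force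
  qed
  have "\<exists>FF. finite FF \<and> FF \<subseteq> fst ` Us \<and> topspace M \<subseteq> \<Union>FF"
    using compact op cover unfolding compact_space_alt by blast
  then obtain FF where FF: "finite FF" "FF \<subseteq> fst ` Us" "topspace M \<subseteq> \<Union>FF" by blast
  from finite_subset_image[OF FF(1,2)] obtain I where I: "I \<subseteq> Us" "finite I" "FF = fst ` I" by blast
  define R where "R = (\<Union>(U, \<kappa>, y, r)\<in>I. (\<lambda>(y, t). F (chart_inv \<kappa> y) t) ` (cball y r \<times> S))"
  have "compact ((\<lambda>(y, t). F (chart_inv \<kappa> y) t) ` (cball y r \<times> S))" if "(U, \<kappa>, y, r) \<in> I" for U \<kappa> y r
  proof (rule compact_continuous_image)
    have "\<kappa> \<in> A" "cball y r \<subseteq> chart_img \<kappa>" using that I unfolding Us_def by blast+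
    then show "continuous_on (cball y r \<times> S) (\<lambda>(y, t). F (chart_inv \<kappa> y) t)"
      by (intro continuous_on_subset[OF F]) auto
  qed (intro compact_Times S compact_cball)
  then have compR: "compact R" unfolding R_def using I(2) by (intro compact_UN) auto
  have inR: "F q s \<in> R" if "q \<in> topspace M" "s \<in> S" for q s
  proof -
    have "q \<in> \<Union>(fst ` I)" using FF(3) that(1) unfolding I(3) by blast
    then obtain X where X: "X \<in> I" "q \<in> fst X" by blast
    obtain \<kappa> y r where e: "X = ({p \<in> chart_dom \<kappa>. chart_map \<kappa> p \<in> ball y r}, \<kappa>, y, r)" "\<kappa> \<in> A"
      using X(1) I(1) unfolding Us_def by blast
    have q: "q \<in> chart_dom \<kappa>" "chart_map \<kappa> q \<in> cball y r" using X(2) e by auto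
    then have "F q s \<in> (\<lambda>(y, t). F (chart_inv \<kappa> y) t) ` (cball y r \<times> S)"
      using that(2) chart_inv_map[OF e(2)] by (intro image_eqI[of _ _ "(chart_map \<kappa> q, s)"]) auto
    then show ?thesis unfolding R_def using X(1) unfolding e(1) by blast
  qed
  obtain q0 s0 where "q0 \<in> topspace M" "s0 \<in> S" using M S by blast
  then have "R \<noteq> {}" using inR by blast
  from compact_attains_inf[OF compR this] obtain x where x: "x \<in> R" "\<And>x'. x' \<in> R \<Longrightarrow> x \<le> x'" by blast
  from x(1) obtain U \<kappa> y r z t where z: "(U, \<kappa>, y, r) \<in> I" "z \<in> cball y r" "t \<in> S" "x = F (chart_inv \<kappa> z) t"
    unfolding R_def by auto
  have "\<kappa> \<in> A" "z \<in> chart_img \<kappa>" using z(1,2) I unfolding Us_def by blast+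
  then have "chart_inv \<kappa> z \<in> topspace M" by (rule chart_inv_topspace)
  then show ?thesis using that[of "chart_inv \<kappa> z" t] z x(2) inR by blast
qed

end

section \<open>The minimum principle for the Fisher solution on the whole manifold\<close>

locale fisher_manifold = closed_riemannian_manifold M A g
  for M :: "'a topology" and A :: "('a, 'n::finite) chart set" and g :: "('a, 'n) metric" +
  fixes c :: real and f :: "'a \<Rightarrow> real \<Rightarrow> real"
  assumes ric: "nonneg_ricci A g" and c: "c > 0" and sol: "fisher_solution A g c f"
    and f01: "x \<in> topspace M \<Longrightarrow> t \<ge> 0 \<Longrightarrow> 0 < f x t \<and> f x t < 1"
begin

definition ft :: "'a \<Rightarrow> real \<Rightarrow> real" where
  "ft p t = vector_derivative (f p) (at t within {0..})"

text \<open>The squared length of grad (ln f), computed in the chart \<kappa>. \<open>Gp\<close>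
  fixes one chart at each point, and \<open>Gp_chart\<close> shows that the choice is
  immaterial.\<close>

definition Gc :: "('a, 'n) chart \<Rightarrow> 'a \<Rightarrow> real \<Rightarrow> real" where
  "Gc \<kappa> p t = pgrad (in_chart \<kappa> f t) (chart_map \<kappa> p) \<bullet> (chart_metric.a (g \<kappa>) (chart_map \<kappa> p) *v pgrad (in_chart \<kappa> f t) (chart_map \<kappa> p)) / (f p t)^2"

definition Gp :: "'a \<Rightarrow> real \<Rightarrow> real" where
  "Gp p t = Gc (chart_at A p) p t"

lemma C21:
  assumes "\<kappa> \<in> A"
  shows "\<And>t. t \<ge> 0 \<Longrightarrow> Ck_on 2 (in_chart \<kappa> f t) (chart_img \<kappa>)"
    "continuous_on (chart_img \<kappa> \<times> {0..}) (\<lambda>(y, t). in_chart \<kappa> f t y)"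
    "\<And>i. continuous_on (chart_img \<kappa> \<times> {0..}) (\<lambda>(y, t). partial_deriv i (in_chart \<kappa> f t) y)"
    "\<And>i j. continuous_on (chart_img \<kappa> \<times> {0..}) (\<lambda>(y, t). partial_deriv i (partial_deriv j (in_chart \<kappa> f t)) y)"
    "continuous_on (chart_img \<kappa> \<times> {0..}) (\<lambda>(y, t). ft (chart_inv \<kappa> y) t)"
  using sol assms unfolding fisher_solution_def C2_1_def Let_def ft_def in_chart_def by auto

lemma in_chart_diff:
  assumes "\<kappa> \<in> A" "y \<in> chart_img \<kappa>" "t \<ge> 0"
  shows "in_chart \<kappa> f t differentiable (at y)"
  using C21(1)[OF assms(1,3)]
  by (intro differentiable_on_open_at[OF chart_img_open[OF assms(1)] assms(2)]) (simp add: numeral_2_eq_2)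

lemma Gp_chart:
  assumes "\<kappa> \<in> A" "p \<in> chart_dom \<kappa>" "t \<ge> 0"
  shows "Gp p t = Gc \<kappa> p t"
proof -
  have p: "p \<in> topspace M" using assms chart_dom_subset by blast
  note ca = chart_at[OF p]
  have eq: "in_chart \<kappa> f t = (\<lambda>y. f (chart_inv \<kappa> y) t)" for \<kappa>
    by (simp add: fun_eq_iff in_chart_def)
  have d: "(\<lambda>y. f (chart_inv \<kappa> y) t) differentiable (at (chart_map \<kappa> p))"
    using in_chart_diff[OF assms(1) chart_map_img[OF assms(2)] assms(3)] unfolding eq .
  show ?thesis
    unfolding Gp_def Gc_def eq
    by (simp only: gradient_norm_chart_independent[where F = "\<lambda>q. f q t", OF ca[THEN conjunct1] assms(1)
      ca[THEN conjunct2] assms(2) d])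
qed

lemma f_deriv:
  assumes "\<kappa> \<in> A" "p \<in> chart_dom \<kappa>" "t \<ge> 0"
  shows "(f p has_real_derivative ft p t) (at t within {0..})"
    "ft p t = laplace_beltrami (g \<kappa>) (in_chart \<kappa> f t) (chart_map \<kappa> p) + c * f p t * (1 - f p t)"
proof -
  have d: "(f p has_real_derivative laplace_beltrami (g \<kappa>) (in_chart \<kappa> f t) (chart_map \<kappa> p) + c * f p t * (1 - f p t))
          (at t within {0..})"
    using sol assms unfolding fisher_solution_def by blast
  \<comment> \<open>Uniqueness of the derivative requires that {0..} accumulates at t; an interval
    to the right of t shows this for t = 0 as well.\<close>
  have "at t within {t..t+1} \<noteq> bot" by (simp add: trivial_limit_within)
  moreover have "at t within {t..t+1} \<le> at t within {0..}" using assms(3) by (intro at_le) auto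
  ultimately have "at t within {0..} \<noteq> bot" by (metis bot_unique)
  then show e: "ft p t = laplace_beltrami (g \<kappa>) (in_chart \<kappa> f t) (chart_map \<kappa> p) + c * f p t * (1 - f p t)"
    unfolding ft_def
    using d[unfolded has_real_derivative_iff_has_vector_derivative] by (rule vector_derivative_within)
  show "(f p has_real_derivative ft p t) (at t within {0..})" using d e by simp
qed

lemma f_deriv_at:
  assumes "p \<in> topspace M" "t > 0"
  shows "(f p has_real_derivative ft p t) (at t)"
proof -
  have "(f p has_real_derivative ft p t) (at t within {0..})"
    using f_deriv(1)[of "chart_at A p" p t] chart_at[OF assms(1)] assms(2) by simp
  then have "(f p has_real_derivative ft p t) (at t within {0<..})"
    by (rule DERIV_subset) auto
  then show ?thesis using assms(2) by (simp add: at_within_open[OF _ open_greaterThan])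
qed

definition Hm :: "real \<Rightarrow> real \<Rightarrow> (real \<Rightarrow> real) \<Rightarrow> 'a \<Rightarrow> real \<Rightarrow> real" where
  "Hm \<alpha> \<beta> \<phi> p t = ft p t / f p t - (1 - \<alpha>) * Gp p t + (- c + (\<beta> + c) * f p t) + \<phi> t"

lemma Hm_continuous:
  assumes \<kappa>: "\<kappa> \<in> A" and S: "S \<subseteq> {0..}" and \<phi>: "continuous_on S \<phi>"
  shows "continuous_on (chart_img \<kappa> \<times> S) (\<lambda>(y, t). Hm \<alpha> \<beta> \<phi> (chart_inv \<kappa> y) t)"
proof -
  interpret chart_metric "chart_img \<kappa>" "g \<kappa>" by (rule chart_metric[OF \<kappa>])
  let ?v = "in_chart \<kappa> f"
  have sub: "chart_img \<kappa> \<times> S \<subseteq> chart_img \<kappa> \<times> {0..}" using S by auto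
  have eq: "Hm \<alpha> \<beta> \<phi> (chart_inv \<kappa> y) t = ft (chart_inv \<kappa> y) t / ?v t y - (1 - \<alpha>) * (pgrad (?v t) y \<bullet> (a y *v pgrad (?v t) y) / (?v t y)^2)
      + (- c + (\<beta> + c) * ?v t y) + \<phi> t" if "y \<in> chart_img \<kappa>" "t \<in> S" for y t
    using Gp_chart[OF \<kappa> chart_inv_dom[OF that(1)], of t] S that
    by (auto simp: Hm_def Gc_def chart_map_inv in_chart_def)
  have cv: "continuous_on (chart_img \<kappa> \<times> S) (\<lambda>z. ?v (snd z) (fst z))"
    using continuous_on_subset[OF C21(2)[OF \<kappa>] sub] by (simp add: case_prod_beta')
  have cft: "continuous_on (chart_img \<kappa> \<times> S) (\<lambda>z. ft (chart_inv \<kappa> (fst z)) (snd z))"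
    using continuous_on_subset[OF C21(5)[OF \<kappa>] sub] by (simp add: case_prod_beta')
  have cp: "continuous_on (chart_img \<kappa> \<times> S) (\<lambda>z. pgrad (?v (snd z)) (fst z))"
    unfolding pgrad_def using continuous_on_subset[OF C21(3)[OF \<kappa>] sub]
    by (intro continuous_on_vec_lambda) (simp add: case_prod_beta')
  have ca: "continuous_on (chart_img \<kappa> \<times> S) (\<lambda>z. a (fst z))"
    by (rule continuous_on_compose2[OF C1_on_continuous[OF a_C1]]) (auto intro!: continuous_intros)
  have nz: "\<forall>z\<in>chart_img \<kappa> \<times> S. ?v (snd z) (fst z) \<noteq> 0"
    using f01 chart_inv_topspace[OF \<kappa>] S unfolding in_chart_def by fastforce
  have c\<phi>: "continuous_on (chart_img \<kappa> \<times> S) (\<lambda>z. \<phi> (snd z))"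
    by (rule continuous_on_compose2[OF \<phi>]) (auto intro!: continuous_intros)
  have "continuous_on (chart_img \<kappa> \<times> S) (\<lambda>z. ft (chart_inv \<kappa> (fst z)) (snd z) / ?v (snd z) (fst z)
     - (1 - \<alpha>) * (pgrad (?v (snd z)) (fst z) \<bullet> (a (fst z) *v pgrad (?v (snd z)) (fst z)) / (?v (snd z) (fst z))^2)
      + (- c + (\<beta> + c) * ?v (snd z) (fst z)) + \<phi> (snd z))"
    using nz by (intro continuous_intros cv cft cp c\<phi> ca continuous_on_matrix_vector) auto
  then show ?thesis
    by (rule continuous_on_cong[THEN iffD1, OF refl, rotated]) (auto simp: eq)
qed

text \<open>By \<open>init\<close>, a negative minimum over M and [a0, T] is attained after time a0.
  Then a backward time interval is available for \<open>local_minimum_inequality\<close>, and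
  \<open>harnack_quadratic_contradiction\<close> excludes the minimum. The assumptions
  \<open>\<phi>\<beta>\<close> and \<open>Q\<close> are what a barrier \<phi> has to
  satisfy.\<close>

lemma Hm_nonneg:
  fixes \<alpha> \<beta> :: real and \<phi> \<phi>' :: "real \<Rightarrow> real"
  defines "n \<equiv> real CARD('n)"
  assumes adm: "admissible n c \<alpha> \<beta>"
    and \<phi>: "\<And>t. t > 0 \<Longrightarrow> (\<phi> has_real_derivative \<phi>' t) (at t)" and c\<phi>': "continuous_on {0<..} \<phi>'"
    and \<phi>\<beta>: "\<And>t. a0 < t \<Longrightarrow> t \<le> T \<Longrightarrow> \<phi> t \<ge> - \<beta>"
    and Q: "\<And>t u. a0 < t \<Longrightarrow> t \<le> T \<Longrightarrow> 0 < u \<Longrightarrow> u < 1 \<Longrightarrow>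
        2 * (1 - \<alpha>) / n * (\<beta> * u + \<phi> t)^2 + c * u * (\<phi> t + \<beta>) + \<phi>' t \<ge> 0"
    and a0: "a0 > 0" and init: "\<And>p. p \<in> topspace M \<Longrightarrow> Hm \<alpha> \<beta> \<phi> p a0 \<ge> 0"
    and p: "p \<in> topspace M" and t: "a0 \<le> t" "t \<le> T"
  shows "Hm \<alpha> \<beta> \<phi> p t \<ge> 0"
proof (rule ccontr)
  assume neg: "\<not> Hm \<alpha> \<beta> \<phi> p t \<ge> 0"
  have n: "n \<ge> 1" by (simp add: n_def Suc_leI)
  have \<alpha>: "0 < \<alpha>" "\<alpha> < 1" using adm by (simp_all add: admissible_def)
  have "continuous_on {a0..T} \<phi>"
    using a0 by (intro continuous_at_imp_continuous_on ballI DERIV_isCont[OF \<phi>]) auto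
  then have cont: "continuous_on (chart_img \<kappa> \<times> {a0..T}) (\<lambda>(y, t). Hm \<alpha> \<beta> \<phi> (chart_inv \<kappa> y) t)" if "\<kappa> \<in> A" for \<kappa>
    using Hm_continuous[OF that, of "{a0..T}"] a0 by auto
  obtain p0 t0 where p0: "p0 \<in> topspace M" and t0: "t0 \<in> {a0..T}"
    and min: "\<And>q s. q \<in> topspace M \<Longrightarrow> s \<in> {a0..T} \<Longrightarrow> Hm \<alpha> \<beta> \<phi> p0 t0 \<le> Hm \<alpha> \<beta> \<phi> q s"
    by (rule attains_min_chartwise[OF cont]) (use t p in auto)
  have neg0: "Hm \<alpha> \<beta> \<phi> p0 t0 < 0" using min[OF p, of t] neg t by auto
  then have t0a: "t0 > a0" using init[OF p0] t0 by (cases "t0 = a0") auto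
  obtain \<kappa> where \<kappa>: "\<kappa> \<in> A" "p0 \<in> chart_dom \<kappa>" using p0 charts_cover by blast
  interpret chart_metric "chart_img \<kappa>" "g \<kappa>" by (rule chart_metric[OF \<kappa>(1)])
  define y0 where "y0 = chart_map \<kappa> p0"
  have y0: "y0 \<in> chart_img \<kappa>" using \<kappa> by (simp add: y0_def chart_map_img)
  have p0y: "chart_inv \<kappa> y0 = p0" using chart_inv_map[OF \<kappa>] by (simp add: y0_def)
  obtain r where r: "r > 0" "cball y0 (2 * r) \<subseteq> chart_img \<kappa>"
  proof -
    obtain r where "r > 0" "cball y0 r \<subseteq> chart_img \<kappa>" using open_contains_cball chart_img_open[OF \<kappa>(1)] y0 by meson
    then show ?thesis using that[of "r / 2"] by simp
  qed
  let ?v = "in_chart \<kappa> f" and ?vt = "\<lambda>y t. ft (chart_inv \<kappa> y) t"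
  have Hm_eq: "Hm \<alpha> \<beta> \<phi> (chart_inv \<kappa> y) t = ?vt y t / ?v t y - (1 - \<alpha>) * (pgrad (?v t) y \<bullet> (a y *v pgrad (?v t) y) / (?v t y)^2)
      + (- c + (\<beta> + c) * ?v t y) + \<phi> t" if "y \<in> chart_img \<kappa>" "t > 0" for y t
    using Gp_chart[OF \<kappa>(1) chart_inv_dom[OF that(1)], of t] that
    by (auto simp: Hm_def Gc_def chart_map_inv in_chart_def)
  have sub: "chart_img \<kappa> \<times> {0<..} \<subseteq> chart_img \<kappa> \<times> {0::real..}" by auto
  have t0pos: "t0 > 0" using t0a a0 by simp
  define P where "P = pgrad (?v t0) y0 \<bullet> (a y0 *v pgrad (?v t0) y0) / (?v t0 y0)^2"
  define u where "u = ?v t0 y0"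
  define L where "L = ?vt y0 t0 / u - P - c * (1 - u)"
  have m1: "0 < ?v t y" if "y \<in> chart_img \<kappa>" "t > 0" for y t
    using f01[OF chart_inv_topspace[OF \<kappa>(1) that(1)], of t] that by (simp add: in_chart_def)
  have m2: "Ck_on 2 (?v t) (chart_img \<kappa>)" if "t > 0" for t using C21(1)[OF \<kappa>(1)] that by simp
  have m3: "((\<lambda>s. ?v s y) has_real_derivative ?vt y t) (at t)" if "y \<in> chart_img \<kappa>" "t > 0" for y t
    using f_deriv_at[OF chart_inv_topspace[OF \<kappa>(1) that(1)] that(2)] by (simp add: in_chart_def)
  have m4: "?vt y t = laplace_beltrami (g \<kappa>) (?v t) y + c * ?v t y * (1 - ?v t y)" if "y \<in> chart_img \<kappa>" "t > 0" for y t
    using f_deriv(2)[OF \<kappa>(1) chart_inv_dom[OF that(1)], of t] that by (simp add: chart_map_inv in_chart_def)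
  have m5: "w \<bullet> (ricci (g \<kappa>) y *v w) \<ge> 0" if "y \<in> chart_img \<kappa>" for y w
    using ric \<kappa>(1) that unfolding nonneg_ricci_def by blast
  have m6: "?vt y0 t0 / ?v t0 y0 - (1 - \<alpha>) * (pgrad (?v t0) y0 \<bullet> (a y0 *v pgrad (?v t0) y0) / (?v t0 y0)^2)
      + (- c + (\<beta> + c) * ?v t0 y0) + \<phi> t0 \<le> ?vt y t / ?v t y - (1 - \<alpha>) * (pgrad (?v t) y \<bullet> (a y *v pgrad (?v t) y) / (?v t y)^2)
      + (- c + (\<beta> + c) * ?v t y) + \<phi> t" if "y \<in> cball y0 r" "t \<in> {t0 - (t0 - a0)..t0}" for y t
  proof -
    have yi: "y \<in> chart_img \<kappa>" using that(1) r subset_cball[of r "2 * r" y0] by auto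
    have tp: "t > 0" using that(2) a0 by simp
    show ?thesis
      using min[OF chart_inv_topspace[OF \<kappa>(1) yi], of t] that t0
      unfolding Hm_eq[OF y0 t0pos, unfolded p0y] Hm_eq[OF yi tp] p0y by simp
  qed
  have \<eta>: "0 < t0 - a0" "t0 - a0 < t0" using t0a a0 by simp_all
  note lm = local_minimum_inequality[OF m1 m2 m3 m4 continuous_on_subset[OF C21(2)[OF \<kappa>(1)] sub]
       continuous_on_subset[OF C21(3)[OF \<kappa>(1)] sub] continuous_on_subset[OF C21(4)[OF \<kappa>(1)] sub]
       continuous_on_subset[OF C21(5)[OF \<kappa>(1)] sub] m5 \<phi> c\<phi>' \<alpha>(2) r \<eta> m6,
       folded P_def, folded u_def, folded L_def]
  \<comment> \<open>The denominator in the bound on \<beta>. Since n \<ge> 1, completing the square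
    shows that it is positive.\<close>
  define B where "B = 4 * \<alpha>^2 - 4 * \<alpha> + 2 * n"
  have "B = (2 * \<alpha> - 1)^2 + (2 * n - 1)" by (simp add: B_def power2_eq_square algebra_simps)
  then have B: "B > 0" using n by (simp add: add_nonneg_pos)
  have "\<beta> \<le> - c * n * (1 + \<alpha>) / B" "- c * n * (1 + \<alpha>) / B < 0"
    using adm by (simp_all add: admissible_def B_def)
  then have \<beta>0: "\<beta> < 0" by linarith
  from \<open>\<beta> \<le> - c * n * (1 + \<alpha>) / B\<close> have \<beta>B: "\<beta> * B \<le> - c * n * (1 + \<alpha>)" using B by (simp add: field_simps)
  define A1 where "A1 = 2 * (1 - \<alpha>) / n"
  have A1: "A1 > 0" using \<alpha> n by (simp add: A1_def)
  have "2 * A1 * \<alpha> * \<beta> - 2 * \<beta> - c * (1 + \<alpha>) = (- (\<beta> * B) - c * n * (1 + \<alpha>)) / n"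
    using n by (simp add: A1_def B_def field_simps power2_eq_square)
  then have ad: "2 * A1 * \<alpha> * \<beta> - 2 * \<beta> - c * (1 + \<alpha>) \<ge> 0" using \<beta>B n by simp
  have u: "0 < u" "u < 1" using f01[OF p0, of t0] t0pos by (simp_all add: u_def in_chart_def p0y)
  have "Hm \<alpha> \<beta> \<phi> p0 t0 = L + \<alpha> * P + \<beta> * u + \<phi> t0"
    using Hm_eq[OF y0 t0pos] unfolding p0y L_def P_def[symmetric] unfolding u_def[symmetric] by (simp add: algebra_simps)
  then have neg1: "L + \<alpha> * P + \<beta> * u + \<phi> t0 < 0" using neg0 by simp
  show False
  proof (rule harnack_quadratic_contradiction[where A = A1 and L = L and P = P and u = u and \<phi> = "\<phi> t0"
        and \<phi>' = "\<phi>' t0" and \<alpha> = \<alpha> and \<beta> = \<beta> and c = c])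
    show "P \<ge> 0" by (rule lm(2))
    show "A1 * L^2 - c * u * L - P * u * (2 * \<beta> + c + 2 * \<alpha> * c) + \<beta> * c * u * (1 - u) + \<phi>' t0 \<le> 0"
      using lm(1) unfolding A1_def n_def .
    show "A1 * (\<beta> * u + \<phi> t0)^2 + c * u * (\<phi> t0 + \<beta>) + \<phi>' t0 \<ge> 0"
      using Q[OF t0a _ u] t0 unfolding A1_def by simp
    show "\<phi> t0 \<ge> - \<beta>" using \<phi>\<beta>[OF t0a] t0 by simp
  qed (rule A1 u \<alpha> c \<beta>0 ad neg1)+
qed

text \<open>As f is regular up to time 0 and M is compact, H without \<phi> is bounded below on M
  and [0, 1]; near time 0 the function \<phi> exceeds any such bound.\<close>

lemma initial_time:
  assumes \<phi>: "filterlim \<phi> at_top (at_right 0)" and T: "T > 0"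
  obtains a0 where "0 < a0" "a0 < T" "\<And>p. p \<in> topspace M \<Longrightarrow> Hm \<alpha> \<beta> \<phi> p a0 \<ge> 0"
proof (cases "topspace M = {}")
  \<comment> \<open>For empty M there is no minimum point, but any positive time below T will
    do.\<close>
  case True
  then show ?thesis using that[of "T / 2"] T by simp
next
  case False
  have cont: "continuous_on (chart_img \<kappa> \<times> {0..1}) (\<lambda>(y, t). Hm \<alpha> \<beta> (\<lambda>_. 0) (chart_inv \<kappa> y) t)" if "\<kappa> \<in> A" for \<kappa>
    by (rule Hm_continuous[OF that]) auto
  obtain p0 t0 where min: "\<And>q s. q \<in> topspace M \<Longrightarrow> s \<in> {0..1} \<Longrightarrow> Hm \<alpha> \<beta> (\<lambda>_. 0) p0 t0 \<le> Hm \<alpha> \<beta> (\<lambda>_. 0) q s"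
    by (rule attains_min_chartwise[OF cont]) (use False in auto)
  have "\<forall>\<^sub>F t in at_right 0. \<phi> t \<ge> - Hm \<alpha> \<beta> (\<lambda>_. 0) p0 t0"
    using \<phi> unfolding filterlim_at_top by blast
  moreover have "\<forall>\<^sub>F t in at_right 0. 0 < t \<and> t < min 1 T"
    using T by (auto simp: eventually_at_right_less eventually_conj_iff intro!: eventually_at_right_less eventually_at_rightI[of 0 "min 1 T"])
  ultimately have "\<forall>\<^sub>F t in at_right 0. \<phi> t \<ge> - Hm \<alpha> \<beta> (\<lambda>_. 0) p0 t0 \<and> 0 < t \<and> t < min 1 T"
    by eventually_elim auto
  then obtain a0 where a0: "\<phi> a0 \<ge> - Hm \<alpha> \<beta> (\<lambda>_. 0) p0 t0" "0 < a0" "a0 < min 1 T"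
    using eventually_happens'[of "at_right (0::real)"] by auto
  show ?thesis
  proof (rule that[of a0])
    fix p assume "p \<in> topspace M"
    then have "Hm \<alpha> \<beta> (\<lambda>_. 0) p0 t0 \<le> Hm \<alpha> \<beta> (\<lambda>_. 0) p a0" using min a0 by auto
    then show "Hm \<alpha> \<beta> \<phi> p a0 \<ge> 0" using a0(1) by (simp add: Hm_def)
  qed (use a0 in auto)
qed

end

section \<open>Piecewise \<open>C\<^sup>1\<close> curves\<close>

context closed_riemannian_manifold
begin

lemma curve_nhd:
  assumes "continuous_map (top_of_set {0..1}) M \<gamma>" "openin M U" "s \<in> {0..1::real}" "\<gamma> s \<in> U"
  obtains T where "open T" "s \<in> T" "\<And>s'. s' \<in> {0..1} \<inter> T \<Longrightarrow> \<gamma> s' \<in> U"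
proof -
  have "openin (top_of_set {0..1}) {x \<in> topspace (top_of_set {0..1}). \<gamma> x \<in> U}"
    by (rule openin_continuous_map_preimage[OF assms(1,2)])
  then obtain T where T: "open T" "{x \<in> {0..1}. \<gamma> x \<in> U} = {0..1} \<inter> T"
    by (auto simp: openin_open)
  then show ?thesis using that[of T] assms(3,4) by blast
qed

lemma curve_topspace: "continuous_map (top_of_set {0..1}) M \<gamma> \<Longrightarrow> s \<in> {0..1} \<Longrightarrow> \<gamma> s \<in> topspace M"
  by (auto simp: continuous_map_def)

lemma chart_curve_continuous:
  fixes \<gamma> :: "real \<Rightarrow> 'a"
  assumes \<gamma>: "continuous_map (top_of_set {0..1}) M \<gamma>" and s: "s \<in> {0..1}" and \<kappa>: "\<kappa> \<in> A" "\<gamma> s \<in> chart_dom \<kappa>"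
  shows "((\<lambda>s. chart_map \<kappa> (\<gamma> s)) \<longlongrightarrow> chart_map \<kappa> (\<gamma> s)) (at s within {0..1})"
proof (rule topological_tendstoI)
  fix B assume B: "open B" "chart_map \<kappa> (\<gamma> s) \<in> B"
  obtain T where T: "open T" "s \<in> T" "\<And>s'. s' \<in> {0..1} \<inter> T \<Longrightarrow> \<gamma> s' \<in> {p \<in> chart_dom \<kappa>. chart_map \<kappa> p \<in> B}"
    using curve_nhd[OF \<gamma> openin_chart_preimage[OF \<kappa>(1) B(1)] s] B(2) \<kappa>(2) by blast
  then show "\<forall>\<^sub>F s in at s within {0..1}. chart_map \<kappa> (\<gamma> s) \<in> B"
    unfolding eventually_at_topological by blast
qed

text \<open>Derivatives are taken within I, hence one-sided at its end points. This makes the speed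
  continuous on each closed piece of the curve; \<open>speed\<close> can differ from it at break
  points.\<close>

definition speed_on :: "real set \<Rightarrow> (real \<Rightarrow> 'a) \<Rightarrow> real \<Rightarrow> real" where
  "speed_on I \<gamma> s = (let \<kappa> = chart_at A (\<gamma> s); v = vector_derivative (chart_map \<kappa> \<circ> \<gamma>) (at s within I)
      in sqrt (v \<bullet> (g \<kappa> (chart_map \<kappa> (\<gamma> s)) *v v)))"

lemma C1_curve_deriv:
  assumes "C1_curve_on A I \<gamma>" "\<kappa> \<in> A" "s \<in> I" "\<gamma> s \<in> chart_dom \<kappa>"
  shows "(chart_map \<kappa> \<circ> \<gamma> has_vector_derivative vector_derivative (chart_map \<kappa> \<circ> \<gamma>) (at s within I)) (at s within I)"
  using assms unfolding C1_curve_on_def Let_def by (auto simp: vector_derivative_works)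

lemma curve_change_of_chart:
  assumes \<gamma>: "continuous_map (top_of_set {0..1}) M \<gamma>" and I: "I \<subseteq> {0..1}" "s \<in> I"
    and \<kappa>: "\<kappa> \<in> A" "\<kappa>' \<in> A" "\<gamma> s \<in> chart_dom \<kappa>" "\<gamma> s \<in> chart_dom \<kappa>'"
    and v: "(chart_map \<kappa> \<circ> \<gamma> has_vector_derivative v) (at s within I)"
  shows "(chart_map \<kappa>' \<circ> \<gamma> has_vector_derivative jac (transition \<kappa> \<kappa>') (chart_map \<kappa> (\<gamma> s)) *v v) (at s within I)"
proof -
  define J where "J = jac (transition \<kappa> \<kappa>') (chart_map \<kappa> (\<gamma> s))"
  have "chart_map \<kappa> (\<gamma> s) \<in> overlap \<kappa> \<kappa>'" using \<kappa> by (simp add: overlap_def)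
  from has_derivative_jac[OF transition_diff[OF \<kappa>(1,2) this]]
  have "(transition \<kappa> \<kappa>' has_derivative (\<lambda>v. J *v v)) (at ((chart_map \<kappa> \<circ> \<gamma>) s))" by (simp add: J_def)
  from has_derivative_compose[OF v[unfolded has_vector_derivative_def] this]
  have 1: "((\<lambda>s. transition \<kappa> \<kappa>' ((chart_map \<kappa> \<circ> \<gamma>) s)) has_derivative (\<lambda>x. x *\<^sub>R (J *v v))) (at s within I)"
    by (simp add: matrix_vector_mult_scaleR)
  obtain T where T: "open T" "s \<in> T" "\<And>s'. s' \<in> {0..1} \<inter> T \<Longrightarrow> \<gamma> s' \<in> chart_dom \<kappa>"
    using curve_nhd[OF \<gamma> chart_dom_open[OF \<kappa>(1)], of s] I \<kappa>(3) by blast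
  have eq: "transition \<kappa> \<kappa>' ((chart_map \<kappa> \<circ> \<gamma>) s') = (chart_map \<kappa>' \<circ> \<gamma>) s'" if "s' \<in> I \<inter> T" for s'
    using transition_map[OF \<kappa>(1) T(3), of s' \<kappa>'] that I by auto
  have "\<forall>\<^sub>F s' in at s within I. transition \<kappa> \<kappa>' ((chart_map \<kappa> \<circ> \<gamma>) s') = (chart_map \<kappa>' \<circ> \<gamma>) s'"
    unfolding eventually_at_topological using T(1,2) eq by blast
  from has_derivative_transform_eventually[OF 1 this _ I(2)] eq[of s] I T(2)
  show ?thesis unfolding has_vector_derivative_def J_def by (simp add: o_def)
qed

text \<open>Under a change of chart the velocity is multiplied by the Jacobian of the transition,
  and the transformation law of the metric compensates for it. So the chosen chart may be replaced
  by any other.\<close>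

lemma speed_on_chart:
  assumes \<gamma>: "continuous_map (top_of_set {0..1}) M \<gamma>" and C1: "C1_curve_on A {a..b} \<gamma>"
    and ab: "a < b" "{a..b} \<subseteq> {0..1}" "s \<in> {a..b}" and \<kappa>: "\<kappa> \<in> A" "\<gamma> s \<in> chart_dom \<kappa>"
    and v: "v = vector_derivative (chart_map \<kappa> \<circ> \<gamma>) (at s within {a..b})"
  shows "speed_on {a..b} \<gamma> s = sqrt (v \<bullet> (g \<kappa> (chart_map \<kappa> (\<gamma> s)) *v v))"
proof -
  define \<kappa>' where "\<kappa>' = chart_at A (\<gamma> s)"
  have \<kappa>': "\<kappa>' \<in> A" "\<gamma> s \<in> chart_dom \<kappa>'"
    unfolding \<kappa>'_def using chart_at curve_topspace[OF \<gamma>] ab by blast+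
  define J where "J = jac (transition \<kappa> \<kappa>') (chart_map \<kappa> (\<gamma> s))"
  have "(chart_map \<kappa> \<circ> \<gamma> has_vector_derivative v) (at s within {a..b})"
    unfolding v by (rule C1_curve_deriv[OF C1 \<kappa>(1) ab(3) \<kappa>(2)])
  from curve_change_of_chart[OF \<gamma> ab(2,3) \<kappa>(1) \<kappa>'(1) \<kappa>(2) \<kappa>'(2) this]
  have "vector_derivative (chart_map \<kappa>' \<circ> \<gamma>) (at s within {a..b}) = J *v v"
    unfolding J_def by (rule vector_derivative_within_closed_interval[OF ab(1,3)])
  then have "speed_on {a..b} \<gamma> s = sqrt ((J *v v) \<bullet> (g \<kappa>' (chart_map \<kappa>' (\<gamma> s)) *v (J *v v)))"
    unfolding speed_on_def \<kappa>'_def[symmetric] Let_def by simp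
  also have "(J *v v) \<bullet> (g \<kappa>' (chart_map \<kappa>' (\<gamma> s)) *v (J *v v)) = v \<bullet> (transpose J *v (g \<kappa>' (chart_map \<kappa>' (\<gamma> s)) *v (J *v v)))"
    by (simp only: inner_transpose_vector)
  also have "\<dots> = v \<bullet> (g \<kappa> (chart_map \<kappa> (\<gamma> s)) *v v)"
    unfolding metric_jac[OF \<kappa>(1) \<kappa>'(1) \<kappa>(2) \<kappa>'(2)] J_def by (simp only: matrix_vector_mul_assoc matrix_mul_assoc)
  finally show ?thesis .
qed

text \<open>The chart selected by \<open>chart_at\<close> may jump along the curve. Near a given
  parameter one fixed chart is used instead, in which all ingredients are continuous.\<close>

lemma speed_on_continuous:
  assumes \<gamma>: "continuous_map (top_of_set {0..1}) M \<gamma>" and C1: "C1_curve_on A {a..b} \<gamma>"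
    and ab: "a < b" "{a..b} \<subseteq> {0..1}"
  shows "continuous_on {a..b} (speed_on {a..b} \<gamma>)"
  unfolding continuous_on_eq_continuous_within
proof
  fix s assume s: "s \<in> {a..b}"
  then have s01: "s \<in> {0..1}" using ab by blast
  obtain \<kappa> where \<kappa>: "\<kappa> \<in> A" "\<gamma> s \<in> chart_dom \<kappa>" using charts_cover curve_topspace[OF \<gamma> s01] by blast
  interpret chart_metric "chart_img \<kappa>" "g \<kappa>" by (rule chart_metric[OF \<kappa>(1)])
  obtain T where T: "open T" "s \<in> T" "\<And>s'. s' \<in> {0..1} \<inter> T \<Longrightarrow> \<gamma> s' \<in> chart_dom \<kappa>"
    using curve_nhd[OF \<gamma> chart_dom_open[OF \<kappa>(1)] s01 \<kappa>(2)] by blast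
  define v where "v s = vector_derivative (chart_map \<kappa> \<circ> \<gamma>) (at s within {a..b})" for s
  define J where "J = {s \<in> {a..b}. \<gamma> s \<in> chart_dom \<kappa>}"
  have sub: "{a..b} \<inter> T \<subseteq> J" using T(3) ab by (auto simp: J_def)
  have cv: "continuous_on J v"
    using C1 \<kappa>(1) unfolding C1_curve_on_def Let_def J_def v_def by blast
  have "continuous_on J (\<lambda>s. chart_map \<kappa> (\<gamma> s))"
    unfolding continuous_on_def
  proof
    fix x assume "x \<in> J"
    then have "x \<in> {0..1}" "\<gamma> x \<in> chart_dom \<kappa>" using ab by (auto simp: J_def)
    then show "((\<lambda>s. chart_map \<kappa> (\<gamma> s)) \<longlongrightarrow> chart_map \<kappa> (\<gamma> x)) (at x within J)"
      by (intro tendsto_within_subset[OF chart_curve_continuous[OF \<gamma> _ \<kappa>(1)]]) (use ab in \<open>auto simp: J_def\<close>)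
  qed
  then have cg: "continuous_on J (\<lambda>s. g \<kappa> (chart_map \<kappa> (\<gamma> s)))"
    by (rule continuous_on_compose2[OF C1_on_continuous[OF h_C1]]) (auto simp: J_def chart_map_img)
  have "continuous_on J (\<lambda>s. sqrt (v s \<bullet> (g \<kappa> (chart_map \<kappa> (\<gamma> s)) *v v s)))"
    by (intro continuous_intros continuous_on_matrix_vector cv cg)
  then have "continuous_on ({a..b} \<inter> T) (\<lambda>s. sqrt (v s \<bullet> (g \<kappa> (chart_map \<kappa> (\<gamma> s)) *v v s)))"
    using sub by (rule continuous_on_subset)
  then have "continuous_on ({a..b} \<inter> T) (speed_on {a..b} \<gamma>)"
  proof (rule continuous_on_cong[THEN iffD1, OF refl, rotated])
    fix x assume "x \<in> {a..b} \<inter> T"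
    then show "sqrt (v x \<bullet> (g \<kappa> (chart_map \<kappa> (\<gamma> x)) *v v x)) = speed_on {a..b} \<gamma> x"
      using speed_on_chart[OF \<gamma> C1 ab _ \<kappa>(1) _ v_def] sub by (auto simp: J_def)
  qed
  then have "continuous (at s within ({a..b} \<inter> T)) (speed_on {a..b} \<gamma>)"
    using s T(2) by (simp add: continuous_on_eq_continuous_within)
  moreover have "at s within ({a..b} \<inter> T) = at s within {a..b}"
    by (rule at_within_nhd[OF T(2,1)]) auto
  ultimately show "continuous (at s within {a..b}) (speed_on {a..b} \<gamma>)" by simp
qed

lemma speed_interior: "a < s \<Longrightarrow> s < b \<Longrightarrow> speed A g \<gamma> s = speed_on {a..b} \<gamma> s"
  by (simp add: speed_def speed_on_def at_within_Icc_at)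

lemma speed_nonneg:
  assumes "continuous_map (top_of_set {0..1}) M \<gamma>" "s \<in> {0..1}"
  shows "speed A g \<gamma> s \<ge> 0"
proof -
  define \<kappa> where "\<kappa> = chart_at A (\<gamma> s)"
  have \<kappa>: "\<kappa> \<in> A" "\<gamma> s \<in> chart_dom \<kappa>"
    unfolding \<kappa>_def using chart_at curve_topspace[OF assms] by blast+
  have "v \<bullet> (g \<kappa> (chart_map \<kappa> (\<gamma> s)) *v v) \<ge> 0" for v
    using metric_pos[OF \<kappa>(1) chart_map_img[OF \<kappa>(2)], of v] by (cases "v = 0") auto
  then show ?thesis unfolding speed_def \<kappa>_def[symmetric] Let_def by simp
qed

text \<open>The two speeds agree on the open interval, and integrals ignore the end points.\<close>

lemma speed_piece:
  assumes \<gamma>: "continuous_map (top_of_set {0..1}) M \<gamma>" and C1: "C1_curve_on A {a..b} \<gamma>"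
    and ab: "a < b" "{a..b} \<subseteq> {0..1}" and s: "s \<in> {a..b}"
  shows "speed A g \<gamma> integrable_on {a..s}" "integral {a..s} (speed A g \<gamma>) = integral {a..s} (speed_on {a..b} \<gamma>)"
proof -
  have "continuous_on {a..s} (speed_on {a..b} \<gamma>)"
    using speed_on_continuous[OF \<gamma> C1 ab] s by (auto intro: continuous_on_subset)
  then have "speed_on {a..b} \<gamma> integrable_on {a..s}" by (rule integrable_continuous_real)
  then show "speed A g \<gamma> integrable_on {a..s}"
    by (rule integrable_spike_finite[of "{a, b}", rotated 2]) (use s in \<open>auto intro!: speed_interior\<close>)
  show "integral {a..s} (speed A g \<gamma>) = integral {a..s} (speed_on {a..b} \<gamma>)"
    by (rule integral_spike[of "{a, b}"]) (use s in \<open>auto intro!: speed_interior[symmetric]\<close>)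
qed

lemma partition_bounds:
  fixes \<tau> :: "nat \<Rightarrow> real"
  assumes "\<tau> 0 = 0" "\<tau> m = 1" "\<And>i. i < m \<Longrightarrow> \<tau> i < \<tau> (Suc i)" "i \<le> m"
  shows "0 \<le> \<tau> i" "\<tau> i \<le> 1"
proof -
  show "0 \<le> \<tau> i" using \<open>i \<le> m\<close>
  proof (induction i)
    case (Suc i)
    then show ?case using assms(3)[of i] by simp
  qed (simp add: assms)
  show "\<tau> i \<le> 1" using \<open>i \<le> m\<close>
  proof (induction rule: inc_induct)
    case (step i)
    then show ?case using assms(3)[of i] by simp
  qed (simp add: assms)
qed

lemma speed_integrable:
  assumes "piecewise_C1_curve M A \<gamma>"
  shows "speed A g \<gamma> integrable_on {0..1}"
proof -
  obtain m \<tau> where \<gamma>: "continuous_map (top_of_set {0..1}) M \<gamma>" and \<tau>: "\<tau> 0 = 0" "\<tau> m = 1"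
    "\<And>i. i < m \<Longrightarrow> \<tau> i < \<tau> (Suc i)" "\<And>i. i < m \<Longrightarrow> C1_curve_on A {\<tau> i..\<tau> (Suc i)} \<gamma>"
    using assms unfolding piecewise_C1_curve_def by blast
  note bounds = partition_bounds[of \<tau>, OF \<tau>(1,2,3)]
  have "speed A g \<gamma> integrable_on {0..\<tau> i}" if "i \<le> m" for i
    using that
  proof (induction i)
    case 0
    then show ?case using integrable_on_refl[of "speed A g \<gamma>" 0] by (simp add: \<tau>)
  next
    case (Suc i)
    have "speed A g \<gamma> integrable_on {\<tau> i..\<tau> (Suc i)}"
      by (rule speed_piece(1)[OF \<gamma> \<tau>(4) \<tau>(3)]) (use Suc bounds[of i] bounds[of "Suc i"] \<tau>(3)[of i] in auto)
    with Suc show ?case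
      using bounds[of i] \<tau>(3)[of i] by (intro Henstock_Kurzweil_Integration.integrable_combine[of 0 "\<tau> i" "\<tau> (Suc i)"]) auto
  qed
  from this[of m] show ?thesis by (simp add: \<tau>)
qed

section \<open>Joining points of the manifold by curves\<close>

lemma C1_curve_on_cong:
  assumes eq: "\<And>s. s \<in> I \<Longrightarrow> \<gamma> s = \<gamma>' s"
  shows "C1_curve_on A I \<gamma> \<Longrightarrow> C1_curve_on A I \<gamma>'"
proof -
  have d: "((chart_map \<kappa> \<circ> \<gamma>) has_vector_derivative v) (at s within I) \<longleftrightarrow> ((chart_map \<kappa> \<circ> \<gamma>') has_vector_derivative v) (at s within I)"
    if "s \<in> I" for s \<kappa> v
    unfolding has_vector_derivative_def using has_derivative_transform[OF that, of "chart_map \<kappa> \<circ> \<gamma>" "chart_map \<kappa> \<circ> \<gamma>'"]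
      has_derivative_transform[OF that, of "chart_map \<kappa> \<circ> \<gamma>'" "chart_map \<kappa> \<circ> \<gamma>"] eq by auto
  have vd: "vector_derivative (chart_map \<kappa> \<circ> \<gamma>) (at s within I) = vector_derivative (chart_map \<kappa> \<circ> \<gamma>') (at s within I)"
    if "s \<in> I" for s \<kappa>
    unfolding vector_derivative_def d[OF that] ..
  assume C1: "C1_curve_on A I \<gamma>"
  have J: "{s \<in> I. \<gamma>' s \<in> chart_dom \<kappa>} = {s \<in> I. \<gamma> s \<in> chart_dom \<kappa>}" for \<kappa> using eq by auto
  show "C1_curve_on A I \<gamma>'"
    unfolding C1_curve_on_def Let_def J
  proof (intro ballI conjI)
    fix \<kappa> assume \<kappa>: "\<kappa> \<in> A"
    { fix s assume s: "s \<in> {s \<in> I. \<gamma> s \<in> chart_dom \<kappa>}"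
      then show "(chart_map \<kappa> \<circ> \<gamma>') differentiable (at s within I)"
        using C1_curve_deriv[OF C1 \<kappa>, of s] d[of s \<kappa>] by (auto intro: differentiableI_vector) }
    have "continuous_on {s \<in> I. \<gamma> s \<in> chart_dom \<kappa>} (\<lambda>s. vector_derivative (chart_map \<kappa> \<circ> \<gamma>) (at s within I))"
      using C1 \<kappa> unfolding C1_curve_on_def Let_def by blast
    then show "continuous_on {s \<in> I. \<gamma> s \<in> chart_dom \<kappa>} (\<lambda>s. vector_derivative (chart_map \<kappa> \<circ> \<gamma>') (at s within I))"
      by (rule continuous_on_cong[THEN iffD1, OF refl, rotated]) (simp add: vd)
  qed
qed

lemma C1_curve_on_double:
  assumes C1: "C1_curve_on A {a..b} \<gamma>" and ab: "a < b"
  shows "C1_curve_on A {a / 2..b / 2} (\<lambda>s. \<gamma> (2 * s))"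
  unfolding C1_curve_on_def Let_def
proof (intro ballI conjI)
  fix \<kappa> assume \<kappa>: "\<kappa> \<in> A"
  define v where "v s = vector_derivative (chart_map \<kappa> \<circ> \<gamma>) (at s within {a..b})" for s
  have img: "(\<lambda>s. 2 * s) ` {a / 2..b / 2} = {a..b}"
    by (auto simp: image_iff intro!: bexI[of _ "_ / 2"])
  have d: "((chart_map \<kappa> \<circ> (\<lambda>s. \<gamma> (2 * s))) has_vector_derivative 2 *\<^sub>R v (2 * s)) (at s within {a / 2..b / 2})"
    if s: "s \<in> {a / 2..b / 2}" "\<gamma> (2 * s) \<in> chart_dom \<kappa>" for s
  proof -
    have 1: "((\<lambda>s. 2 * s) has_vector_derivative 2) (at s within {a / 2..b / 2})"
      by (auto intro!: derivative_eq_intros simp: has_vector_derivative_def)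
    have "(chart_map \<kappa> \<circ> \<gamma> has_vector_derivative v (2 * s)) (at (2 * s) within (\<lambda>s. 2 * s) ` {a / 2..b / 2})"
      unfolding img v_def by (rule C1_curve_deriv[OF C1 \<kappa>]) (use s in auto)
    from vector_diff_chain_within[OF 1 this] show ?thesis by (simp add: o_def)
  qed
  have vd: "vector_derivative (chart_map \<kappa> \<circ> (\<lambda>s. \<gamma> (2 * s))) (at s within {a / 2..b / 2}) = 2 *\<^sub>R v (2 * s)"
    if "s \<in> {a / 2..b / 2}" "\<gamma> (2 * s) \<in> chart_dom \<kappa>" for s
    using d[OF that] by (rule vector_derivative_within_closed_interval[rotated 2]) (use ab that in auto)
  { fix s assume "s \<in> {s \<in> {a / 2..b / 2}. \<gamma> (2 * s) \<in> chart_dom \<kappa>}"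
    then show "(chart_map \<kappa> \<circ> (\<lambda>s. \<gamma> (2 * s))) differentiable (at s within {a / 2..b / 2})"
      using d by (blast intro: differentiableI_vector) }
  have "continuous_on {s \<in> {a..b}. \<gamma> s \<in> chart_dom \<kappa>} v"
    using C1 \<kappa> unfolding C1_curve_on_def Let_def v_def by blast
  then have "continuous_on {s \<in> {a / 2..b / 2}. \<gamma> (2 * s) \<in> chart_dom \<kappa>} (\<lambda>s. v (2 * s))"
    by (rule continuous_on_compose2) (auto intro!: continuous_intros)
  then have "continuous_on {s \<in> {a / 2..b / 2}. \<gamma> (2 * s) \<in> chart_dom \<kappa>} (\<lambda>s. 2 *\<^sub>R v (2 * s))"
    by (intro continuous_intros)
  then show "continuous_on {s \<in> {a / 2..b / 2}. \<gamma> (2 * s) \<in> chart_dom \<kappa>}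
      (\<lambda>s. vector_derivative (chart_map \<kappa> \<circ> (\<lambda>s. \<gamma> (2 * s))) (at s within {a / 2..b / 2}))"
    by (rule continuous_on_cong[THEN iffD1, OF refl, rotated]) (simp add: vd)
qed

lemma C1_curve_on_segment:
  fixes q w :: "real^'n"
  assumes \<kappa>: "\<kappa> \<in> A" and ab: "a < b" and img: "\<And>s. s \<in> {a..b} \<Longrightarrow> q + s *\<^sub>R w \<in> chart_img \<kappa>"
  shows "C1_curve_on A {a..b} (\<lambda>s. chart_inv \<kappa> (q + s *\<^sub>R w))"
  unfolding C1_curve_on_def Let_def
proof (intro ballI conjI)
  fix \<kappa>' assume \<kappa>': "\<kappa>' \<in> A"
  have eq: "chart_map \<kappa>' \<circ> (\<lambda>s. chart_inv \<kappa> (q + s *\<^sub>R w)) = (\<lambda>s. transition \<kappa> \<kappa>' (q + s *\<^sub>R w))"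
    by (simp add: fun_eq_iff transition_def)
  define J where "J = {s \<in> {a..b}. chart_inv \<kappa> (q + s *\<^sub>R w) \<in> chart_dom \<kappa>'}"
  have ov: "q + s *\<^sub>R w \<in> overlap \<kappa> \<kappa>'" if "s \<in> J" for s
  proof -
    have i: "q + s *\<^sub>R w \<in> chart_img \<kappa>" using img that by (simp add: J_def)
    then have "chart_inv \<kappa> (q + s *\<^sub>R w) \<in> chart_dom \<kappa> \<inter> chart_dom \<kappa>'" using that chart_inv_dom[OF i] by (simp add: J_def)
    then show ?thesis unfolding overlap_def using chart_map_inv[OF i] by (metis imageI)
  qed
  have d: "((\<lambda>s. transition \<kappa> \<kappa>' (q + s *\<^sub>R w)) has_vector_derivative jac (transition \<kappa> \<kappa>') (q + s *\<^sub>R w) *v w) (at s within {a..b})"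
    if "s \<in> J" for s
    by (rule has_vector_derivative_at_within, rule line_has_derivative, rule has_derivative_jac,
        rule transition_diff[OF \<kappa> \<kappa>' ov[OF that]])
  have vd: "vector_derivative (\<lambda>s. transition \<kappa> \<kappa>' (q + s *\<^sub>R w)) (at s within {a..b}) = jac (transition \<kappa> \<kappa>') (q + s *\<^sub>R w) *v w"
    if "s \<in> J" for s
    using d[OF that] by (rule vector_derivative_within_closed_interval[rotated 2]) (use ab that in \<open>auto simp: J_def\<close>)
  { fix s assume "s \<in> {s \<in> {a..b}. chart_inv \<kappa> (q + s *\<^sub>R w) \<in> chart_dom \<kappa>'}"
    then show "(chart_map \<kappa>' \<circ> (\<lambda>s. chart_inv \<kappa> (q + s *\<^sub>R w))) differentiable (at s within {a..b})"
      unfolding eq J_def[symmetric] using d by (blast intro: differentiableI_vector) }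
  have "continuous_on (overlap \<kappa> \<kappa>') (jac (transition \<kappa> \<kappa>'))"
    unfolding jac_def[abs_def] using transition_Ck[OF \<kappa> \<kappa>', of "Suc 0"]
    by (intro continuous_on_vec_lambda continuous_on_component) auto
  then have "continuous_on J (\<lambda>s. jac (transition \<kappa> \<kappa>') (q + s *\<^sub>R w))"
    by (rule continuous_on_compose2) (auto intro!: continuous_intros ov)
  then have "continuous_on J (\<lambda>s. jac (transition \<kappa> \<kappa>') (q + s *\<^sub>R w) *v w)"
    by (intro continuous_on_matrix_vector continuous_on_const)
  then show "continuous_on {s \<in> {a..b}. chart_inv \<kappa> (q + s *\<^sub>R w) \<in> chart_dom \<kappa>'}
      (\<lambda>s. vector_derivative (chart_map \<kappa>' \<circ> (\<lambda>s. chart_inv \<kappa> (q + s *\<^sub>R w))) (at s within {a..b}))"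
    unfolding eq J_def[symmetric]
    by (rule continuous_on_cong[THEN iffD1, OF refl, rotated]) (simp add: vd)
qed

lemma chart_inv_continuous: "\<kappa> \<in> A \<Longrightarrow> continuous_map (top_of_set (chart_img \<kappa>)) M (chart_inv \<kappa>)"
  unfolding continuous_map_def
proof (intro conjI allI impI)
  assume \<kappa>: "\<kappa> \<in> A"
  show "chart_inv \<kappa> \<in> topspace (top_of_set (chart_img \<kappa>)) \<rightarrow> topspace M"
    using chart_inv_topspace[OF \<kappa>] by auto
  fix U assume U: "openin M U"
  have "{x \<in> topspace (top_of_set (chart_img \<kappa>)). chart_inv \<kappa> x \<in> U} = chart_map \<kappa> ` (U \<inter> chart_dom \<kappa>)"
  proof (intro equalityI subsetI)
    fix x assume "x \<in> {x \<in> topspace (top_of_set (chart_img \<kappa>)). chart_inv \<kappa> x \<in> U}"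
    then have x: "x \<in> chart_img \<kappa>" "chart_inv \<kappa> x \<in> U" by auto
    show "x \<in> chart_map \<kappa> ` (U \<inter> chart_dom \<kappa>)"
      by (rule image_eqI[of _ _ "chart_inv \<kappa> x"]) (simp_all add: chart_map_inv[OF x(1)] chart_inv_dom[OF x(1)] x(2))
  next
    fix x assume "x \<in> chart_map \<kappa> ` (U \<inter> chart_dom \<kappa>)"
    then obtain p where "x = chart_map \<kappa> p" "p \<in> U" "p \<in> chart_dom \<kappa>" by blast
    then show "x \<in> {x \<in> topspace (top_of_set (chart_img \<kappa>)). chart_inv \<kappa> x \<in> U}"
      by (simp add: chart_inv_map[OF \<kappa>] chart_map_img)
  qed
  moreover have "openin (top_of_set (chart_img \<kappa>)) (chart_map \<kappa> ` (U \<inter> chart_dom \<kappa>))"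
    using U chart_dom_open[OF \<kappa>] by (intro open_subset open_chart_image[OF \<kappa>]) (auto simp: chart_img_def)
  ultimately show "openin (top_of_set (chart_img \<kappa>)) {x \<in> topspace (top_of_set (chart_img \<kappa>)). chart_inv \<kappa> x \<in> U}"
    by simp
qed

text \<open>The given curve is traversed at double speed and followed by a straight segment in
  coordinates, which the convex set B keeps inside the chart.\<close>

lemma piecewise_C1_curve_extend:
  assumes \<gamma>: "piecewise_C1_curve M A \<gamma>" and \<kappa>: "\<kappa> \<in> A" and q: "\<gamma> 1 \<in> chart_dom \<kappa>" "q' \<in> chart_dom \<kappa>"
    and B: "convex B" "B \<subseteq> chart_img \<kappa>" "chart_map \<kappa> (\<gamma> 1) \<in> B" "chart_map \<kappa> q' \<in> B"
  obtains \<gamma>' where "piecewise_C1_curve M A \<gamma>'" "\<gamma>' 0 = \<gamma> 0" "\<gamma>' 1 = q'"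
proof -
  obtain m \<tau> where c\<gamma>: "continuous_map (top_of_set {0..1}) M \<gamma>" and \<tau>: "\<tau> 0 = 0" "\<tau> m = 1"
    "\<And>i. i < m \<Longrightarrow> \<tau> i < \<tau> (Suc i)" "\<And>i. i < m \<Longrightarrow> C1_curve_on A {\<tau> i..\<tau> (Suc i)} \<gamma>"
    using \<gamma> unfolding piecewise_C1_curve_def by blast
  note bounds = partition_bounds[of \<tau>, OF \<tau>(1,2,3)]
  \<comment> \<open>\<open>w\<close> and \<open>y\<close> are chosen so that y + s w is the
    coordinate of the old end point at s = 1/2 and that of q' at s = 1.\<close>
  define w where "w = 2 *\<^sub>R (chart_map \<kappa> q' - chart_map \<kappa> (\<gamma> 1))"
  define y where "y = chart_map \<kappa> (\<gamma> 1) - (1/2) *\<^sub>R w"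
  define \<gamma>2 where "\<gamma>2 s = chart_inv \<kappa> (y + s *\<^sub>R w)" for s :: real
  define \<gamma>' where "\<gamma>' s = (if s \<le> 1/2 then \<gamma> (2 * s) else \<gamma>2 s)" for s :: real
  have seg: "y + s *\<^sub>R w \<in> chart_img \<kappa>" if "s \<in> {1/2..1}" for s
  proof -
    have "y + s *\<^sub>R w = (2 - 2 * s) *\<^sub>R chart_map \<kappa> (\<gamma> 1) + (2 * s - 1) *\<^sub>R chart_map \<kappa> q'"
      by (simp add: y_def w_def vec_eq_iff algebra_simps)
    also have "\<dots> \<in> B" using that by (intro convexD[OF B(1,3,4)]) auto
    finally show ?thesis using B(2) by blast
  qed
  have half: "\<gamma>2 (1/2) = \<gamma> 1" by (simp add: \<gamma>2_def y_def chart_inv_map[OF \<kappa> q(1)])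
  have end1: "\<gamma>2 1 = q'"
  proof -
    have "y + 1 *\<^sub>R w = chart_map \<kappa> q'"
      by (simp add: y_def w_def vec_eq_iff algebra_simps)
    then show ?thesis by (simp add: \<gamma>2_def chart_inv_map[OF \<kappa> q(2)])
  qed
  have "continuous_map (top_of_set {0..1}) M \<gamma>'"
    unfolding \<gamma>'_def
  proof (rule continuous_map_cases_le)
    show "continuous_map (top_of_set {0..1}) euclideanreal (\<lambda>s. s)" by (simp add: continuous_map_iff_continuous)
    show "continuous_map (top_of_set {0..1}) euclideanreal (\<lambda>s. 1/2)" by simp
    have e: "subtopology (top_of_set {0..1}) {x \<in> topspace (top_of_set {0..1}). x \<le> 1/2} = top_of_set {0..1/2::real}"
      by (simp add: subtopology_subtopology) (rule arg_cong[where f = top_of_set], auto)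
    have "continuous_map (top_of_set {0..1/2}) (top_of_set {0..1}) (\<lambda>s::real. 2 * s)"
      by (auto intro!: continuous_intros)
    from continuous_map_compose[OF this c\<gamma>]
    show "continuous_map (subtopology (top_of_set {0..1}) {x \<in> topspace (top_of_set {0..1}). x \<le> 1/2}) M (\<lambda>s. \<gamma> (2 * s))"
      unfolding e by (simp add: o_def)
    have e2: "subtopology (top_of_set {0..1}) {x \<in> topspace (top_of_set {0..1}). 1/2 \<le> x} = top_of_set {1/2..1::real}"
      by (simp add: subtopology_subtopology) (rule arg_cong[where f = top_of_set], auto)
    have "continuous_map (top_of_set {1/2..1}) (top_of_set (chart_img \<kappa>)) (\<lambda>s::real. y + s *\<^sub>R w)"
      using seg by (auto intro!: continuous_intros)
    from continuous_map_compose[OF this chart_inv_continuous[OF \<kappa>]]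
    show "continuous_map (subtopology (top_of_set {0..1}) {x \<in> topspace (top_of_set {0..1}). 1/2 \<le> x}) M \<gamma>2"
      unfolding e2 \<gamma>2_def by (simp add: o_def)
    show "\<gamma> (2 * s) = \<gamma>2 s" if "s = 1/2" for s
      unfolding that half by simp
  qed
  moreover have "\<exists>m::nat. \<exists>\<tau>::nat \<Rightarrow> real. \<tau> 0 = 0 \<and> \<tau> m = 1 \<and>
        (\<forall>i<m. \<tau> i < \<tau> (Suc i) \<and> C1_curve_on A {\<tau> i..\<tau> (Suc i)} \<gamma>')"
  \<comment> \<open>The halved old partition ends at 1/2 with index m; the index m + 1 gets the new
    end point 1.\<close>
  proof (intro exI[of _ "Suc m"] exI[of _ "\<lambda>i. if i \<le> m then \<tau> i / 2 else 1"] conjI allI impI)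
    fix i assume i: "i < Suc m"
    let ?\<tau> = "\<lambda>i. if i \<le> m then \<tau> i / 2 else (1::real)"
    show "?\<tau> i < ?\<tau> (Suc i)" using i \<tau>(2) \<tau>(3)[of i] by (auto simp: less_Suc_eq)
    show "C1_curve_on A {?\<tau> i..?\<tau> (Suc i)} \<gamma>'"
    proof (cases "i < m")
      case True
      have "C1_curve_on A {\<tau> i / 2..\<tau> (Suc i) / 2} (\<lambda>s. \<gamma> (2 * s))"
        by (rule C1_curve_on_double[OF \<tau>(4)[OF True] \<tau>(3)[OF True]])
      then have "C1_curve_on A {\<tau> i / 2..\<tau> (Suc i) / 2} \<gamma>'"
        by (rule C1_curve_on_cong[rotated]) (use True bounds(2)[of "Suc i"] in \<open>auto simp: \<gamma>'_def\<close>)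
      then show ?thesis using True by simp
    next
      case False
      then have im: "i = m" using i by simp
      have "C1_curve_on A {1/2..1} (\<lambda>s. chart_inv \<kappa> (y + s *\<^sub>R w))"
        by (rule C1_curve_on_segment[OF \<kappa> _ seg]) auto
      then have "C1_curve_on A {1/2..1} \<gamma>'"
      proof (rule C1_curve_on_cong[rotated])
        fix s :: real assume "s \<in> {1/2..1}"
        have "\<gamma>2 s = \<gamma>' s"
        proof (cases "s = 1/2")
          case True
          show ?thesis unfolding True \<gamma>'_def half by simp
        next
          case False
          then show ?thesis using \<open>s \<in> {1/2..1}\<close> by (auto simp: \<gamma>'_def)
        qed
        then show "chart_inv \<kappa> (y + s *\<^sub>R w) = \<gamma>' s" by (simp add: \<gamma>2_def)
      qed
      then show ?thesis using im \<tau>(2) by simp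
    qed
  qed (use \<tau> in auto)
  ultimately have "piecewise_C1_curve M A \<gamma>'" unfolding piecewise_C1_curve_def by blast
  then show ?thesis using that[of \<gamma>'] end1 by (simp add: \<gamma>'_def)
qed

text \<open>In a coordinate ball, one point can be reached from x1 if and only if all can. So the
  set of reachable points is open and closed, and M is connected. The lemma ensures that the infimum
  in \<open>geodesic_dist\<close> is taken over a nonempty set.\<close>

lemma piecewise_C1_curve_exists:
  assumes x: "x1 \<in> topspace M" "x2 \<in> topspace M"
  shows "\<exists>\<gamma>. piecewise_C1_curve M A \<gamma> \<and> \<gamma> 0 = x1 \<and> \<gamma> 1 = x2"
proof -
  define S where "S = {q \<in> topspace M. \<exists>\<gamma>. piecewise_C1_curve M A \<gamma> \<and> \<gamma> 0 = x1 \<and> \<gamma> 1 = q}"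
  have nbhd: "\<exists>U. openin M U \<and> p \<in> U \<and> (\<forall>q\<in>U. \<forall>q'\<in>U. q \<in> S \<longrightarrow> q' \<in> S)" if p: "p \<in> topspace M" for p
  proof -
    obtain \<kappa> where \<kappa>: "\<kappa> \<in> A" "p \<in> chart_dom \<kappa>" using p charts_cover by blast
    obtain r where r: "r > 0" "ball (chart_map \<kappa> p) r \<subseteq> chart_img \<kappa>"
      using openE[OF chart_img_open[OF \<kappa>(1)] chart_map_img[OF \<kappa>(2)]] by blast
    let ?U = "{q \<in> chart_dom \<kappa>. chart_map \<kappa> q \<in> ball (chart_map \<kappa> p) r}"
    have "q' \<in> S" if q: "q \<in> ?U" "q' \<in> ?U" "q \<in> S" for q q'
    proof -
      from q(3) obtain \<gamma> where \<gamma>: "piecewise_C1_curve M A \<gamma>" "\<gamma> 0 = x1" "\<gamma> 1 = q" unfolding S_def by blast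
      obtain \<gamma>' where "piecewise_C1_curve M A \<gamma>'" "\<gamma>' 0 = \<gamma> 0" "\<gamma>' 1 = q'"
        by (rule piecewise_C1_curve_extend[OF \<gamma>(1) \<kappa>(1), of q' "ball (chart_map \<kappa> p) r"]) (use q r \<gamma>(3) in auto)
      then show ?thesis using \<gamma>(2) q(2) chart_dom_subset[OF \<kappa>(1)] unfolding S_def by auto
    qed
    moreover have "openin M ?U" by (rule openin_chart_preimage[OF \<kappa>(1) open_ball])
    moreover have "p \<in> ?U" using \<kappa>(2) r(1) by simp
    ultimately show ?thesis by blast
  qed
  have "openin M S"
    unfolding openin_subopen[of M S]
  proof
    fix q assume q: "q \<in> S"
    then obtain U where "openin M U" "q \<in> U" "\<forall>q\<in>U. \<forall>q'\<in>U. q \<in> S \<longrightarrow> q' \<in> S" using nbhd[of q] unfolding S_def by blast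
    then show "\<exists>U. openin M U \<and> q \<in> U \<and> U \<subseteq> S" using q by blast
  qed
  moreover have "openin M (topspace M - S)"
    unfolding openin_subopen[of M "topspace M - S"]
  proof
    fix q assume q: "q \<in> topspace M - S"
    then obtain U where U: "openin M U" "q \<in> U" "\<forall>q\<in>U. \<forall>q'\<in>U. q \<in> S \<longrightarrow> q' \<in> S" using nbhd[of q] by blast
    then have "U \<subseteq> topspace M - S" using q openin_subset[OF U(1)] by blast
    then show "\<exists>U. openin M U \<and> q \<in> U \<and> U \<subseteq> topspace M - S" using U by blast
  qed
  then have "closedin M S" by (simp add: closedin_def S_def subset_iff)
  moreover have "x1 \<in> S"
  proof -
    obtain \<kappa> where \<kappa>: "\<kappa> \<in> A" "x1 \<in> chart_dom \<kappa>" using x(1) charts_cover by blast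
    \<comment> \<open>The constant curve is the coordinate segment with direction 0.\<close>
    have "C1_curve_on A {0..1} (\<lambda>s. chart_inv \<kappa> (chart_map \<kappa> x1 + s *\<^sub>R 0))"
      by (rule C1_curve_on_segment[OF \<kappa>(1)]) (use \<kappa> chart_map_img in simp_all)
    then have "C1_curve_on A {0..1} (\<lambda>s. x1)"
      by (simp add: chart_inv_map[OF \<kappa>])
    then have "piecewise_C1_curve M A (\<lambda>s. x1)"
      unfolding piecewise_C1_curve_def using x(1)
      by (auto intro!: exI[of _ "Suc 0"] exI[of _ real])
    then show ?thesis using x(1) unfolding S_def by auto
  qed
  ultimately have "S = topspace M" using connected unfolding connected_space_clopen_in by blast
  then show ?thesis using x(2) unfolding S_def by blast
qed

end

section \<open>Integration along curves\<close>

text \<open>For a curve with velocity w and time speed s, the assumption \<open>q\<close> is the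
  squared length of w + 2 (1 - \<alpha>) s grad l, where d is the derivative of l along w. Dividing
  by 4 (1 - \<alpha>) s leaves the term \<sigma>^2 / (4 (1 - \<alpha>) s), which is at most the last
  term of the claim because |\<sigma>| \<le> \<tau> and s = \<Delta> \<tau> / R.\<close>

lemma weighted_quadratic_nonneg:
  fixes d G x \<sigma> \<tau> \<Delta> \<alpha> R s :: real
  assumes \<alpha>: "\<alpha> < 1" and \<Delta>: "\<Delta> > 0" and R: "R > 0" and \<tau>: "\<tau> > 0" "\<bar>\<sigma>\<bar> \<le> \<tau>" and s: "s = \<Delta> * \<tau> / R"
    and q: "\<sigma>^2 + 2 * (2 * (1 - \<alpha>) * s) * d + (2 * (1 - \<alpha>) * s)^2 * G \<ge> 0"
  shows "d + (1 - \<alpha>) * G * s + R / (4 * (1 - \<alpha>) * \<Delta>) * \<tau> \<ge> 0"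
proof -
  define x where "x = 2 * (1 - \<alpha>) * s"
  have x: "x > 0" using assms by (simp add: x_def)
  have "\<sigma>^2 \<le> \<tau>^2" using \<tau> by (metis abs_le_square_iff abs_of_pos)
  moreover have "2 * x * (R / (4 * (1 - \<alpha>) * \<Delta>) * \<tau>) = \<tau>^2"
  proof -
    have "1 - \<alpha> \<noteq> 0" using \<alpha> by simp
    then show ?thesis using \<Delta> R unfolding x_def s by (simp add: power2_eq_square field_simps)
  qed
  moreover have "2 * x * (d + (1 - \<alpha>) * G * s + R / (4 * (1 - \<alpha>) * \<Delta>) * \<tau>)
      = 2 * x * d + x^2 * G + 2 * x * (R / (4 * (1 - \<alpha>) * \<Delta>) * \<tau>)"
    by (simp add: x_def power2_eq_square distrib_left)
  ultimately have "2 * x * (d + (1 - \<alpha>) * G * s + R / (4 * (1 - \<alpha>) * \<Delta>) * \<tau>) \<ge> 0"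
    using q unfolding x_def[symmetric] by linarith
  then show ?thesis using x by (simp add: zero_le_mult_iff)
qed

context fisher_manifold
begin

lemma ln_f_has_derivative:
  assumes \<kappa>: "\<kappa> \<in> A" and y: "y \<in> chart_img \<kappa>" and t: "t > 0"
  shows "((\<lambda>z. ln (in_chart \<kappa> f (snd z) (fst z))) has_derivative
    (\<lambda>h. ((pgrad (in_chart \<kappa> f t) y \<bullet> fst h) + ft (chart_inv \<kappa> y) t * snd h) / in_chart \<kappa> f t y)) (at (y, t))"
proof -
  have sub: "chart_img \<kappa> \<times> {0<..} \<subseteq> chart_img \<kappa> \<times> {0::real..}" by auto
  have C1: "C1_gradient (chart_img \<kappa> \<times> {0<..}) (\<lambda>(y, t). in_chart \<kappa> f t y)
      (\<lambda>(y, t). (pgrad (in_chart \<kappa> f t) y, ft (chart_inv \<kappa> y) t))"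
  proof (rule joint_C1_gradient[OF chart_img_open[OF \<kappa>] open_greaterThan])
    show "convex {0::real<..}" by (rule convex_real_interval)
    show "((\<lambda>y. in_chart \<kappa> f t y) has_derivative (\<lambda>v. pgrad (in_chart \<kappa> f t) y \<bullet> v)) (at y)"
      if "y \<in> chart_img \<kappa>" "t \<in> {0<..}" for y t
      using has_derivative_pgrad[OF in_chart_diff[OF \<kappa> that(1), of t]] that by simp
    show "((\<lambda>t. in_chart \<kappa> f t y) has_real_derivative ft (chart_inv \<kappa> y) t) (at t)"
      if "y \<in> chart_img \<kappa>" "t \<in> {0<..}" for y t
      using f_deriv_at[OF chart_inv_topspace[OF \<kappa> that(1)], of t] that by (simp add: in_chart_def)
    show "continuous_on (chart_img \<kappa> \<times> {0<..}) (\<lambda>(y, t). pgrad (in_chart \<kappa> f t) y)"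
      unfolding pgrad_def case_prod_beta' using continuous_on_subset[OF C21(3)[OF \<kappa>] sub]
      by (intro continuous_on_vec_lambda) (simp add: case_prod_beta')
    show "continuous_on (chart_img \<kappa> \<times> {0<..}) (\<lambda>(y, t). ft (chart_inv \<kappa> y) t)"
      by (rule continuous_on_subset[OF C21(5)[OF \<kappa>] sub])
  qed
  have d: "((\<lambda>z. in_chart \<kappa> f (snd z) (fst z)) has_derivative
      (\<lambda>h. (pgrad (in_chart \<kappa> f t) y \<bullet> fst h) + ft (chart_inv \<kappa> y) t * snd h)) (at (y, t))"
  proof -
    have "(\<lambda>h. (pgrad (in_chart \<kappa> f t) y, ft (chart_inv \<kappa> y) t) \<bullet> h) =
        (\<lambda>h. (pgrad (in_chart \<kappa> f t) y \<bullet> fst h) + ft (chart_inv \<kappa> y) t * snd h)"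
      by (simp add: fun_eq_iff inner_prod_def)
    moreover have "((\<lambda>z. in_chart \<kappa> f (snd z) (fst z)) has_derivative
        (\<lambda>h. (pgrad (in_chart \<kappa> f t) y, ft (chart_inv \<kappa> y) t) \<bullet> h)) (at (y, t))"
      using C1 y t unfolding C1_gradient_def by (auto simp: case_prod_beta')
    ultimately show ?thesis by (simp only:)
  qed
  have "in_chart \<kappa> f (snd (y, t)) (fst (y, t)) > 0"
    using f01[OF chart_inv_topspace[OF \<kappa> y], of t] t by (simp add: in_chart_def)
  from has_derivative_ln[OF this d] show ?thesis by (simp add: divide_inverse)
qed

text \<open>The curve is lifted to space-time with time advancing essentially in proportion to arc
  length, which minimises the integral of (speed)^2 / (time speed) for the given length. Along the
  lift, ln f + \<Theta> plus a multiple of the arc length is nondecreasing.\<close>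

lemma harnack_along_curve:
  assumes \<gamma>: "piecewise_C1_curve M A \<gamma>" "\<gamma> 0 = x1" "\<gamma> 1 = x2"
    and t: "0 < t1" "t1 < t2" and \<alpha>: "\<alpha> < 1"
    and \<Theta>: "\<And>t. t1 \<le> t \<Longrightarrow> t \<le> t2 \<Longrightarrow> (\<Theta> has_real_derivative \<theta> t) (at t)"
    and H: "\<And>p t. p \<in> topspace M \<Longrightarrow> t1 \<le> t \<Longrightarrow> t \<le> t2 \<Longrightarrow> ft p t / f p t \<ge> (1 - \<alpha>) * Gp p t - \<theta> t"
  shows "4 * (1 - \<alpha>) * (t2 - t1) * (ln (f x1 t1) + \<Theta> t1 - ln (f x2 t2) - \<Theta> t2) \<le> (curve_length A g \<gamma>)^2"
proof -
  obtain m \<tau> where c\<gamma>: "continuous_map (top_of_set {0..1}) M \<gamma>" and \<tau>: "\<tau> 0 = 0" "\<tau> m = 1"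
    "\<And>i. i < m \<Longrightarrow> \<tau> i < \<tau> (Suc i)" "\<And>i. i < m \<Longrightarrow> C1_curve_on A {\<tau> i..\<tau> (Suc i)} \<gamma>"
    using \<gamma>(1) unfolding piecewise_C1_curve_def by blast
  note bounds = partition_bounds[of \<tau>, OF \<tau>(1,2,3)]
  define \<Delta> where "\<Delta> = t2 - t1"
  have \<Delta>: "\<Delta> > 0" using t by (simp add: \<Delta>_def)
  define Ls where "Ls s = integral {0..s} (speed A g \<gamma>)" for s
  define L where "L = Ls 1"
  note int = speed_integrable[OF \<gamma>(1)]
  have intS: "speed A g \<gamma> integrable_on {a..b}" if "0 \<le> a" "b \<le> 1" for a b
    by (rule integrable_subinterval_real[OF int]) (use that in auto)
  have Ls_bounds: "0 \<le> Ls s" "Ls s \<le> L" if "s \<in> {0..1}" for s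
  proof -
    show "0 \<le> Ls s" unfolding Ls_def
      by (rule integral_nonneg[OF intS]) (use that speed_nonneg[OF c\<gamma>] in auto)
    show "Ls s \<le> L" unfolding Ls_def L_def
      by (rule integral_subset_le) (use that speed_nonneg[OF c\<gamma>] intS int in auto)
  qed
  have L0: "L \<ge> 0" unfolding L_def using Ls_bounds(1)[of 1] by simp
  have cLs: "continuous_on {0..1} Ls" unfolding Ls_def by (rule indefinite_integral_continuous_1[OF int])
  have main: "4 * (1 - \<alpha>) * \<Delta> * (ln (f x1 t1) + \<Theta> t1 - ln (f x2 t2) - \<Theta> t2) \<le> (L + \<epsilon>)^2" if \<epsilon>: "\<epsilon> > 0" for \<epsilon>
  proof -
    define R where "R = L + \<epsilon>"
    have R: "R > 0" using L0 \<epsilon> by (simp add: R_def)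
    \<comment> \<open>At the end of the curve the length term is K R = R^2 / (4 (1 - \<alpha>)
      \<Delta>), the Gaussian exponent for length R.\<close>
    define K where "K = R / (4 * (1 - \<alpha>) * \<Delta>)"
    \<comment> \<open>The summand \<epsilon> s keeps the time speed positive where the curve stands
      still; division by R makes time end at t2.\<close>
    define tt where "tt s = t1 + \<Delta> * (\<epsilon> * s + Ls s) / R" for s
    have tt_bounds: "t1 \<le> tt s" "tt s \<le> t2" if "s \<in> {0..1}" for s
    proof -
      have "0 \<le> \<epsilon> * s + Ls s" using Ls_bounds(1)[OF that] that \<epsilon> by simp
      then show "t1 \<le> tt s" using \<Delta> R by (simp add: tt_def)
      have "\<epsilon> * s \<le> \<epsilon>" using that \<epsilon> by (simp add: mult_left_le)
      then have "\<epsilon> * s + Ls s \<le> R" using Ls_bounds(2)[OF that] by (simp add: R_def)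
      then have "\<Delta> * (\<epsilon> * s + Ls s) / R \<le> \<Delta>" using \<Delta> R by (simp add: divide_le_eq mult_left_mono)
      then show "tt s \<le> t2" by (simp add: tt_def \<Delta>_def)
    qed
    define F where "F s = ln (f (\<gamma> s) (tt s)) + \<Theta> (tt s) + K * (\<epsilon> * s + Ls s)" for s
    have ctt: "continuous_on {0..1} tt" unfolding tt_def using R by (intro continuous_intros cLs) auto
    have c\<Theta>: "continuous_on {0..1} (\<lambda>s. \<Theta> (tt s))"
    proof (rule continuous_on_compose2[OF _ ctt])
      show "continuous_on {t1..t2} \<Theta>"
        by (intro continuous_at_imp_continuous_on ballI DERIV_isCont[OF \<Theta>]) auto
    qed (use tt_bounds in auto)
    have local: "\<exists>\<kappa> T. \<kappa> \<in> A \<and> \<gamma> s \<in> chart_dom \<kappa> \<and> open T \<and> s \<in> T \<and>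
        (\<forall>s'\<in>{0..1} \<inter> T. f (\<gamma> s') (tt s') = in_chart \<kappa> f (tt s') (chart_map \<kappa> (\<gamma> s')))" if s: "s \<in> {0..1}" for s
    proof -
      obtain \<kappa> where \<kappa>: "\<kappa> \<in> A" "\<gamma> s \<in> chart_dom \<kappa>" using charts_cover curve_topspace[OF c\<gamma> s] by blast
      obtain T where T: "open T" "s \<in> T" "\<And>s'. s' \<in> {0..1} \<inter> T \<Longrightarrow> \<gamma> s' \<in> chart_dom \<kappa>"
        using curve_nhd[OF c\<gamma> chart_dom_open[OF \<kappa>(1)] s \<kappa>(2)] by blast
      have "f (\<gamma> s') (tt s') = in_chart \<kappa> f (tt s') (chart_map \<kappa> (\<gamma> s'))" if "s' \<in> {0..1} \<inter> T" for s'
        unfolding in_chart_def chart_inv_map[OF \<kappa>(1) T(3)[OF that]] ..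
      with \<kappa> T show ?thesis by blast
    qed
    have clnf: "continuous_on {0..1} (\<lambda>s. ln (f (\<gamma> s) (tt s)))"
      unfolding continuous_on_def
    proof
      fix s :: real assume s: "s \<in> {0..1}"
      obtain \<kappa> T where \<kappa>: "\<kappa> \<in> A" "\<gamma> s \<in> chart_dom \<kappa>" and T: "open T" "s \<in> T"
        and eq: "\<And>s'. s' \<in> {0..1} \<inter> T \<Longrightarrow> f (\<gamma> s') (tt s') = in_chart \<kappa> f (tt s') (chart_map \<kappa> (\<gamma> s'))"
        using local[OF s] by blast
      have "isCont (\<lambda>z. ln (in_chart \<kappa> f (snd z) (fst z))) (chart_map \<kappa> (\<gamma> s), tt s)"
        by (rule has_derivative_continuous[OF ln_f_has_derivative[OF \<kappa>(1) chart_map_img[OF \<kappa>(2)]]])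
          (use tt_bounds(1)[OF s] t in simp)
      moreover have "((\<lambda>s. (chart_map \<kappa> (\<gamma> s), tt s)) \<longlongrightarrow> (chart_map \<kappa> (\<gamma> s), tt s)) (at s within {0..1})"
        using ctt s by (intro tendsto_Pair chart_curve_continuous[OF c\<gamma> s \<kappa>]) (simp add: continuous_on_def)
      ultimately have "((\<lambda>s. ln (in_chart \<kappa> f (snd (chart_map \<kappa> (\<gamma> s), tt s)) (fst (chart_map \<kappa> (\<gamma> s), tt s))))
          \<longlongrightarrow> ln (in_chart \<kappa> f (snd (chart_map \<kappa> (\<gamma> s), tt s)) (fst (chart_map \<kappa> (\<gamma> s), tt s)))) (at s within {0..1})"
        by (rule isCont_tendsto_compose)
      then have "((\<lambda>s. ln (in_chart \<kappa> f (tt s) (chart_map \<kappa> (\<gamma> s)))) \<longlongrightarrow> ln (f (\<gamma> s) (tt s))) (at s within {0..1})"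
        using eq[of s] s T(2) by simp
      then show "((\<lambda>s. ln (f (\<gamma> s) (tt s))) \<longlongrightarrow> ln (f (\<gamma> s) (tt s))) (at s within {0..1})"
      proof (rule Lim_transform_eventually)
        show "\<forall>\<^sub>F s in at s within {0..1}. ln (in_chart \<kappa> f (tt s) (chart_map \<kappa> (\<gamma> s))) = ln (f (\<gamma> s) (tt s))"
          unfolding eventually_at_topological using T eq by auto
      qed
    qed
    have cF: "continuous_on {0..1} F" unfolding F_def by (intro continuous_intros clnf c\<Theta> cLs)
    have piece: "F (\<tau> i) \<le> F (\<tau> (Suc i))" if i: "i < m" for i
    proof (rule DERIV_nonneg_imp_increasing_open[where f = F])
      define a where "a = \<tau> i"
      define b where "b = \<tau> (Suc i)"
      have ab: "a < b" "0 \<le> a" "b \<le> 1" using \<tau>(3)[OF i] bounds[of i] bounds[of "Suc i"] i by (auto simp: a_def b_def)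
      then have sub: "{a..b} \<subseteq> {0..1}" by auto
      have C1: "C1_curve_on A {a..b} \<gamma>" using \<tau>(4)[OF i] by (simp add: a_def b_def)
      show "\<tau> i \<le> \<tau> (Suc i)" using ab by (simp add: a_def b_def)
      show "continuous_on {\<tau> i..\<tau> (Suc i)} F"
        using continuous_on_subset[OF cF sub] by (simp add: a_def b_def)
      fix s assume "\<tau> i < s" "s < \<tau> (Suc i)"
      then have s: "a < s" "s < b" by (simp_all add: a_def b_def)
      have sab: "s \<in> {a..b}" and s01: "s \<in> {0..1}" using s sub by auto
      obtain \<kappa> T where \<kappa>: "\<kappa> \<in> A" "\<gamma> s \<in> chart_dom \<kappa>" and T: "open T" "s \<in> T"
        and eq: "\<And>s'. s' \<in> {0..1} \<inter> T \<Longrightarrow> f (\<gamma> s') (tt s') = in_chart \<kappa> f (tt s') (chart_map \<kappa> (\<gamma> s'))"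
        using local[OF s01] by blast
      interpret cm: chart_metric "chart_img \<kappa>" "g \<kappa>" by (rule chart_metric[OF \<kappa>(1)])
      define y where "y = chart_map \<kappa> (\<gamma> s)"
      have y: "y \<in> chart_img \<kappa>" unfolding y_def by (rule chart_map_img[OF \<kappa>(2)])
      define w where "w = vector_derivative (chart_map \<kappa> \<circ> \<gamma>) (at s within {a..b})"
      have atI: "at s within {a..b} = at s" by (rule at_within_Icc_at[OF s])
      have dw: "((\<lambda>s. chart_map \<kappa> (\<gamma> s)) has_derivative (\<lambda>x. x *\<^sub>R w)) (at s)"
      proof -
        have "(chart_map \<kappa> \<circ> \<gamma> has_vector_derivative w) (at s within {a..b})"
          unfolding w_def by (rule C1_curve_deriv[OF C1 \<kappa>(1) sab \<kappa>(2)])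
        then show ?thesis unfolding atI has_vector_derivative_def o_def .
      qed
      define \<sigma> where "\<sigma> = speed_on {a..b} \<gamma> s"
      have \<sigma>_eq: "\<sigma> = sqrt (w \<bullet> (g \<kappa> y *v w))"
        unfolding \<sigma>_def y_def by (rule speed_on_chart[OF c\<gamma> C1 ab(1) sub sab \<kappa> w_def])
      have wgw: "w \<bullet> (g \<kappa> y *v w) \<ge> 0" using cm.pos[OF y, of w] by (cases "w = 0") auto
      then have \<sigma>: "\<sigma> \<ge> 0" "\<sigma>^2 = w \<bullet> (g \<kappa> y *v w)" by (simp_all add: \<sigma>_eq)
      have dLs: "(Ls has_real_derivative \<sigma>) (at s)"
      proof -
        have "((\<lambda>u. integral {a..u} (speed_on {a..b} \<gamma>)) has_vector_derivative \<sigma>) (at s within {a..b})"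
          unfolding \<sigma>_def by (rule integral_has_vector_derivative[OF speed_on_continuous[OF c\<gamma> C1 ab(1) sub] sab])
        then have "((\<lambda>u. integral {a..u} (speed_on {a..b} \<gamma>)) has_real_derivative \<sigma>) (at s within {a..b})"
          by (simp add: has_real_derivative_iff_has_vector_derivative)
        then have "((\<lambda>u. Ls a + integral {a..u} (speed_on {a..b} \<gamma>)) has_real_derivative \<sigma>) (at s within {a..b})"
          by (auto intro!: derivative_eq_intros)
        moreover have "Ls u = Ls a + integral {a..u} (speed_on {a..b} \<gamma>)" if "u \<in> {a..b}" for u
          unfolding Ls_def speed_piece(2)[OF c\<gamma> C1 ab(1) sub that, symmetric]
          by (rule Henstock_Kurzweil_Integration.integral_combine[symmetric]) (use that ab in \<open>auto intro!: intS\<close>)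
        ultimately have "(Ls has_real_derivative \<sigma>) (at s within {a..b})"
          unfolding has_field_derivative_def by (rule has_derivative_transform[OF sab, rotated])
        then show ?thesis unfolding atI .
      qed
      define t' where "t' = \<Delta> * (\<epsilon> + \<sigma>) / R"
      have dtt: "(tt has_real_derivative t') (at s)"
        unfolding tt_def t'_def using R by (auto intro!: derivative_eq_intros dLs)
      have ttp: "tt s > 0" using tt_bounds(1)[OF s01] t by simp
      define v where "v = in_chart \<kappa> f (tt s) y"
      have inv_y: "chart_inv \<kappa> y = \<gamma> s" unfolding y_def by (rule chart_inv_map[OF \<kappa>])
      have v_eq: "v = f (\<gamma> s) (tt s)" unfolding v_def in_chart_def inv_y ..
      have pM: "\<gamma> s \<in> topspace M" by (rule curve_topspace[OF c\<gamma> s01])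
      have v: "v > 0" unfolding v_eq using f01[OF pM, of "tt s"] ttp by simp
      define p where "p = (1 / v) *\<^sub>R pgrad (in_chart \<kappa> f (tt s)) y"
      define D where "D = p \<bullet> w + ft (\<gamma> s) (tt s) / v * t'"
      have dln: "((\<lambda>s. ln (f (\<gamma> s) (tt s))) has_real_derivative D) (at s)"
      proof -
        have pr: "((\<lambda>s. (chart_map \<kappa> (\<gamma> s), tt s)) has_derivative (\<lambda>x. (x *\<^sub>R w, t' * x))) (at s)"
          by (rule has_derivative_Pair[OF dw dtt[unfolded has_field_derivative_def]])
        have "((\<lambda>z. ln (in_chart \<kappa> f (snd z) (fst z))) has_derivative
            (\<lambda>h. ((pgrad (in_chart \<kappa> f (tt s)) y \<bullet> fst h) + ft (\<gamma> s) (tt s) * snd h) / v)) (at (chart_map \<kappa> (\<gamma> s), tt s))"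
          using ln_f_has_derivative[OF \<kappa>(1) y ttp] unfolding inv_y unfolding v_def y_def .
        from has_derivative_compose[OF pr this]
        have "((\<lambda>s. ln (in_chart \<kappa> f (tt s) (chart_map \<kappa> (\<gamma> s)))) has_derivative
            (\<lambda>x. ((pgrad (in_chart \<kappa> f (tt s)) y \<bullet> (x *\<^sub>R w)) + ft (\<gamma> s) (tt s) * (t' * x)) / v)) (at s)" by simp
        moreover have "(\<lambda>x. ((pgrad (in_chart \<kappa> f (tt s)) y \<bullet> (x *\<^sub>R w)) + ft (\<gamma> s) (tt s) * (t' * x)) / v) = (\<lambda>x. D * x)"
          using v by (simp add: fun_eq_iff D_def p_def field_simps)
        ultimately have "((\<lambda>s. ln (in_chart \<kappa> f (tt s) (chart_map \<kappa> (\<gamma> s)))) has_derivative (\<lambda>x. D * x)) (at s)" by simp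
        then show ?thesis unfolding has_field_derivative_def
        proof (rule has_derivative_transform_within_open[of _ _ _ _ "T \<inter> {a<..<b}"])
          fix s' assume "s' \<in> T \<inter> {a<..<b}"
          then show "ln (in_chart \<kappa> f (tt s') (chart_map \<kappa> (\<gamma> s'))) = ln (f (\<gamma> s') (tt s'))"
            using eq[of s'] ab by auto
        qed (use T s in auto)
      qed
      have d\<Theta>: "((\<lambda>s. \<Theta> (tt s)) has_real_derivative \<theta> (tt s) * t') (at s)"
        by (rule DERIV_chain2[OF \<Theta>[OF tt_bounds[OF s01]] dtt])
      have "((\<lambda>s. K * (\<epsilon> * s + Ls s)) has_real_derivative K * (\<epsilon> + \<sigma>)) (at s)"
        by (auto intro!: derivative_eq_intros dLs)
      from DERIV_add[OF DERIV_add[OF dln d\<Theta>] this]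
      have "(F has_real_derivative D + \<theta> (tt s) * t' + K * (\<epsilon> + \<sigma>)) (at s)"
        unfolding F_def .
      \<comment> \<open>The bound on the time derivative of ln f supplies the squared gradient;
        together with the derivative along the curve and the length term it is estimated by a
        complete square.\<close>
      moreover have "D + \<theta> (tt s) * t' + K * (\<epsilon> + \<sigma>) \<ge> 0"
      proof -
        define G where "G = p \<bullet> (cm.a y *v p)"
        have GG: "Gp (\<gamma> s) (tt s) = G"
          using Gp_chart[OF \<kappa>, of "tt s"] ttp v
          unfolding Gc_def y_def[symmetric] v_eq[symmetric] G_def p_def
          by (simp add: matrix_vector_mult_scaleR power2_eq_square)
        have t'p: "t' > 0" using \<Delta> \<epsilon> \<sigma>(1) R by (simp add: t'_def add_pos_nonneg)
        define x where "x = 2 * (1 - \<alpha>) * t'"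
        have "0 \<le> (w + x *\<^sub>R (cm.a y *v p)) \<bullet> (g \<kappa> y *v (w + x *\<^sub>R (cm.a y *v p)))"
          using cm.pos[OF y, of "w + x *\<^sub>R (cm.a y *v p)"] by (cases "w + x *\<^sub>R (cm.a y *v p) = 0") auto
        also have "\<dots> = \<sigma>^2 + 2 * x * (p \<bullet> w) + x^2 * G"
        proof -
          have 1: "(cm.a y *v p) \<bullet> (g \<kappa> y *v w) = p \<bullet> w"
            unfolding cm.h_swap[OF y] cm.h_a[OF y] ..
          have 2: "g \<kappa> y *v (w + x *\<^sub>R (cm.a y *v p)) = g \<kappa> y *v w + x *\<^sub>R p"
            by (simp only: matrix_vector_right_distrib matrix_vector_mult_scaleR cm.h_a[OF y])
          show ?thesis unfolding 2 \<sigma>(2) G_def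
            by (simp add: inner_add_left inner_add_right 1 inner_commute[of w p] inner_commute[of "cm.a y *v p" p] power2_eq_square algebra_simps)
        qed
        finally have q: "\<sigma>^2 + 2 * (2 * (1 - \<alpha>) * t') * (p \<bullet> w) + (2 * (1 - \<alpha>) * t')^2 * G \<ge> 0" by (simp only: x_def)
        have "p \<bullet> w + (1 - \<alpha>) * G * t' + R / (4 * (1 - \<alpha>) * \<Delta>) * (\<epsilon> + \<sigma>) \<ge> 0"
          by (rule weighted_quadratic_nonneg[OF \<alpha> \<Delta> R _ _ _ q]) (use \<epsilon> \<sigma>(1) in \<open>auto simp: t'_def\<close>)
        moreover have "(ft (\<gamma> s) (tt s) / v + \<theta> (tt s)) * t' \<ge> ((1 - \<alpha>) * G) * t'"
          using H[OF pM tt_bounds[OF s01]] t'p unfolding GG v_eq by (intro mult_right_mono) auto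
        ultimately show ?thesis unfolding D_def K_def distrib_right by linarith
      qed
      ultimately show "\<exists>y. (F has_real_derivative y) (at s) \<and> 0 \<le> y" by blast
    qed
    have "F 0 \<le> F (\<tau> i)" if "i \<le> m" for i
      using that
    proof (induction i)
      case (Suc i)
      then show ?case using piece[of i] by simp
    qed (simp add: \<tau>)
    from this[of m] have "F 0 \<le> F 1" by (simp add: \<tau>)
    moreover have "F 0 = ln (f x1 t1) + \<Theta> t1" by (simp add: F_def tt_def Ls_def \<gamma>)
    moreover have "F 1 = ln (f x2 t2) + \<Theta> t2 + K * R"
    proof -
      have "\<epsilon> * 1 + Ls 1 = R" by (simp add: R_def L_def)
      moreover have "tt 1 = t2" using R calculation by (simp add: tt_def \<Delta>_def)
      ultimately show ?thesis unfolding F_def \<gamma> by simp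
    qed
    moreover have "K * R * (4 * (1 - \<alpha>) * \<Delta>) = R^2"
      using \<alpha> \<Delta> by (simp add: K_def power2_eq_square)
    ultimately have "4 * (1 - \<alpha>) * \<Delta> * (ln (f x1 t1) + \<Theta> t1 - ln (f x2 t2) - \<Theta> t2) \<le> 4 * (1 - \<alpha>) * \<Delta> * (K * R)"
      using \<alpha> \<Delta> by (intro mult_left_mono) auto
    also have "\<dots> = R^2" using \<open>K * R * (4 * (1 - \<alpha>) * \<Delta>) = R^2\<close> by (simp add: mult_ac)
    finally show ?thesis by (simp add: R_def)
  qed
  have lim: "((\<lambda>\<epsilon>. (L + \<epsilon>)^2) \<longlongrightarrow> (L + 0)^2) (at_right 0)" by (intro tendsto_intros)
  have "4 * (1 - \<alpha>) * \<Delta> * (ln (f x1 t1) + \<Theta> t1 - ln (f x2 t2) - \<Theta> t2) \<le> (L + 0)^2"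
  proof (rule tendsto_lowerbound[OF lim])
    show "\<forall>\<^sub>F \<epsilon> in at_right 0. 4 * (1 - \<alpha>) * \<Delta> * (ln (f x1 t1) + \<Theta> t1 - ln (f x2 t2) - \<Theta> t2) \<le> (L + \<epsilon>)^2"
      by (rule eventually_at_rightI[of 0 1]) (rule main, simp_all)
  qed simp
  then show ?thesis by (simp add: \<Delta>_def L_def Ls_def curve_length_def)
qed

text \<open>As f < 1 and \<beta> + c \<ge> 0, the part - c + (\<beta> + c) f of H is at most
  \<beta>, so H \<ge> 0 gives the rate \<beta> + \<phi>, whose primitive is \<Theta>. The estimate
  for every curve then passes to the infimum of the lengths.\<close>

lemma harnack_inequality:
  assumes x: "x1 \<in> topspace M" "x2 \<in> topspace M" and t: "0 < t1" "t1 < t2" and \<alpha>: "\<alpha> < 1" and \<beta>: "\<beta> + c \<ge> 0"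
    and \<Theta>: "\<And>t. t > 0 \<Longrightarrow> (\<Theta> has_real_derivative \<beta> + \<phi> t) (at t)"
    and H: "\<And>p t. p \<in> topspace M \<Longrightarrow> t1 \<le> t \<Longrightarrow> t \<le> t2 \<Longrightarrow> Hm \<alpha> \<beta> \<phi> p t \<ge> 0"
  shows "f x2 t2 / f x1 t1 \<ge> exp (- (\<Theta> t2 - \<Theta> t1)) * exp (- ((geodesic_dist M A g x1 x2)^2 / (4 * (1 - \<alpha>) * (t2 - t1))))"
proof -
  have H': "ft p t / f p t \<ge> (1 - \<alpha>) * Gp p t - (\<beta> + \<phi> t)" if "p \<in> topspace M" "t1 \<le> t" "t \<le> t2" for p t
  proof -
    have "(\<beta> + c) * f p t \<le> (\<beta> + c) * 1" using f01[OF that(1), of t] that t \<beta> by (intro mult_left_mono) auto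
    then show ?thesis using H[OF that] unfolding Hm_def by simp
  qed
  define C where "C = 4 * (1 - \<alpha>) * (t2 - t1)"
  have C: "C > 0" using \<alpha> t by (simp add: C_def)
  define X where "X = C * (ln (f x1 t1) + \<Theta> t1 - ln (f x2 t2) - \<Theta> t2)"
  define S where "S = {curve_length A g \<gamma> |\<gamma>. piecewise_C1_curve M A \<gamma> \<and> \<gamma> 0 = x1 \<and> \<gamma> 1 = x2}"
  define d where "d = geodesic_dist M A g x1 x2"
  have d: "d = Inf S" by (simp add: d_def geodesic_dist_def S_def)
  have S: "S \<noteq> {}" using piecewise_C1_curve_exists[OF x] unfolding S_def by blast
  have le: "X \<le> l^2 \<and> 0 \<le> l" if "l \<in> S" for l
  proof -
    obtain \<gamma> where \<gamma>: "piecewise_C1_curve M A \<gamma>" "\<gamma> 0 = x1" "\<gamma> 1 = x2" "l = curve_length A g \<gamma>"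
      using \<open>l \<in> S\<close> unfolding S_def by blast
    have "X \<le> l^2" unfolding X_def C_def \<gamma>(4)
      by (rule harnack_along_curve[OF \<gamma>(1-3) t \<alpha>, of \<Theta> "\<lambda>t. \<beta> + \<phi> t"]) (use \<Theta> H' t in auto)
    moreover have "0 \<le> l" unfolding \<gamma>(4) curve_length_def
      using \<gamma>(1) unfolding piecewise_C1_curve_def
      by (intro integral_nonneg speed_integrable[OF \<gamma>(1)] speed_nonneg) auto
    ultimately show ?thesis by simp
  qed
  have "X \<le> d^2"
  \<comment> \<open>The infimum concerns lengths and not their squares, so for positive X square
    roots are compared; otherwise the bound is trivial.\<close>
  proof (cases "X \<le> 0")
    case True
    then show ?thesis using zero_le_power2[of d] by linarith
  next
    case False
    have "sqrt X \<le> d" unfolding d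
    proof (rule cInf_greatest[OF S])
      fix l assume "l \<in> S"
      from le[OF this] show "sqrt X \<le> l" by (simp add: real_le_lsqrt)
    qed
    then have "(sqrt X)^2 \<le> d^2" using False by (intro power_mono) auto
    then show ?thesis using False by simp
  qed
  then have "ln (f x1 t1) + \<Theta> t1 - ln (f x2 t2) - \<Theta> t2 \<le> d^2 / C"
    using C by (simp add: X_def pos_le_divide_eq mult.commute)
  then have le2: "- (\<Theta> t2 - \<Theta> t1) + - (d^2 / C) \<le> ln (f x2 t2) - ln (f x1 t1)" by simp
  have f: "f x1 t1 > 0" "f x2 t2 > 0" using f01 x t by auto
  have "exp (- (\<Theta> t2 - \<Theta> t1)) * exp (- (d^2 / C)) \<le> exp (ln (f x2 t2) - ln (f x1 t1))"
    unfolding exp_add[symmetric] using le2 by simp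
  also have "\<dots> = f x2 t2 / f x1 t1" using f by (simp add: exp_diff)
  finally show ?thesis by (simp add: d_def C_def)
qed

end

section \<open>The Riccati equation\<close>

lemma powr_quotient: "x > 0 \<Longrightarrow> y > 0 \<Longrightarrow> (x / y) powr k = exp (k * (ln x - ln y))" for x y k :: real
  by (simp add: powr_def ln_div)

text \<open>Put \<phi> = - \<beta> + \<theta> and regard a (\<beta> u + \<phi>)^2 + c u (\<phi> +
  \<beta>) + \<phi>' as a quadratic in u. Requiring its discriminant to vanish and solving for
  \<phi>' gives the last bracket; this is the origin of the Riccati equation.\<close>

lemma riccati_square_nonneg:
  fixes a \<beta> c \<theta> u :: real
  assumes "a > 0" "\<beta> \<noteq> 0"
  shows "a * (\<beta> * u + (- \<beta> + \<theta>))^2 + c * u * ((- \<beta> + \<theta>) + \<beta>)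
    + (- c * \<theta> + c * (c + 4 * a * \<beta>) / (4 * a * \<beta>^2) * \<theta>^2) \<ge> 0"
proof -
  have "a * (\<beta> * u + (- \<beta> + \<theta>))^2 + c * u * ((- \<beta> + \<theta>) + \<beta>)
    + (- c * \<theta> + c * (c + 4 * a * \<beta>) / (4 * a * \<beta>^2) * \<theta>^2)
    = ((2 * a * \<beta> + c) * \<theta> - 2 * a * \<beta>^2 * (1 - u))^2 / (4 * a * \<beta>^2)"
    using assms by (simp add: field_simps) (simp add: power2_eq_square algebra_simps)
  also have "\<dots> \<ge> 0" using assms by simp
  finally show ?thesis .
qed

lemma admissible_negative:
  assumes "admissible n c \<alpha> \<beta>"
  shows "\<beta> < 0" "0 < \<alpha>" "\<alpha> < 1"
  using assms unfolding admissible_def by linarith+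

text \<open>The upper bound itself serves as \<beta>. Then \<beta> + c \<ge> 0 amounts to n (1 +
  \<alpha>) \<le> 4 \<alpha>^2 - 4 \<alpha> + 2 n, and the difference of the two sides is (1 -
  \<alpha>) (n - 4 \<alpha>).\<close>

lemma admissible_exists:
  fixes n c \<alpha> :: real
  assumes n: "n \<ge> 1" and c: "c > 0" and \<alpha>: "0 < \<alpha>" "\<alpha> < 1" "\<alpha> \<le> n / 4"
  shows "\<exists>\<beta>. admissible n c \<alpha> \<beta> \<and> \<beta> + c \<ge> 0"
proof -
  define B where "B = 4 * \<alpha>^2 - 4 * \<alpha> + 2 * n"
  have "B = (2 * \<alpha> - 1)^2 + (2 * n - 1)" by (simp add: B_def power2_eq_square algebra_simps)
  then have B: "B > 0" using n by (simp add: add_nonneg_pos)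
  have "0 < c * (n * (1 + \<alpha>))" using c n \<alpha> by simp
  then have neg: "- c * n * (1 + \<alpha>) / B < 0" using B by (simp add: mult.assoc)
  have "(1 - \<alpha>) * (n - 4 * \<alpha>) \<ge> 0" using \<alpha> by simp
  then have "n * (1 + \<alpha>) \<le> B" by (simp add: B_def power2_eq_square algebra_simps)
  then have "c * (n * (1 + \<alpha>)) \<le> c * B" using c by (intro mult_left_mono) auto
  then have "- c * n * (1 + \<alpha>) / B + c \<ge> 0" using B by (simp add: field_simps)
  then show ?thesis using neg \<alpha> unfolding admissible_def B_def[symmetric] by blast
qed

section \<open>Explicit barriers in the three cases\<close>

context fisher_manifold
begin

text \<open>With K as in the proof, the Riccati equation reads \<theta>' = - c \<theta> - (c / K)
  \<theta>^2 with K > 0. It is linear in 1 / \<theta>, and the solution that is infinite at time 0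
  is K / (exp (c t) - 1).\<close>

lemma harnack_case_negative:
  fixes \<alpha> \<beta> t1 t2 :: real
  defines "n \<equiv> real CARD('n)"
  assumes adm: "admissible n c \<alpha> \<beta>" and \<beta>c: "\<beta> + c \<ge> 0" and neg: "8 * \<beta> * (1 - \<alpha>) + c * n < 0"
    and t: "t2 > t1" "t1 > 0" and x: "x1 \<in> topspace M" "x2 \<in> topspace M"
  shows "f x2 t2 / f x1 t1 \<ge> ((1 - exp (- c * t2)) / (1 - exp (- c * t1)))
        powr (8 * \<beta>^2 * (1 - \<alpha>) / (c^2 * n + 8 * \<beta> * c * (1 - \<alpha>)))
      * exp (- ((geodesic_dist M A g x1 x2)^2 / (4 * (1 - \<alpha>) * (t2 - t1))))"
proof -
  have n: "n > 0" by (simp add: n_def)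
  note \<beta> = admissible_negative(1)[OF adm] and \<alpha> = admissible_negative(2,3)[OF adm]
  define a where "a = 2 * (1 - \<alpha>) / n"
  have a: "a > 0" using \<alpha> n by (simp add: a_def)
  have an: "8 * \<beta> * (1 - \<alpha>) = n * (4 * a * \<beta>)" using n by (simp add: a_def)
  have neg': "c + 4 * a * \<beta> < 0"
  proof -
    have "n * (c + 4 * a * \<beta>) < 0" using neg unfolding an by (simp add: algebra_simps)
    then show ?thesis using n by (simp add: mult_less_0_iff)
  qed
  define K where "K = - (4 * a * \<beta>^2) / (c + 4 * a * \<beta>)"
  have K: "K > 0" unfolding K_def by (rule divide_neg_neg) (use a \<beta> neg' in auto)
  define \<theta> where "\<theta> t = K / (exp (c * t) - 1)" for t
  define \<phi> where "\<phi> t = - \<beta> + \<theta> t" for t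
  define \<phi>' where "\<phi>' t = - c * \<theta> t + c * (c + 4 * a * \<beta>) / (4 * a * \<beta>^2) * (\<theta> t)^2" for t
  define \<Theta> where "\<Theta> t = (K / c) * ln (1 - exp (- c * t))" for t
  have E: "exp (c * t) > 1" if "t > 0" for t using c that by simp
  have R: "c * (c + 4 * a * \<beta>) / (4 * a * \<beta>^2) = - c / K"
    using neg' a \<beta> by (simp add: K_def)
  have \<theta>_pos: "\<theta> t > 0" if "t > 0" for t using K E[OF that] by (simp add: \<theta>_def)
  have d\<phi>: "(\<phi> has_real_derivative \<phi>' t) (at t)" if "t > 0" for t
  proof -
    have "(\<phi> has_real_derivative - (K * (exp (c * t) * c)) / ((exp (c * t) - 1) * (exp (c * t) - 1))) (at t)"
      unfolding \<phi>_def \<theta>_def using E[OF that] by (auto intro!: derivative_eq_intros)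
    moreover have "- (K * (exp (c * t) * c)) / ((exp (c * t) - 1) * (exp (c * t) - 1)) = \<phi>' t"
      unfolding \<phi>'_def R \<theta>_def using E[OF that] K
      by (simp add: divide_simps power2_eq_square) (simp add: algebra_simps)
    ultimately show ?thesis by simp
  qed
  have c\<phi>': "continuous_on {0<..} \<phi>'"
    unfolding \<phi>'_def \<theta>_def using E by (intro continuous_intros) (auto simp: less_imp_neq[symmetric])
  have lim: "filterlim \<phi> at_top (at_right 0)"
    unfolding \<phi>_def \<theta>_def using c K by real_asymp
  obtain a0 where a0: "0 < a0" "a0 < t1" "\<And>p. p \<in> topspace M \<Longrightarrow> Hm \<alpha> \<beta> \<phi> p a0 \<ge> 0"
    using initial_time[OF lim t(2)] by blast
  have H: "Hm \<alpha> \<beta> \<phi> p t \<ge> 0" if "p \<in> topspace M" "t1 \<le> t" "t \<le> t2" for p t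
  proof (rule Hm_nonneg[where \<phi>' = \<phi>' and T = t2 and ?a0.0 = a0])
    show "- \<beta> \<le> \<phi> t" if "a0 < t" for t using \<theta>_pos[of t] that a0 by (simp add: \<phi>_def)
    show "0 \<le> 2 * (1 - \<alpha>) / real CARD('n) * (\<beta> * u + \<phi> t)^2 + c * u * (\<phi> t + \<beta>) + \<phi>' t" for t u
      using riccati_square_nonneg[OF a, of \<beta> u "\<theta> t" c] \<beta> unfolding a_def n_def \<phi>_def \<phi>'_def by simp
  qed (use adm d\<phi> c\<phi>' a0 that in \<open>auto simp: n_def\<close>)
  have d\<Theta>: "(\<Theta> has_real_derivative \<beta> + \<phi> t) (at t)" if "t > 0" for t
  proof -
    have e: "exp (- c * t) < 1" using c that by simp
    have "(\<Theta> has_real_derivative (K / c) * (exp (- c * t) * c / (1 - exp (- c * t)))) (at t)"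
      unfolding \<Theta>_def using e by (auto intro!: derivative_eq_intros)
    moreover have "(K / c) * (exp (- c * t) * c / (1 - exp (- c * t))) = \<beta> + \<phi> t"
      using c E[OF that] by (simp add: \<phi>_def \<theta>_def exp_minus field_simps)
    ultimately show ?thesis by simp
  qed
  have k: "8 * \<beta>^2 * (1 - \<alpha>) / (c^2 * n + 8 * \<beta> * c * (1 - \<alpha>)) = - (K / c)"
  proof -
    have k1: "8 * \<beta>^2 * (1 - \<alpha>) = n * (4 * a * \<beta>^2)" using n by (simp add: a_def)
    have "c^2 * n + 8 * \<beta> * c * (1 - \<alpha>) = c * (c * n + 8 * \<beta> * (1 - \<alpha>))"
      by (simp add: power2_eq_square algebra_simps)
    also have "\<dots> = n * (c * (c + 4 * a * \<beta>))"
      unfolding an by (simp add: algebra_simps)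
    finally have "8 * \<beta>^2 * (1 - \<alpha>) / (c^2 * n + 8 * \<beta> * c * (1 - \<alpha>)) = (4 * a * \<beta>^2) / (c * (c + 4 * a * \<beta>))"
      unfolding k1 using n by simp
    then show ?thesis using c neg' by (simp add: K_def)
  qed
  have pos: "1 - exp (- c * t1) > 0" "1 - exp (- c * t2) > 0" using c t by auto
  have "((1 - exp (- c * t2)) / (1 - exp (- c * t1))) powr (- (K / c)) = exp (- (\<Theta> t2 - \<Theta> t1))"
    unfolding powr_quotient[OF pos(2,1)] \<Theta>_def right_diff_distrib by simp
  moreover have "f x2 t2 / f x1 t1 \<ge> exp (- (\<Theta> t2 - \<Theta> t1)) * exp (- ((geodesic_dist M A g x1 x2)^2 / (4 * (1 - \<alpha>) * (t2 - t1))))"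
    by (rule harnack_inequality[OF x t(2,1) \<alpha>(2) \<beta>c d\<Theta> H])
  ultimately show ?thesis unfolding k by simp
qed

text \<open>With a nonnegative quadratic coefficient no Riccati solution comes down from infinity at
  time 0. Up to time T the barrier is 1 / (a t) instead, and from T on the Riccati solution
  \<theta>, whose constant of integration is fixed by continuity at T. The case of equality is
  included; the denominator of \<theta> is then 1.\<close>

lemma Hm_nonneg_after_T2:
  fixes \<alpha> \<beta> :: real
  defines "n \<equiv> real CARD('n)"
  defines "T \<equiv> T2 n c \<alpha> \<beta>" and "a \<equiv> 2 * (1 - \<alpha>) / n"
  defines "\<theta> \<equiv> \<lambda>t. (4 * a * \<beta>^2 / c) * exp (- c * (t - T)) / ((c + 4 * a * \<beta>) / c * exp (- c * (t - T)) + 1)"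
  assumes adm: "admissible n c \<alpha> \<beta>" and nonneg: "c + 4 * a * \<beta> \<ge> 0"
    and p: "p \<in> topspace M" and t: "T \<le> t"
  shows "T > 0" "Hm \<alpha> \<beta> (\<lambda>t. - \<beta> + \<theta> t) p t \<ge> 0"
proof -
  have n: "n > 0" by (simp add: n_def)
  note \<beta> = admissible_negative(1)[OF adm] and \<alpha> = admissible_negative(2,3)[OF adm]
  have a: "a > 0" using \<alpha> n by (simp add: a_def)
  have a\<beta>: "a * \<beta> < 0" using a \<beta> by (simp add: mult_pos_neg)
  have c2: "2 * a * \<beta> + c > 0" using nonneg a\<beta> by linarith
  have T_eq: "T = (2 * a * \<beta> + c) / (a * (- \<beta> * c))"
    using n \<alpha> \<beta> c by (simp add: T_def T2_def a_def field_simps)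
  have den: "a * (- \<beta> * c) > 0" using a \<beta> c by (simp add: mult_pos_neg mult_neg_pos)
  show T: "T > 0" unfolding T_eq by (rule divide_pos_pos[OF c2 den])
  \<comment> \<open>A solution of \<phi>' = - a \<phi>^2. The quadratic in u then loses its constant
    term and factors as u times an expression that is nonnegative for all u in (0, 1) exactly when
    (2 a \<beta> + c) \<phi> \<ge> - \<beta> c, that is, up to time T.\<close>
  define \<phi>1 where "\<phi>1 t = 1 / (a * t)" for t
  define \<phi>1' where "\<phi>1' t = - (1 / (a * t^2))" for t
  have aT: "a * T = (2 * a * \<beta> + c) / (- \<beta> * c)" unfolding T_eq using a by simp
  have lim: "filterlim \<phi>1 at_top (at_right 0)"
    unfolding \<phi>1_def using a by real_asymp
  obtain a0 where a0: "0 < a0" "a0 < T" "\<And>p. p \<in> topspace M \<Longrightarrow> Hm \<alpha> \<beta> \<phi>1 p a0 \<ge> 0"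
    using initial_time[OF lim T] by blast
  have \<phi>1_ge: "(2 * a * \<beta> + c) * \<phi>1 t \<ge> - \<beta> * c" if "0 < t" "t \<le> T" for t
  proof -
    have "a * t \<le> (2 * a * \<beta> + c) / (- \<beta> * c)" unfolding aT[symmetric] using that a by simp
    then have "(a * t) * (- \<beta> * c) \<le> 2 * a * \<beta> + c"
      using \<beta> c by (subst (asm) pos_le_divide_eq) (auto simp: mult_neg_pos)
    then have "- \<beta> * c \<le> (2 * a * \<beta> + c) / (a * t)" using a that by (subst pos_le_divide_eq) (auto simp: mult.commute)
    then show ?thesis by (simp add: \<phi>1_def)
  qed
  have H1: "Hm \<alpha> \<beta> \<phi>1 p T \<ge> 0" if "p \<in> topspace M" for p
  proof (rule Hm_nonneg[where \<phi>' = \<phi>1' and T = T and ?a0.0 = a0])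
    show "(\<phi>1 has_real_derivative \<phi>1' t) (at t)" if "t > 0" for t
      unfolding \<phi>1_def \<phi>1'_def using a that by (auto intro!: derivative_eq_intros simp: field_simps power2_eq_square)
    show "continuous_on {0<..} \<phi>1'" unfolding \<phi>1'_def using a by (intro continuous_intros) auto
    show "- \<beta> \<le> \<phi>1 t" if "a0 < t" "t \<le> T" for t
    proof -
      have "2 * a * \<beta> + c \<le> c" using a\<beta> by linarith
      then have "(2 * a * \<beta> + c) * (- \<beta>) \<le> c * (- \<beta>)" by (rule mult_right_mono) (use \<beta> in simp)
      also have "\<dots> \<le> (2 * a * \<beta> + c) * \<phi>1 t" using \<phi>1_ge[of t] that a0 by (simp add: mult.commute)
      finally show ?thesis using c2 by (simp only: mult_le_cancel_left_pos)
    qed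
    show "0 \<le> 2 * (1 - \<alpha>) / real CARD('n) * (\<beta> * u + \<phi>1 t)^2 + c * u * (\<phi>1 t + \<beta>) + \<phi>1' t"
      if "a0 < t" "t \<le> T" "0 < u" "u < 1" for t u
    proof -
      have tp: "t > 0" using that a0 by simp
      have e: "\<phi>1' t = - (a * (\<phi>1 t)^2)" using a tp by (simp add: \<phi>1'_def \<phi>1_def power2_eq_square)
      have "a * (\<beta> * u + \<phi>1 t)^2 + c * u * (\<phi>1 t + \<beta>) + \<phi>1' t
        = u * (a * \<beta>^2 * u + ((2 * a * \<beta> + c) * \<phi>1 t + \<beta> * c))"
        unfolding e by (simp add: power2_eq_square algebra_simps)
      also have "\<dots> \<ge> 0"
      proof -
        have "(2 * a * \<beta> + c) * \<phi>1 t + \<beta> * c \<ge> 0" using \<phi>1_ge[OF tp that(2)] by simp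
        moreover have "a * \<beta>^2 * u \<ge> 0" using a that by simp
        ultimately show ?thesis using that by simp
      qed
      finally show ?thesis by (simp add: a_def n_def)
    qed
  qed (use adm a0 that in \<open>auto simp: n_def\<close>)
  define B where "B = (c + 4 * a * \<beta>) / c"
  define D where "D = 4 * a * \<beta>^2 / c"
  have B: "B \<ge> 0" using nonneg c by (simp add: B_def)
  have D: "D > 0" using a \<beta> c by (simp add: D_def)
  define y where "y t = exp (- c * (t - T))" for t
  have \<theta>_eq: "\<theta> t = D * y t / (B * y t + 1)" for t by (simp add: \<theta>_def D_def B_def y_def)
  have By: "B * y t + 1 > 0" for t using B by (simp add: y_def add_nonneg_pos)
  define \<phi>' where "\<phi>' t = - c * \<theta> t + c * (c + 4 * a * \<beta>) / (4 * a * \<beta>^2) * (\<theta> t)^2" for t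
  have R: "c * (c + 4 * a * \<beta>) / (4 * a * \<beta>^2) = c * B / D"
    using c a \<beta> by (simp add: B_def D_def)
  have dy: "(y has_real_derivative - c * y t) (at t)" for t
    unfolding y_def by (auto intro!: derivative_eq_intros)
  have d\<phi>: "((\<lambda>t. - \<beta> + \<theta> t) has_real_derivative \<phi>' t) (at t)" for t
  proof -
    have "((\<lambda>t. - \<beta> + \<theta> t) has_real_derivative (D * (- c * y t) * (B * y t + 1) - D * y t * (B * (- c * y t))) / ((B * y t + 1) * (B * y t + 1))) (at t)"
      unfolding \<theta>_eq using By[of t] by (auto intro!: derivative_eq_intros dy)
    moreover have "(D * (- c * y t) * (B * y t + 1) - D * y t * (B * (- c * y t))) / ((B * y t + 1) * (B * y t + 1)) = \<phi>' t"
      unfolding \<phi>'_def R \<theta>_eq using By[of t] D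
      by (simp add: divide_simps power2_eq_square)
    ultimately show ?thesis by simp
  qed
  have nz: "B * exp (- c * (t - T)) + 1 \<noteq> 0" for t using By[of t] by (simp add: y_def)
  have cont: "continuous_on {0<..} \<phi>'"
    unfolding \<phi>'_def \<theta>_eq y_def by (intro continuous_intros ballI nz)
  \<comment> \<open>The two barriers agree at T, so the nonnegativity reached with the first is the
    initial condition for the second.\<close>
  have match: "- \<beta> + \<theta> T = \<phi>1 T"
  proof -
    have "B + 1 = 2 * (2 * a * \<beta> + c) / c" using c by (simp add: B_def field_simps)
    then have 1: "\<theta> T = 2 * a * \<beta>^2 / (2 * a * \<beta> + c)"
      using c c2 by (simp add: \<theta>_eq y_def D_def field_simps)
    have 2: "\<phi>1 T = - \<beta> * c / (2 * a * \<beta> + c)" unfolding \<phi>1_def aT using \<beta> c by simp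
    have "- \<beta> + 2 * a * \<beta>^2 / (2 * a * \<beta> + c) = - \<beta> * c / (2 * a * \<beta> + c)"
      using c2 by (simp add: field_simps power2_eq_square)
    then show ?thesis by (simp only: 1 2)
  qed
  show "Hm \<alpha> \<beta> (\<lambda>t. - \<beta> + \<theta> t) p t \<ge> 0"
  proof (rule Hm_nonneg[where \<phi>' = \<phi>' and T = t and ?a0.0 = T])
    show "- \<beta> \<le> - \<beta> + \<theta> t" for t using By[of t] D by (simp add: \<theta>_eq y_def)
    show "0 \<le> 2 * (1 - \<alpha>) / real CARD('n) * (\<beta> * u + (- \<beta> + \<theta> t))^2 + c * u * ((- \<beta> + \<theta> t) + \<beta>) + \<phi>' t" for t u
      using riccati_square_nonneg[OF a, of \<beta> u "\<theta> t" c] \<beta> unfolding a_def n_def \<phi>'_def by simp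
    show "Hm \<alpha> \<beta> (\<lambda>t. - \<beta> + \<theta> t) p T \<ge> 0" if "p \<in> topspace M" for p
      using H1[OF that] match by (simp add: Hm_def)
  qed (use adm d\<phi> cont T p t in \<open>auto simp: n_def\<close>)
qed

text \<open>Here \<theta> is - k times the logarithmic derivative of B exp (- c (t - T)) + 1, whence
  the power in the estimate.\<close>

lemma harnack_case_positive:
  fixes \<alpha> \<beta> t1 t2 :: real
  defines "n \<equiv> real CARD('n)"
  defines "T \<equiv> T2 n c \<alpha> \<beta>"
  assumes adm: "admissible n c \<alpha> \<beta>" and \<beta>c: "\<beta> + c \<ge> 0" and pos: "8 * \<beta> * (1 - \<alpha>) + c * n > 0"
    and t: "t2 > t1" "t1 > T" and x: "x1 \<in> topspace M" "x2 \<in> topspace M"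
  shows "f x2 t2 / f x1 t1 \<ge>
            (((1 + 8 * \<beta> * (1 - \<alpha>) / (c * n)) * exp (- c * (t2 - T)) + 1) /
             ((1 + 8 * \<beta> * (1 - \<alpha>) / (c * n)) * exp (- c * (t1 - T)) + 1))
              powr (8 * \<beta>^2 * (1 - \<alpha>) / (c * (c * n + 8 * \<beta> * (1 - \<alpha>))))
      * exp (- ((geodesic_dist M A g x1 x2)^2 / (4 * (1 - \<alpha>) * (t2 - t1))))"
proof -
  have n: "n > 0" by (simp add: n_def)
  note \<beta> = admissible_negative(1)[OF adm] and \<alpha> = admissible_negative(2,3)[OF adm]
  define a where "a = 2 * (1 - \<alpha>) / n"
  have a: "a > 0" using \<alpha> n by (simp add: a_def)
  have an: "8 * \<beta> * (1 - \<alpha>) = n * (4 * a * \<beta>)" using n by (simp add: a_def)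
  have pos': "c + 4 * a * \<beta> > 0"
  proof -
    have "n * (c + 4 * a * \<beta>) > 0" using pos unfolding an by (simp add: algebra_simps)
    then show ?thesis using n by (simp add: zero_less_mult_iff)
  qed
  define B where "B = (c + 4 * a * \<beta>) / c"
  define k where "k = 4 * a * \<beta>^2 / (c * (c + 4 * a * \<beta>))"
  have B: "B > 0" using pos' c by (simp add: B_def)
  define \<theta> where "\<theta> t = (4 * a * \<beta>^2 / c) * exp (- c * (t - T)) / (B * exp (- c * (t - T)) + 1)" for t
  note H = Hm_nonneg_after_T2[where \<alpha> = \<alpha> and \<beta> = \<beta>, folded n_def, folded T_def a_def, folded B_def, folded \<theta>_def, OF adm less_imp_le[OF pos']]
  have t1p: "t1 > 0" using H(1)[OF x(1), of t1] t by simp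
  define \<Theta> where "\<Theta> t = - k * ln (B * exp (- c * (t - T)) + 1)" for t
  have By: "B * exp (- c * (t - T)) + 1 > 0" for t using B by (simp add: add_pos_pos)
  have d\<Theta>: "(\<Theta> has_real_derivative \<beta> + (- \<beta> + \<theta> t)) (at t)" for t
  proof -
    have "(\<Theta> has_real_derivative - k * (B * (exp (- c * (t - T)) * - c) / (B * exp (- c * (t - T)) + 1))) (at t)"
      unfolding \<Theta>_def using By[of t] by (auto intro!: derivative_eq_intros)
    moreover have "- k * (B * (z * - c) / z') = (k * B * c) * z / z'" for z z' by (simp add: mult_ac)
    moreover have "k * B * c = 4 * a * \<beta>^2 / c" using pos' c by (simp add: k_def B_def)
    ultimately have "(\<Theta> has_real_derivative \<theta> t) (at t)" by (simp only: \<theta>_def)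
    then show ?thesis by simp
  qed
  have k: "8 * \<beta>^2 * (1 - \<alpha>) / (c * (c * n + 8 * \<beta> * (1 - \<alpha>))) = k"
  proof -
    have k1: "8 * \<beta>^2 * (1 - \<alpha>) = n * (4 * a * \<beta>^2)" using n by (simp add: a_def)
    have k2: "c * (c * n + 8 * \<beta> * (1 - \<alpha>)) = n * (c * (c + 4 * a * \<beta>))"
      unfolding an by (simp add: algebra_simps)
    show ?thesis unfolding k1 k2 k_def using n by simp
  qed
  have BB: "1 + 8 * \<beta> * (1 - \<alpha>) / (c * n) = B"
    unfolding an B_def using n c by (simp add: field_simps)
  have "((B * exp (- c * (t2 - T)) + 1) / (B * exp (- c * (t1 - T)) + 1)) powr k = exp (- (\<Theta> t2 - \<Theta> t1))"
    unfolding powr_quotient[OF By By] unfolding \<Theta>_def by (simp add: right_diff_distrib)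
  moreover have "f x2 t2 / f x1 t1 \<ge> exp (- (\<Theta> t2 - \<Theta> t1)) * exp (- ((geodesic_dist M A g x1 x2)^2 / (4 * (1 - \<alpha>) * (t2 - t1))))"
    by (rule harnack_inequality[OF x t1p t(1) \<alpha>(2) \<beta>c d\<Theta>]) (use H(2) t in auto)
  ultimately show ?thesis unfolding k BB by simp
qed

text \<open>Now the denominator of \<theta> is 1, and 4 a \<beta> = - c reduces \<theta> to -
  \<beta> exp (- c (t - T)); its primitive is an exponential in place of a logarithm.\<close>

lemma harnack_case_zero:
  fixes \<alpha> \<beta> t1 t2 :: real
  defines "n \<equiv> real CARD('n)"
  defines "T \<equiv> T2 n c \<alpha> \<beta>"
  assumes adm: "admissible n c \<alpha> \<beta>" and \<beta>c: "\<beta> + c \<ge> 0" and zero: "8 * \<beta> * (1 - \<alpha>) + c * n = 0"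
    and t: "t2 > t1" "t1 > T" and x: "x1 \<in> topspace M" "x2 \<in> topspace M"
  shows "f x2 t2 / f x1 t1 \<ge> exp (- (\<beta> / c) * (exp (- c * (t2 - T)) - exp (- c * (t1 - T))))
      * exp (- ((geodesic_dist M A g x1 x2)^2 / (4 * (1 - \<alpha>) * (t2 - t1))))"
proof -
  have n: "n > 0" by (simp add: n_def)
  note \<beta> = admissible_negative(1)[OF adm] and \<alpha> = admissible_negative(2,3)[OF adm]
  define a where "a = 2 * (1 - \<alpha>) / n"
  have an: "8 * \<beta> * (1 - \<alpha>) = n * (4 * a * \<beta>)" using n by (simp add: a_def)
  have zero': "c + 4 * a * \<beta> = 0"
  proof -
    have "n * (c + 4 * a * \<beta>) = 0" using zero unfolding an by (simp add: algebra_simps)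
    then show ?thesis using n by simp
  qed
  define \<theta> where "\<theta> t = (4 * a * \<beta>^2 / c) * exp (- c * (t - T)) / ((c + 4 * a * \<beta>) / c * exp (- c * (t - T)) + 1)" for t
  note H = Hm_nonneg_after_T2[where \<alpha> = \<alpha> and \<beta> = \<beta>, folded n_def, folded T_def a_def, folded \<theta>_def, OF adm eq_refl[OF zero'[symmetric]]]
  have t1p: "t1 > 0" using H(1)[OF x(1), of t1] t by simp
  define \<Theta> where "\<Theta> t = (\<beta> / c) * exp (- c * (t - T))" for t
  have d\<Theta>: "(\<Theta> has_real_derivative \<beta> + (- \<beta> + \<theta> t)) (at t)" for t
  proof -
    have "4 * a * \<beta> = - c" using zero' by simp
    then have "4 * a * \<beta>^2 = - c * \<beta>" by (metis mult.assoc power2_eq_square)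
    then have "\<theta> t = - \<beta> * exp (- c * (t - T))" unfolding \<theta>_def zero' using c by simp
    moreover have "(\<Theta> has_real_derivative - \<beta> * exp (- c * (t - T))) (at t)"
      unfolding \<Theta>_def using c by (auto intro!: derivative_eq_intros)
    ultimately show ?thesis by simp
  qed
  have "exp (- (\<beta> / c) * (exp (- c * (t2 - T)) - exp (- c * (t1 - T)))) = exp (- (\<Theta> t2 - \<Theta> t1))"
    unfolding \<Theta>_def by (simp only: right_diff_distrib[symmetric] mult_minus_left)
  moreover have "f x2 t2 / f x1 t1 \<ge> exp (- (\<Theta> t2 - \<Theta> t1)) * exp (- ((geodesic_dist M A g x1 x2)^2 / (4 * (1 - \<alpha>) * (t2 - t1))))"
    by (rule harnack_inequality[OF x t1p t(1) \<alpha>(2) \<beta>c d\<Theta>]) (use H(2) t in auto)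
  ultimately show ?thesis by simp
qed

end

theorem theorem4:
  fixes M :: "'a topology"
    and A :: "('a, 'n::finite) chart set"
    and g :: "('a, 'n) metric"
    and c n :: real
    and f :: "'a \<Rightarrow> real \<Rightarrow> real"
  assumes "closed_riemannian_manifold M A g"
    and "n = real CARD('n)"
    and "nonneg_ricci A g"
    and "c > 0"
    and "fisher_solution A g c f"
    and "\<And>x t. x \<in> topspace M \<Longrightarrow> t \<ge> 0 \<Longrightarrow> 0 < f x t \<and> f x t < 1"
  shows "(\<forall>\<alpha>. 0 < \<alpha> \<and> \<alpha> < 1 \<and> \<alpha> \<le> n / 4 \<longrightarrow> (\<exists>\<beta>. admissible n c \<alpha> \<beta> \<and> \<beta> + c \<ge> 0)) \<and>
    (\<forall>\<alpha> \<beta>. admissible n c \<alpha> \<beta> \<and> \<alpha> \<le> n / 4 \<and> \<beta> + c \<ge> 0 \<longrightarrow>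
      (\<forall>T. T = T2 n c \<alpha> \<beta> \<longrightarrow>
      (\<forall>x1\<in>topspace M. \<forall>x2\<in>topspace M. \<forall>t1 t2.
        (8 * \<beta> * (1 - \<alpha>) + c * n < 0 \<and> t2 > t1 \<and> t1 > 0 \<longrightarrow>
          f x2 t2 / f x1 t1 \<ge>
            ((1 - exp (- c * t2)) / (1 - exp (- c * t1)))
              powr (8 * \<beta>^2 * (1 - \<alpha>) / (c^2 * n + 8 * \<beta> * c * (1 - \<alpha>)))
            * exp (- ((geodesic_dist M A g x1 x2)^2 / (4 * (1 - \<alpha>) * (t2 - t1))))) \<and>
        (8 * \<beta> * (1 - \<alpha>) + c * n > 0 \<and> t2 > t1 \<and> t1 > T \<longrightarrow>
          f x2 t2 / f x1 t1 \<ge>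
            (((1 + 8 * \<beta> * (1 - \<alpha>) / (c * n)) * exp (- c * (t2 - T)) + 1) /
             ((1 + 8 * \<beta> * (1 - \<alpha>) / (c * n)) * exp (- c * (t1 - T)) + 1))
              powr (8 * \<beta>^2 * (1 - \<alpha>) / (c * (c * n + 8 * \<beta> * (1 - \<alpha>))))
            * exp (- ((geodesic_dist M A g x1 x2)^2 / (4 * (1 - \<alpha>) * (t2 - t1))))) \<and>
        (8 * \<beta> * (1 - \<alpha>) + c * n = 0 \<and> t2 > t1 \<and> t1 > T \<longrightarrow>
          f x2 t2 / f x1 t1 \<ge>
            exp (- (\<beta> / c) * (exp (- c * (t2 - T)) - exp (- c * (t1 - T))))
            * exp (- ((geodesic_dist M A g x1 x2)^2 / (4 * (1 - \<alpha>) * (t2 - t1))))))))"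
proof -
  interpret fisher_manifold M A g c f
    using assms unfolding fisher_manifold_def fisher_manifold_axioms_def by blast
  have "n \<ge> 1" using assms(2) by (simp add: Suc_leI)
  then show ?thesis
    using admissible_exists[OF _ c] harnack_case_negative harnack_case_positive harnack_case_zero
    unfolding assms(2) by blast
qed

end
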